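(* Let $n\ge1$, $\rho>0$, and let $\Omega$ be a discrete filtered set which coincides with its upper closure and satisfies $\Omega_{3\rho}=\emptyset$. Let $\delta\in(0,\rho)$, $L>0$, and let $\gamma:[0,1]\to\mathbb{C}$ be a path in $\Pi^{\delta,L}_{\Omega^{*n}}$ for which there exists $a\in(0,1)$ such that $\gamma(t)=\frac{t}{a}\gamma(a)$ for $t\in[0,a]$, $|\gamma(a)|=\rho$, and $\gamma|_{[a,1]}$ is $C^1$. For $t\in[a,1]$ set $$\delta'(t)=\rho\,e^{-2\sqrt2\,\delta^{-1}L(\gamma|_{[a,t]})},\qquad c(t)=\rho\,e^{3\delta^{-1}L(\gamma|_{[a,t]})}.$$ Then there exists a $\gamma$-adapted deformation of the identity $(\Psi_t)_{t\in[a,1]}$ such that for every $t\in[a,1]$ $$\Psi_t(\underline V)\subset\bigcup_{L_1+\cdots+L_n=L(\gamma_{|t})}K^{\delta'(t),L_1}_\Omega\times\cdots\times K^{\delta'(t),L_n}_\Omega ,$$ and, writing $\zeta_i^t(\vec s)=\mathfrak{p}_\Omega\big(i\text{-th component of }\Psi_t(\mathscr{L}(s_1\gamma(a)),\ldots,\mathscr{L}(s_n\gamma(a)))\big)$ for $\vec s=(s_1,\ldots,s_n)\in\Delta_n$ (these are Lipschitz functions on $\Delta_n$), one has for each $t\in[a,1]$ $$\Big|\det\Big[\frac{\partial\zeta_i^t}{\partial s_j}\Big]_{1\le i,j\le n}\Big|\le c(t)^n\quad\text{almost everywhere on }\Delta_n.$$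
   Context: A discrete filtered set (d.f.s.) is a family $\Omega=(\Omega_L)_{L\ge0}$ of finite subsets of $\mathbb{C}$ with $\Omega_{L_1}\subseteq\Omega_{L_2}$ for $L_1\le L_2$ and $\Omega_\delta=\emptyset$ for some $\delta>0$; its upper closure is $\tilde\Omega_L=\bigcap_{\varepsilon>0}\Omega_{L+\varepsilon}$. Sum: $(\Omega*\Omega')_L=\{\omega_1+\omega_2\mid\omega_1\in\Omega_{L_1},\omega_2\in\Omega'_{L_2},L_1+L_2=L\}\cup\Omega_L\cup\Omega'_L$, $\Omega^{*n}$ the $n$-fold sum. $\mathcal{S}_\Omega=\{(\lambda,\omega)\mid\lambda\ge0,\omega\in\Omega_\lambda\}\subset\mathbb{R}\times\mathbb{C}$, $\mathcal{M}_\Omega=(\mathbb{R}\times\mathbb{C})\setminus\overline{\mathcal{S}_\Omega}$. A Lipschitz path $\gamma:[0,t_*]\to\mathbb{C}$, $\gamma(0)=0$, is $\Omega$-allowed if $(L(\gamma_{|t}),\gamma(t))\in\mathcal{M}_\Omega$ for all $t$ ($\gamma_{|t}$ restriction to $[0,t]$, $L$ length). $\Pi^{\delta,L}_\Omega$: $\Omega$-allowed $\gamma$ with $\operatorname{dist}((L(\gamma_{|t}),\gamma(t)),\mathcal{S}_\Omega)\ge\delta$ and $L(\gamma_{|t})\le L$ for all $t$ (Euclidean distance in $\mathbb{R}^3$). $(X_\Omega,\mathfrak{p}_\Omega,\underline0_\Omega)$ is the universal $\Omega$-endless Riemann surface: a connected Riemann surface $X_\Omega$ with a local biholomorphism $\mathfrak{p}_\Omega:X_\Omega\to\mathbb{C}$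 and $\underline0_\Omega\in\mathfrak{p}_\Omega^{-1}(0)$, such that every $\Omega$-allowed path $[0,1]\to\mathbb{C}$ lifts to $X_\Omega$ from $\underline0_\Omega$, which is initial among all such triples (morphisms being local biholomorphisms commuting with projections and preserving base points); $\underline\gamma$ denotes the lift of $\gamma$. $K^{\delta,L}_\Omega=\{\underline\gamma(1)\mid\gamma\in\Pi^{\delta,L}_\Omega\}$. Let $U=\{|\zeta|<3\rho\}$; for $\zeta\in U$, $\mathscr{L}(\zeta)$ is the endpoint of the lift of $t\in[0,1]\mapsto t\zeta$, so $\mathscr{L}:U\to X_\Omega$ is a biholomorphism onto its image with $\mathfrak{p}_\Omega\circ\mathscr{L}=\mathrm{Id}$. $\Delta_n=\{\vec s\in\mathbb{R}_{\ge0}^n\mid s_1+\cdots+s_n\le1\}$. For $\gamma,a$ as in the claim, $\underline V=\{(\mathscr{L}(s_1\gamma(a)),\ldots,\mathscr{L}(s_n\gamma(a)))\mid\vec s\in\Delta_n\}\subset X_\Omega^n$. For $\zeta\in\mathbb{C}$, $\mathcal{N}(\zeta)=\{(\underline\zeta_1,\ldots,\underline\zeta_n)\in X_\Omega^n\mid\sum_j\mathfrak{p}_\Omega(\underline\zeta_j)=\zeta\}$ and $\mathcal{N}_j=\{(\underline\zeta_1,\ldots,\underline\zeta_n)\in X_\Omega^n\mid\underline\zeta_j=\underline0_\Omega\}$. A $\gamma$-adapted deformation of the identity is a family of maps $\Psi_t:\underline V\to X_\Omega^n$, $t\in[a,1]$, with $\Psi_a=\mathrm{Id}$, $(t,\vec{\underline\zeta})\mapsto\Psi_t(\vec{\underline\zeta})$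 locally Lipschitz (in the local coordinates given by $\mathfrak{p}_\Omega$), and for all $t\in[a,1]$ and $j=1,\ldots,n$: $\Psi_t(\underline V\cap\mathcal{N}(\gamma(a)))\subset\mathcal{N}(\gamma(t))$ and $\Psi_t(\underline V\cap\mathcal{N}_j)\subset\mathcal{N}_j$. *)

theory Defs
  imports "HOL-Analysis.Analysis"
begin

type_synonym dfs = "real \<Rightarrow> complex set"

definition is_dfs :: "dfs \<Rightarrow> bool" where
  "is_dfs \<Omega> \<longleftrightarrow> (\<forall>L\<ge>0. finite (\<Omega> L))
     \<and> (\<forall>L1 L2. 0 \<le> L1 \<longrightarrow> L1 \<le> L2 \<longrightarrow> \<Omega> L1 \<subseteq> \<Omega> L2)
     \<and> (\<exists>\<delta>>0. \<Omega> \<delta> = {})"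

definition upper_closure :: "dfs \<Rightarrow> dfs" where
  "upper_closure \<Omega> L = (\<Inter>\<epsilon>\<in>{0<..}. \<Omega> (L + \<epsilon>))"

definition dfs_sum :: "dfs \<Rightarrow> dfs \<Rightarrow> dfs" where
  "dfs_sum \<Omega> \<Omega>' L =
     {w1 + w2 | w1 w2 L1 L2. 0 \<le> L1 \<and> 0 \<le> L2 \<and> L1 + L2 = L \<and> w1 \<in> \<Omega> L1 \<and> w2 \<in> \<Omega>' L2}
     \<union> \<Omega> L \<union> \<Omega>' L"

fun dfs_pow :: "dfs \<Rightarrow> nat \<Rightarrow> dfs" where
  "dfs_pow \<Omega> 0 = (\<lambda>_. {})"
| "dfs_pow \<Omega> (Suc n) = dfs_sum (dfs_pow \<Omega> n) \<Omega>"

definition S_set :: "dfs \<Rightarrow> (real \<times> complex) set" where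
  "S_set \<Omega> = {(l, \<omega>). l \<ge> 0 \<and> \<omega> \<in> \<Omega> l}"

definition M_set :: "dfs \<Rightarrow> (real \<times> complex) set" where
  "M_set \<Omega> = UNIV - closure (S_set \<Omega>)"

definition path_length :: "(real \<Rightarrow> complex) \<Rightarrow> real \<Rightarrow> real \<Rightarrow> real" where
  "path_length \<gamma> u v = Sup {(\<Sum>i<k. cmod (\<gamma> (x (Suc i)) - \<gamma> (x i))) | k x.
       x 0 = u \<and> x k = v \<and> (\<forall>i<k. x i \<le> x (Suc i))}"

definition allowed :: "dfs \<Rightarrow> real \<Rightarrow> (real \<Rightarrow> complex) \<Rightarrow> bool" where
  "allowed \<Omega> tstar \<gamma> \<longleftrightarrow> 0 \<le> tstar \<and> (\<exists>C. C-lipschitz_on {0..tstar} \<gamma>) \<and> \<gamma> 0 = 0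
     \<and> (\<forall>t\<in>{0..tstar}. (path_length \<gamma> 0 t, \<gamma> t) \<in> M_set \<Omega>)"

text \<open>Pi^{delta,L}_Omega (paths parametrised by [0,1]); the Euclidean distance in R x C = R^3
  to S_Omega is at least delta (vacuous if S_Omega is empty).\<close>
definition Pi_set :: "dfs \<Rightarrow> real \<Rightarrow> real \<Rightarrow> (real \<Rightarrow> complex) set" where
  "Pi_set \<Omega> \<delta> L = {\<gamma>. allowed \<Omega> 1 \<gamma> \<and>
      (\<forall>t\<in>{0..1}. (\<forall>q\<in>S_set \<Omega>. dist (path_length \<gamma> 0 t, \<gamma> t) q \<ge> \<delta>)
                   \<and> path_length \<gamma> 0 t \<le> L)}"

text \<open>A Riemann surface with a local biholomorphism p to C is the same as a connected Hausdorff
  space with a local homeomorphism p to C (the complex structure being pulled back by p).\<close>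
definition local_homeo_to_C :: "'x topology \<Rightarrow> ('x \<Rightarrow> complex) \<Rightarrow> bool" where
  "local_homeo_to_C X p \<longleftrightarrow> (\<forall>x\<in>topspace X. \<exists>U. openin X U \<and> x \<in> U \<and> open (p ` U) \<and>
       homeomorphic_map (subtopology X U) (top_of_set (p ` U)) p)"

definition lifts_path :: "'x topology \<Rightarrow> ('x \<Rightarrow> complex) \<Rightarrow> 'x \<Rightarrow> (real \<Rightarrow> complex) \<Rightarrow> (real \<Rightarrow> 'x) \<Rightarrow> bool" where
  "lifts_path X p x0 \<gamma> g \<longleftrightarrow> continuous_map (top_of_set {0..1}) X g \<and> g 0 = x0
      \<and> (\<forall>t\<in>{0..1}. p (g t) = \<gamma> t)"

definition endless_surface :: "dfs \<Rightarrow> 'x topology \<Rightarrow> ('x \<Rightarrow> complex) \<Rightarrow> 'x \<Rightarrow> bool" where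
  "endless_surface \<Omega> X p x0 \<longleftrightarrow> connected_space X \<and> Hausdorff_space X \<and> local_homeo_to_C X p
     \<and> x0 \<in> topspace X \<and> p x0 = 0
     \<and> (\<forall>\<gamma>. allowed \<Omega> 1 \<gamma> \<longrightarrow> (\<exists>g. lifts_path X p x0 \<gamma> g))"

text \<open>Morphisms: continuous maps commuting with the projections and preserving base points
  (these are automatically local biholomorphisms).  Initiality is quantified over triples whose
  underlying space is carried by a subset of the reals: every connected surface with a local
  homeomorphism to C is second countable, hence of cardinality at most the continuum, so this
  covers all triples up to isomorphism.\<close>
definition universal_endless_surface :: "dfs \<Rightarrow> 'x topology \<Rightarrow> ('x \<Rightarrow> complex) \<Rightarrow> 'x \<Rightarrow> bool" where
  "universal_endless_surface \<Omega> X p x0 \<longleftrightarrow> endless_surface \<Omega> X p x0 \<and>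
     (\<forall>(Y::real topology) q y0. endless_surface \<Omega> Y q y0 \<longrightarrow>
        (\<exists>f. continuous_map X Y f \<and> (\<forall>x\<in>topspace X. q (f x) = p x) \<and> f x0 = y0 \<and>
             (\<forall>g. continuous_map X Y g \<and> (\<forall>x\<in>topspace X. q (g x) = p x) \<and> g x0 = y0
                  \<longrightarrow> (\<forall>x\<in>topspace X. g x = f x))))"

text \<open>The lift of a path (unique, by Hausdorffness and local homeomorphy).\<close>
definition lift :: "'x topology \<Rightarrow> ('x \<Rightarrow> complex) \<Rightarrow> 'x \<Rightarrow> (real \<Rightarrow> complex) \<Rightarrow> real \<Rightarrow> 'x" where
  "lift X p x0 \<gamma> = (SOME g. lifts_path X p x0 \<gamma> g)"

definition K_set :: "dfs \<Rightarrow> 'x topology \<Rightarrow> ('x \<Rightarrow> complex) \<Rightarrow> 'x \<Rightarrow> real \<Rightarrow> real \<Rightarrow> 'x set" where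
  "K_set \<Omega> X p x0 \<delta> L = {lift X p x0 \<gamma> 1 | \<gamma>. \<gamma> \<in> Pi_set \<Omega> \<delta> L}"

definition Lmap :: "'x topology \<Rightarrow> ('x \<Rightarrow> complex) \<Rightarrow> 'x \<Rightarrow> complex \<Rightarrow> 'x" where
  "Lmap X p x0 \<zeta> = lift X p x0 (\<lambda>t. of_real t * \<zeta>) 1"

definition Delta_simplex :: "(real^'n::finite) set" where
  "Delta_simplex = {s. (\<forall>i. 0 \<le> s $ i) \<and> (\<Sum>i\<in>UNIV. s $ i) \<le> 1}"

definition Vset :: "'x topology \<Rightarrow> ('x \<Rightarrow> complex) \<Rightarrow> 'x \<Rightarrow> complex \<Rightarrow> ('n::finite \<Rightarrow> 'x) set" where
  "Vset X p x0 w = {(\<lambda>i. Lmap X p x0 (of_real (s $ i) * w)) | s. s \<in> Delta_simplex}"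

definition loc_lipschitz_coords ::
  "'x topology \<Rightarrow> ('x \<Rightarrow> complex) \<Rightarrow> real \<Rightarrow> ('n::finite \<Rightarrow> 'x) set
     \<Rightarrow> (real \<Rightarrow> ('n \<Rightarrow> 'x) \<Rightarrow> ('n \<Rightarrow> 'x)) \<Rightarrow> bool" where
  "loc_lipschitz_coords X p a V \<Psi> \<longleftrightarrow>
     (let D = prod_topology (top_of_set {a..1}) (subtopology (product_topology (\<lambda>_. X) UNIV) V) in
      continuous_map D (product_topology (\<lambda>_. X) UNIV) (\<lambda>(t, v). \<Psi> t v) \<and>
      (\<forall>z\<in>topspace D. \<exists>W C. openin D W \<and> z \<in> W \<and>
          (\<forall>(t, v)\<in>W. \<forall>(t', v')\<in>W.
             norm ((\<chi> i. p (\<Psi> t v i) - p (\<Psi> t' v' i)) :: complex^'n)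
               \<le> C * (\<bar>t - t'\<bar> + norm ((\<chi> i. p (v i) - p (v' i)) :: complex^'n)))))"

definition adapted_deformation ::
  "'x topology \<Rightarrow> ('x \<Rightarrow> complex) \<Rightarrow> 'x \<Rightarrow> (real \<Rightarrow> complex) \<Rightarrow> real
     \<Rightarrow> (real \<Rightarrow> ('n::finite \<Rightarrow> 'x) \<Rightarrow> ('n \<Rightarrow> 'x)) \<Rightarrow> bool" where
  "adapted_deformation X p x0 \<gamma> a \<Psi> \<longleftrightarrow>
     (let V = (Vset X p x0 (\<gamma> a) :: ('n \<Rightarrow> 'x) set) in
      (\<forall>v\<in>V. \<Psi> a v = v) \<and>
      (\<forall>t\<in>{a..1}. \<forall>v\<in>V. \<forall>i. \<Psi> t v i \<in> topspace X) \<and>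
      loc_lipschitz_coords X p a V \<Psi> \<and>
      (\<forall>t\<in>{a..1}. \<forall>v\<in>V. (\<Sum>i\<in>UNIV. p (v i)) = \<gamma> a \<longrightarrow> (\<Sum>i\<in>UNIV. p (\<Psi> t v i)) = \<gamma> t) \<and>
      (\<forall>t\<in>{a..1}. \<forall>v\<in>V. \<forall>j. v j = x0 \<longrightarrow> \<Psi> t v j = x0))"

definition C1_on_interval :: "(real \<Rightarrow> complex) \<Rightarrow> real \<Rightarrow> real \<Rightarrow> bool" where
  "C1_on_interval \<gamma> a b \<longleftrightarrow> (\<exists>D. continuous_on {a..b} D \<and>
      (\<forall>x\<in>{a..b}. (\<gamma> has_vector_derivative D x) (at x within {a..b})))"

end

theory Submission
  imports Defs
begin

text \<open>
  Write \<open>l\<close> for the arc length of \<open>\<gamma>\<close> from \<open>a\<close>. On the face \<open>\<Sum> s\<^sub>i = 1\<close> the points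
  \<open>v\<^sub>i = (\<lambda>\<^sub>i, \<zeta>\<^sub>i)\<close> should follow the flow \<open>v\<^sub>i' = f\<^sub>i (1, \<gamma>')\<close> with
  \<open>f\<^sub>i = \<eta> v\<^sub>i / \<Sum> \<eta> v\<^sub>j\<close>, where \<open>\<eta>\<close> is the distance to the origin and the singular set.
  As \<open>\<Sum> f\<^sub>i = 1\<close>, the sum of the \<open>v\<^sub>i\<close> stays on \<open>\<gamma>\<close>, so that the weights add up to at least \<open>\<delta>\<close>,
  and \<open>\<eta> v\<^sub>i\<close> changes at a rate of at most \<open>\<surd>2 / \<delta>\<close>.

  All of this survives if the flow is replaced by an Euler scheme with small steps, because \<open>f\<^sub>i\<close> is
  frozen while \<open>\<gamma>\<close> itself is followed exactly. So no differential equation has to be solved, and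
  replacing \<open>\<eta>\<close> by a regularised distance, differentiable off its zero set, makes the scheme
  differentiable in the initial values. The \<open>l\<^sup>1\<close> norms of the columns of the Jacobian then grow at
  a rate of at most \<open>2 \<surd>2 / (\<theta> \<delta>) \<le> 3 / \<delta>\<close>.

  Off the face, \<open>\<Psi>\<^sub>t\<close> sends \<open>s\<close> to \<open>G (e\<^bsup>l(t)/\<delta>\<^esup> s)\<close>, where \<open>G\<close> is linear up to the face and
  follows the face trajectory of the direction of \<open>z\<close> for the arc length \<open>\<delta> ln (\<Sum> z\<^sub>i)\<close> beyond it.
  The Jacobian of \<open>G\<close> is a rank-one modification of the one on the face, and since the columns of
  the latter all have sum \<open>\<gamma> a\<close>, the modification multiplies the determinant by a factor of modulus
  at most \<open>1\<close>. The deformation lifts because \<open>r \<mapsto> G (r z)\<close> is an allowed path in each component.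
\<close>

section \<open>Length of paths\<close>

text \<open>The constants arise as follows. The rate \<open>2 * sqrt 2 / \<delta>\<close> is twice
  the rate \<open>sqrt 2 / \<delta>\<close> of a single component. A component that starts below
  about 2 \<rho> exp(- sqrt 2 l / \<delta>) grows by at most one such exponential and stays within 2
  \<rho> of the origin, where the emptiness of \<Omega> at level 3 \<rho> leaves a margin \<rho>;
  any other component starts above that threshold and loses a second exponential. The exponent
  \<open>3 / \<delta>\<close> of the Jacobian is met twice. On the face it is a bound for 2 sqrt 2 /
  (\<theta> \<delta>), and 2 sqrt 2 < 3 leaves room for \<theta> < 1. Beyond the face, dividing by
  the sum of the coordinates lowers it to 2 / \<delta>, and the dilation by exp(l / \<delta>) brings
  it back. The logarithm carries the factor \<delta> so that the radial derivative is governed by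
  \<delta> g', which is shorter than \<open>g 0\<close>: this ratio is the rank-one factor. The
  scheme has kinks at its nodes, and a unit-speed parametrisation may fail to be differentiable at
  levels where \<gamma>' vanishes. Both are null sets of levels, the latter by Sard's
  theorem.\<close>

lemma chain_le:
  fixes x :: "nat \<Rightarrow> real"
  assumes "\<And>i. i < k \<Longrightarrow> x i \<le> x (Suc i)" "i \<le> j" "j \<le> k"
  shows "x i \<le> x j"
  using assms(2,3)
proof (induction j)
  case (Suc j)
  then show ?case using assms(1)[of j] by (cases "i = Suc j") auto
qed simp

lemma partition_sum_le:
  fixes x :: "nat \<Rightarrow> real"
  assumes ctrl: "\<And>s t. u \<le> s \<Longrightarrow> s \<le> t \<Longrightarrow> t \<le> v \<Longrightarrow> cmod (\<gamma> t - \<gamma> s) \<le> l t - l s"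
    and x: "x 0 = u" "x k = v" "\<And>i. i < k \<Longrightarrow> x i \<le> x (Suc i)"
  shows "(\<Sum>i<k. cmod (\<gamma> (x (Suc i)) - \<gamma> (x i))) \<le> l v - l u"
proof -
  have in_uv: "u \<le> x i" "x i \<le> v" if "i \<le> k" for i
    using chain_le[of k x 0 i] chain_le[of k x i k] x that by auto
  have "(\<Sum>i<k. cmod (\<gamma> (x (Suc i)) - \<gamma> (x i))) \<le> (\<Sum>i<k. l (x (Suc i)) - l (x i))"
    using in_uv x(3) by (intro sum_mono ctrl) auto
  also have "\<dots> = l (x k) - l (x 0)" by (rule sum_lessThan_telescope)
  finally show ?thesis by (simp add: x)
qed

text \<open>Telescoping along a partition. Later \<open>l\<close> is the first component of the
  scheme, so that lengths of its paths need only be bounded, never computed.\<close>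

lemma path_length_le:
  assumes "u \<le> v" and ctrl: "\<And>s t. u \<le> s \<Longrightarrow> s \<le> t \<Longrightarrow> t \<le> v \<Longrightarrow> cmod (\<gamma> t - \<gamma> s) \<le> l t - l s"
  shows "path_length \<gamma> u v \<le> l v - l u"
  unfolding path_length_def
proof (rule cSup_least)
  let ?x = "\<lambda>i::nat. if i = 0 then u else v"
  show "{\<Sum>i<k. cmod (\<gamma> (x (Suc i)) - \<gamma> (x i)) |k x. x 0 = u \<and> x k = v \<and> (\<forall>i<k. x i \<le> x (Suc i))} \<noteq> {}"
    using assms(1) by (auto intro!: exI[of _ "Suc 0"] exI[of _ ?x])
next
  fix S assume "S \<in> {\<Sum>i<k. cmod (\<gamma> (x (Suc i)) - \<gamma> (x i)) |k x. x 0 = u \<and> x k = v \<and> (\<forall>i<k. x i \<le> x (Suc i))}"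
  then obtain k x where S: "S = (\<Sum>i<k. cmod (\<gamma> (x (Suc i)) - \<gamma> (x i)))"
    and x: "x 0 = u" "x k = v" "\<And>i. i < k \<Longrightarrow> x i \<le> x (Suc i)" by blast
  show "S \<le> l v - l u" unfolding S using ctrl x by (rule partition_sum_le)
qed

lemma path_length_ge_partition_sum:
  assumes lip: "C-lipschitz_on {u..v} \<gamma>"
    and x: "x 0 = u" "x k = v" "\<And>i. i < k \<Longrightarrow> x i \<le> x (Suc i)"
  shows "(\<Sum>i<k. cmod (\<gamma> (x (Suc i)) - \<gamma> (x i))) \<le> path_length \<gamma> u v"
  unfolding path_length_def
proof (rule cSup_upper)
  have "cmod (\<gamma> t - \<gamma> s) \<le> C * t - C * s" if "u \<le> s" "s \<le> t" "t \<le> v" for s t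
    using lipschitz_onD[OF lip, of t s] that by (simp add: dist_norm algebra_simps)
  then show "bdd_above {\<Sum>i<k. cmod (\<gamma> (x (Suc i)) - \<gamma> (x i)) |k x. x 0 = u \<and> x k = v \<and> (\<forall>i<k. x i \<le> x (Suc i))}"
    by (intro bdd_aboveI[of _ "C * v - C * u"]) (auto intro!: partition_sum_le[where l = "\<lambda>t. C * t"])
qed (use x in blast)

text \<open>A partition of \<open>{v..w}\<close> becomes one of \<open>{u..w}\<close> when
  \<open>u\<close> is prepended, with the chord from \<open>u\<close> to \<open>v\<close> as its
  additional term.\<close>

lemma path_length_superadditive:
  assumes lip: "C-lipschitz_on {u..w} \<gamma>" and uvw: "u \<le> v" "v \<le> w"
  shows "cmod (\<gamma> v - \<gamma> u) + path_length \<gamma> v w \<le> path_length \<gamma> u w"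
proof -
  have "path_length \<gamma> v w \<le> path_length \<gamma> u w - cmod (\<gamma> v - \<gamma> u)"
    unfolding path_length_def[of _ v]
  proof (rule cSup_least)
    let ?x = "\<lambda>i::nat. if i = 0 then v else w"
    show "{\<Sum>i<k. cmod (\<gamma> (x (Suc i)) - \<gamma> (x i)) |k x. x 0 = v \<and> x k = w \<and> (\<forall>i<k. x i \<le> x (Suc i))} \<noteq> {}"
      using uvw by (auto intro!: exI[of _ "Suc 0"] exI[of _ ?x])
    fix S assume "S \<in> {\<Sum>i<k. cmod (\<gamma> (x (Suc i)) - \<gamma> (x i)) |k x. x 0 = v \<and> x k = w \<and> (\<forall>i<k. x i \<le> x (Suc i))}"
    then obtain k x where S: "S = (\<Sum>i<k. cmod (\<gamma> (x (Suc i)) - \<gamma> (x i)))"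
      and x: "x 0 = v" "x k = w" "\<And>i. i < k \<Longrightarrow> x i \<le> x (Suc i)" by blast
    define y where "y i = (case i of 0 \<Rightarrow> u | Suc j \<Rightarrow> x j)" for i
    have "(\<Sum>i<Suc k. cmod (\<gamma> (y (Suc i)) - \<gamma> (y i))) \<le> path_length \<gamma> u w"
      by (rule path_length_ge_partition_sum[OF lip])
        (use x uvw in \<open>auto simp: y_def split: nat.splits\<close>)
    then show "S \<le> path_length \<gamma> u w - cmod (\<gamma> v - \<gamma> u)"
      unfolding S sum.lessThan_Suc_shift by (simp add: y_def x)
  qed
  then show ?thesis by simp
qed

text \<open>On a piece of length \<open>h\<close> on which \<open>D\<close> varies by at most
  \<epsilon>, chord and integral both lie within \<open>\<epsilon> * h\<close> of \<open>h\<close>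
  times the speed at the left end. This one inequality is enough: replacing the integral by the
  larger \<open>path_length\<close> relaxes both the required distance and the determinant
  bound.\<close>

lemma integral_speed_le_path_length:
  fixes \<gamma> :: "real \<Rightarrow> complex"
  assumes ab: "a \<le> b" and cD: "continuous_on {a..b} D"
    and der: "\<And>x. x \<in> {a..b} \<Longrightarrow> (\<gamma> has_vector_derivative D x) (at x within {a..b})"
    and lip: "C-lipschitz_on {a..b} \<gamma>"
  shows "integral {a..b} (\<lambda>x. cmod (D x)) \<le> path_length \<gamma> a b"
proof (rule field_le_epsilon)
  fix e :: real assume e: "e > 0"
  \<comment> \<open>The summand 1 keeps the quotient meaningful when \<open>a = b\<close>.\<close>
  define \<epsilon> where "\<epsilon> = e / (2 * (b - a + 1))"
  have eps: "\<epsilon> > 0" "2 * \<epsilon> * (b - a) \<le> e"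
    using e ab by (auto simp: \<epsilon>_def field_simps)
  have "uniformly_continuous_on {a..b} D" by (intro compact_uniformly_continuous cD compact_Icc)
  then obtain d where d: "d > 0" "\<And>x y. x \<in> {a..b} \<Longrightarrow> y \<in> {a..b} \<Longrightarrow> dist y x < d \<Longrightarrow> dist (D y) (D x) < \<epsilon>"
    unfolding uniformly_continuous_on_def using eps(1) by meson
  obtain N where N: "real N > (b - a) / d" using reals_Archimedean2 by blast
  have N0: "0 < real N" using N ab d(1) divide_nonneg_pos[of "b - a" d] by linarith
  define h where "h = (b - a) / real N"
  have h: "0 \<le> h" "h < d" using ab N N0 d(1) by (auto simp: h_def field_simps)
  define x where "x i = a + real i * h" for i
  have x0: "x 0 = a" and xN: "x N = b" and xS: "x (Suc i) = x i + h" for i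
    using N0 by (auto simp: x_def h_def distrib_right add_divide_distrib)
  have xle: "x i \<le> x (Suc i)" for i using h by (simp add: xS)
  have xin: "a \<le> x i" "x i \<le> b" if "i \<le> N" for i
    using chain_le[of N x 0 i] chain_le[of N x i N] xle that x0 xN by auto
  let ?I = "\<lambda>y. integral {a..y} (\<lambda>x. cmod (D x))"
  have piece: "?I (x (Suc i)) - ?I (x i) \<le> cmod (\<gamma> (x (Suc i)) - \<gamma> (x i)) + 2 * \<epsilon> * h"
    if i: "i < N" for i
  proof -
    have sub: "{x i..x (Suc i)} \<subseteq> {a..b}" using xin[of i] xin[of "Suc i"] i by auto
    have icD: "(\<lambda>x. cmod (D x)) integrable_on {a..x (Suc i)}"
      using xin[of "Suc i"] i by (intro integrable_continuous_interval continuous_intros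
          continuous_on_subset[OF cD]) auto
    have icD': "(\<lambda>x. cmod (D x)) integrable_on {x i..x (Suc i)}"
      by (intro integrable_continuous_interval continuous_intros continuous_on_subset[OF cD] sub)
    have "?I (x (Suc i)) - ?I (x i) = integral {x i..x (Suc i)} (\<lambda>x. cmod (D x))"
      using Henstock_Kurzweil_Integration.integral_combine[OF _ xle icD] xin[of i] i by force
    also have "\<dots> \<le> integral {x i..x (Suc i)} (\<lambda>_. cmod (D (x i)) + \<epsilon>)"
    proof (rule integral_le[OF icD'])
      fix y assume y: "y \<in> {x i..x (Suc i)}"
      have "dist (D y) (D (x i)) < \<epsilon>"
        using y sub h xS[of i] xle[of i] by (intro d(2)) (auto simp: dist_real_def)
      then show "cmod (D y) \<le> cmod (D (x i)) + \<epsilon>"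
        using norm_triangle_ineq2[of "D y" "D (x i)"] by (simp add: dist_norm)
    qed auto
    also have "\<dots> = (cmod (D (x i)) + \<epsilon>) * h" using xS h by simp
    finally have 1: "?I (x (Suc i)) - ?I (x i) \<le> (cmod (D (x i)) + \<epsilon>) * h" .
    have "cmod (\<gamma> (x (Suc i)) - \<gamma> (x i) - (x (Suc i) - x i) *\<^sub>R D (x i)) \<le> norm (x (Suc i) - x i) * \<epsilon>"
    proof (rule vector_differentiable_bound_linearization[where S = "{x i..x (Suc i)}" and f' = D])
      show "(\<gamma> has_vector_derivative D y) (at y within {x i..x (Suc i)})"
        if "y \<in> {x i..x (Suc i)}" for y
        using der[of y] sub that by (blast intro: has_vector_derivative_within_subset)
      show "cmod (D y - D (x i)) \<le> \<epsilon>" if "y \<in> {x i..x (Suc i)}" for y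
        using d(2)[of "x i" y] that sub h xS[of i] xle[of i] by (auto simp: dist_norm dist_real_def less_imp_le)
    qed (use xle in \<open>auto simp: closed_segment_eq_real_ivl\<close>)
    then have "cmod ((x (Suc i) - x i) *\<^sub>R D (x i)) \<le> cmod (\<gamma> (x (Suc i)) - \<gamma> (x i)) + h * \<epsilon>"
      using norm_triangle_ineq3[of "\<gamma> (x (Suc i)) - \<gamma> (x i)" "(x (Suc i) - x i) *\<^sub>R D (x i)"] xS h by auto
    then show ?thesis using 1 xS h by (simp add: algebra_simps)
  qed
  have "?I b = (\<Sum>i<N. ?I (x (Suc i)) - ?I (x i))"
    using sum_lessThan_telescope[of "\<lambda>i. ?I (x i)" N] by (simp add: x0 xN)
  also have "\<dots> \<le> (\<Sum>i<N. cmod (\<gamma> (x (Suc i)) - \<gamma> (x i)) + 2 * \<epsilon> * h)"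
    using piece by (intro sum_mono) auto
  also have "\<dots> = (\<Sum>i<N. cmod (\<gamma> (x (Suc i)) - \<gamma> (x i))) + 2 * \<epsilon> * (b - a)"
    using N0 by (simp add: sum.distrib h_def)
  also have "\<dots> \<le> path_length \<gamma> a b + e"
    using path_length_ge_partition_sum[of C a b \<gamma> x N, OF lip x0 xN xle] eps(2) by simp
  finally show "?I b \<le> path_length \<gamma> a b + e" .
qed

text \<open>The curve moves by at most the increase of \<open>l\<close>, so \<open>g\<close> does
  not depend on the preimages that \<open>\<sigma>\<close> chooses. Where the speed is nonzero,
  \<open>l\<close> increases strictly at the point, which makes \<open>\<sigma>\<close> continuous
  there and the inverse function rule applicable.\<close>

lemma arclength_reparametrisation:
  fixes \<gamma> D :: "real \<Rightarrow> complex"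
  assumes ab: "a \<le> b" and cD: "continuous_on {a..b} D"
    and der: "\<And>x. x \<in> {a..b} \<Longrightarrow> (\<gamma> has_vector_derivative D x) (at x within {a..b})"
    and l: "\<And>t. l t = integral {a..t} (\<lambda>x. cmod (D x))"
  obtains g where "\<And>t. t \<in> {a..b} \<Longrightarrow> g (l t) = \<gamma> t"
    "\<And>s t. 0 \<le> s \<Longrightarrow> s \<le> t \<Longrightarrow> t \<le> l b \<Longrightarrow> cmod (g t - g s) \<le> t - s"
    "\<And>t. t \<in> {a..b} \<Longrightarrow> D t \<noteq> 0 \<Longrightarrow> 0 < l t \<Longrightarrow> l t < l b \<Longrightarrow>
        \<exists>g'. (g has_vector_derivative g') (at (l t)) \<and> cmod g' \<le> 1"
    "l a = 0" "\<And>s t. a \<le> s \<Longrightarrow> s \<le> t \<Longrightarrow> t \<le> b \<Longrightarrow> l s \<le> l t"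
    "\<And>t. t \<in> {a..b} \<Longrightarrow> (l has_real_derivative cmod (D t)) (at t within {a..b})"
    "\<And>x. 0 \<le> x \<Longrightarrow> x \<le> l b \<Longrightarrow> \<exists>t\<in>{a..b}. l t = x"
proof -
  have cn: "continuous_on {a..b} (\<lambda>x. cmod (D x))" by (intro continuous_intros cD)
  have int: "(\<lambda>x. cmod (D x)) integrable_on {s..t}" if "a \<le> s" "t \<le> b" for s t
    using that by (intro integrable_continuous_interval continuous_on_subset[OF cn]) auto
  have diff: "l t - l s = integral {s..t} (\<lambda>x. cmod (D x))" if "a \<le> s" "s \<le> t" "t \<le> b" for s t
    using Henstock_Kurzweil_Integration.integral_combine[OF that(1,2) int[of a t]] that by (simp add: l)
  have mono: "l s \<le> l t" if "a \<le> s" "s \<le> t" "t \<le> b" for s t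
    using diff[OF that] Henstock_Kurzweil_Integration.integral_nonneg[OF int[OF that(1,3)]] by simp
  have ctrl: "cmod (\<gamma> t - \<gamma> s) \<le> l t - l s" if st: "a \<le> s" "s \<le> t" "t \<le> b" for s t
  proof -
    have "(D has_integral (\<gamma> t - \<gamma> s)) {s..t}"
      using st by (intro fundamental_theorem_of_calculus)
        (auto intro: has_vector_derivative_within_subset[OF der])
    then have "\<gamma> t - \<gamma> s = integral {s..t} D" "D integrable_on {s..t}"
      by (auto simp: integral_unique has_integral_integrable)
    then show ?thesis
      using integral_norm_bound_integral[of D "{s..t}" "\<lambda>x. cmod (D x)"] int[OF st(1,3)] diff[OF st] by simp
  qed
  have la: "l a = 0" by (simp add: l)
  have dl: "(l has_real_derivative cmod (D t)) (at t within {a..b})" if "t \<in> {a..b}" for t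
    using integral_has_real_derivative[OF cn that] by (simp add: l[abs_def])
  have cl: "continuous_on {a..b} l"
    by (rule DERIV_continuous_on[OF dl])
  have ex: "\<exists>t\<in>{a..b}. l t = x" if "0 \<le> x" "x \<le> l b" for x
    using IVT'[of l a x b] that la ab cl by auto
  define \<sigma> where "\<sigma> x = (SOME t. t \<in> {a..b} \<and> l t = x)" for x
  have sg: "\<sigma> x \<in> {a..b}" "l (\<sigma> x) = x" if "0 \<le> x" "x \<le> l b" for x
    using someI_ex[of "\<lambda>t. t \<in> {a..b} \<and> l t = x"] ex[OF that] unfolding \<sigma>_def by blast+
  have ctrl': "cmod (\<gamma> t - \<gamma> s) \<le> \<bar>l t - l s\<bar>" if "s \<in> {a..b}" "t \<in> {a..b}" for s t
    using ctrl[of s t] ctrl[of t s] that by (cases "s \<le> t") (auto simp: norm_minus_commute)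
  define g where "g x = \<gamma> (\<sigma> x)" for x
  have gl: "g (l t) = \<gamma> t" if t: "t \<in> {a..b}" for t
  proof -
    have "0 \<le> l t" "l t \<le> l b" using mono[of a t] mono[of t b] t la by auto
    then show ?thesis using ctrl'[OF sg(1)[of "l t"] t] sg(2)[of "l t"] by (simp add: g_def)
  qed
  have glip: "cmod (g t - g s) \<le> t - s" if "0 \<le> s" "s \<le> t" "t \<le> l b" for s t
    using ctrl'[OF sg(1) sg(1), of s t] sg(2)[of s] sg(2)[of t] that by (simp add: g_def)
  have gd: "\<exists>g'. (g has_vector_derivative g') (at (l t)) \<and> cmod g' \<le> 1"
    if t: "t \<in> {a..b}" "D t \<noteq> 0" "0 < l t" "l t < l b" for t
  proof -
    have tab: "a < t" "t < b" using t la by (auto simp: less_le)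
    then have int: "at t within {a..b} = at t" by (intro at_within_interior) simp
    have dlt: "DERIV l t :> cmod (D t)" using dl[OF t(1)] int by simp
    have c: "0 < cmod (D t)" using t by simp
    obtain d1 where d1: "d1 > 0" "\<And>h. 0 < h \<Longrightarrow> h < d1 \<Longrightarrow> l t < l (t + h)"
      using DERIV_pos_inc_right[OF dlt c] by blast
    obtain d2 where d2: "d2 > 0" "\<And>h. 0 < h \<Longrightarrow> h < d2 \<Longrightarrow> l (t - h) < l t"
      using DERIV_pos_inc_left[OF dlt c] by blast
    \<comment> \<open>Monotonicity of \<open>l\<close> together with its strict increase at
      \<open>t\<close> traps \<open>\<sigma> x\<close> between \<open>t - h\<close> and
      \<open>t + h\<close>.\<close>
    have near: "\<exists>e>0. \<forall>x. \<bar>x - l t\<bar> < e \<longrightarrow> 0 \<le> x \<and> x \<le> l b \<and> \<bar>\<sigma> x - t\<bar> < \<epsilon>" if "\<epsilon> > 0" for \<epsilon>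
    proof -
      define m where "m = min \<epsilon> (min d1 (min d2 (min (t - a) (b - t))))"
      define h where "h = m / 2"
      have m: "0 < m" "m \<le> \<epsilon>" "m \<le> d1" "m \<le> d2" "m \<le> t - a" "m \<le> b - t"
        using that d1(1) d2(1) tab unfolding m_def
        by (simp_all only: min_less_iff_conj min_le_iff_disj order_refl simp_thms) linarith
      have h: "0 < h" "h < \<epsilon>" "h < d1" "h < d2" "a < t - h" "t + h < b"
        using m unfolding h_def by linarith+
      have lt: "l (t - h) < l t" "l t < l (t + h)" using d1(2) d2(2) h by auto
      show ?thesis
      proof (intro exI[of _ "min (l t - l (t - h)) (l (t + h) - l t)"] conjI allI impI)
        show "0 < min (l t - l (t - h)) (l (t + h) - l t)" using lt by simp
        fix x assume x: "\<bar>x - l t\<bar> < min (l t - l (t - h)) (l (t + h) - l t)"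
        then have xb: "l (t - h) < x" "x < l (t + h)" by auto
        show x0: "0 \<le> x" "x \<le> l b" using xb mono[of a "t - h"] mono[of "t + h" b] h la by auto
        have "t - h < \<sigma> x"
          using xb(1) mono[of "\<sigma> x" "t - h"] sg[OF x0] h tab by (cases "\<sigma> x \<le> t - h") auto
        moreover have "\<sigma> x < t + h"
          using xb(2) mono[of "t + h" "\<sigma> x"] sg[OF x0] h tab by (cases "t + h \<le> \<sigma> x") auto
        ultimately show "\<bar>\<sigma> x - t\<bar> < \<epsilon>" using h by auto
      qed
    qed
    have st: "\<sigma> (l t) = t"
    proof (rule ccontr)
      assume "\<sigma> (l t) \<noteq> t"
      then obtain e where "e > 0" "\<And>x. \<bar>x - l t\<bar> < e \<Longrightarrow> \<bar>\<sigma> x - t\<bar> < \<bar>\<sigma> (l t) - t\<bar>"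
        using near[of "\<bar>\<sigma> (l t) - t\<bar>"] by auto
      from this(2)[of "l t"] this(1) show False by simp
    qed
    have cont: "isCont \<sigma> (l t)"
      unfolding continuous_at_eps_delta using near st by (fastforce simp: dist_real_def)
    have ds: "DERIV \<sigma> (l t) :> inverse (cmod (D t))"
      by (rule DERIV_inverse_function[where f = l and a = 0 and b = "l b"])
        (use dlt c t cont st sg in auto)
    have "(\<gamma> has_vector_derivative D t) (at (\<sigma> (l t)))" using der[OF t(1)] int st by simp
    from vector_diff_chain_at[OF ds[unfolded has_real_derivative_iff_has_vector_derivative] this]
    have "(g has_vector_derivative inverse (cmod (D t)) *\<^sub>R D t) (at (l t))"
      by (simp add: o_def g_def[abs_def])
    then show ?thesis using c by (intro exI[of _ "inverse (cmod (D t)) *\<^sub>R D t"]) simp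
  qed
  show ?thesis by (rule that[of g]) (fact gl glip gd la mono dl ex)+
qed

section \<open>Lifting paths\<close>

text \<open>The coincidence set is closed because \<open>X\<close> is Hausdorff, and open because
  \<open>p\<close> is locally injective.\<close>

lemma local_homeo_lift_unique:
  fixes S :: "'b::topological_space set"
  assumes haus: "Hausdorff_space X" and lh: "local_homeo_to_C X p" and conn: "connected S"
    and g: "continuous_map (top_of_set S) X g" and g': "continuous_map (top_of_set S) X g'"
    and eq: "\<And>t. t \<in> S \<Longrightarrow> p (g t) = p (g' t)"
    and t0: "t0 \<in> S" "g t0 = g' t0" and t: "t \<in> S"
  shows "g t = g' t"
proof -
  let ?A = "{t \<in> topspace (top_of_set S). g t = g' t}"
  have cl: "closedin (top_of_set S) ?A"
    using haus g g' by (rule closedin_continuous_maps_eq)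
  have op: "openin (top_of_set S) ?A"
  proof (subst openin_subopen, intro ballI)
    fix t assume "t \<in> ?A"
    then have t: "t \<in> S" "g t = g' t" by auto
    have "g t \<in> topspace X" using continuous_map_image_subset_topspace[OF g] t(1) by auto
    then obtain U where U: "openin X U" "g t \<in> U"
      and hom: "homeomorphic_map (subtopology X U) (top_of_set (p ` U)) p"
      using lh unfolding local_homeo_to_C_def by blast
    have inj: "inj_on p U"
      using homeomorphic_imp_injective_map[OF hom] U(1) openin_subset[OF U(1)]
      by (simp add: topspace_subtopology Int_absorb1)
    let ?B = "{t \<in> topspace (top_of_set S). g t \<in> U} \<inter> {t \<in> topspace (top_of_set S). g' t \<in> U}"
    have "openin (top_of_set S) ?B"
      using openin_continuous_map_preimage[OF g U(1)] openin_continuous_map_preimage[OF g' U(1)]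
      by (rule openin_Int)
    moreover have "t \<in> ?B" using t U by auto
    moreover have "?B \<subseteq> ?A" using inj eq by (auto simp: inj_on_def)
    ultimately show "\<exists>T. openin (top_of_set S) T \<and> t \<in> T \<and> T \<subseteq> ?A" by blast
  qed
  have "?A = {} \<or> ?A = S"
    using conn cl op unfolding connected_clopen by blast
  then show ?thesis using t0 t by auto
qed

text \<open>Continuity in \<open>z\<close> is carried from \<open>r = 0\<close> to
  \<open>r = 1\<close> by connectedness. Near \<open>(z0, r0)\<close> a lift that meets the chart at
  one parameter is the local inverse of \<open>p\<close> applied to \<open>H\<close>, so continuity
  at one parameter of a short interval spreads to all of it.\<close>

lemma continuous_lift_endpoint:
  fixes Z :: "'b::metric_space set" and H :: "'b \<times> real \<Rightarrow> complex"
  assumes haus: "Hausdorff_space X" and lh: "local_homeo_to_C X p"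
    and x0: "x0 \<in> topspace X"
    and H: "continuous_on (Z \<times> {0..1}) H"
    and K: "\<And>z. z \<in> Z \<Longrightarrow> continuous_map (top_of_set {0..1}) X (K z)"
    and K0: "\<And>z. z \<in> Z \<Longrightarrow> K z 0 = x0"
    and pK: "\<And>z r. z \<in> Z \<Longrightarrow> r \<in> {0..1} \<Longrightarrow> p (K z r) = H (z, r)"
  shows "continuous_map (top_of_set Z) X (\<lambda>z. K z 1)"
proof -
  define cts where "cts z0 r \<longleftrightarrow> (\<forall>U. openin X U \<and> K z0 r \<in> U \<longrightarrow>
      (\<exists>d>0. \<forall>z\<in>Z. dist z z0 < d \<longrightarrow> K z r \<in> U))" for z0 r
  have Ktop: "K z r \<in> topspace X" if "z \<in> Z" "r \<in> {0..1}" for z r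
    using K[OF that(1)] that(2) by (auto simp: continuous_map_def)
  have step: "\<exists>T. openin (top_of_set {0..1}) T \<and> r0 \<in> T \<and>
      (\<forall>r1\<in>T. \<forall>r2\<in>T. cts z0 r1 \<longrightarrow> cts z0 r2)" if z0: "z0 \<in> Z" and r0: "r0 \<in> {0..1}" for z0 r0
  proof -
    obtain U0 where U0: "openin X U0" "K z0 r0 \<in> U0" "open (p ` U0)"
      and hom: "homeomorphic_map (subtopology X U0) (top_of_set (p ` U0)) p"
      using lh Ktop[OF z0 r0] unfolding local_homeo_to_C_def by blast
    obtain q where q: "homeomorphic_maps (subtopology X U0) (top_of_set (p ` U0)) p q"
      using hom homeomorphic_map_maps by blast
    have U0sub: "U0 \<subseteq> topspace X" using U0(1) by (rule openin_subset)
    have qp: "q (p x) = x" if "x \<in> U0" for x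
      using q that U0sub unfolding homeomorphic_maps_def by auto
    have pq: "p (q w) = w" if "w \<in> p ` U0" for w
      using q that unfolding homeomorphic_maps_def by auto
    have qc: "continuous_map (top_of_set (p ` U0)) X q"
      using q unfolding homeomorphic_maps_def continuous_map_in_subtopology by auto
    have "openin (top_of_set {0..1}) {r \<in> topspace (top_of_set {0..1}). K z0 r \<in> U0}"
      using openin_continuous_map_preimage[OF K[OF z0] U0(1)] .
    moreover have "r0 \<in> {r \<in> topspace (top_of_set {0..1}). K z0 r \<in> U0}" using r0 U0 by auto
    ultimately have "\<exists>e>0. \<forall>r\<in>{0..1}. dist r r0 < e \<longrightarrow>
        r \<in> {r \<in> topspace (top_of_set {0..1}). K z0 r \<in> U0}"
      unfolding openin_euclidean_subtopology_iff by blast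
    then obtain e1 where e1: "e1 > 0"
      "\<And>r. r \<in> {0..1} \<Longrightarrow> dist r r0 < e1 \<Longrightarrow> K z0 r \<in> U0" by blast
    have "H (z0, r0) \<in> p ` U0" using U0(2) pK[OF z0 r0] by (metis image_eqI)
    then obtain e where e: "e > 0" "ball (H (z0, r0)) e \<subseteq> p ` U0"
      using U0(3) open_contains_ball by blast
    obtain d where d: "d > 0" "\<And>y. y \<in> Z \<times> {0..1} \<Longrightarrow> dist y (z0, r0) < d \<Longrightarrow> dist (H y) (H (z0, r0)) < e"
      using H[unfolded continuous_on_iff, rule_format, of "(z0, r0)" e] z0 r0 e(1) by blast
    have Hin: "H (z, r) \<in> p ` U0" if "z \<in> Z" "r \<in> {0..1}" "dist z z0 < d / 2" "dist r r0 < d / 2" for z r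
    proof -
      have "dist (z, r) (z0, r0) \<le> dist z z0 + dist r r0"
        unfolding dist_Pair_Pair by (rule order_trans[OF sqrt_sum_squares_le_sum]) auto
      then have "dist (H (z, r)) (H (z0, r0)) < e" using that by (intro d(2)) auto
      then show ?thesis using e(2) by (auto simp: dist_commute)
    qed
    let ?I = "{0..1} \<inter> ball r0 (min e1 (d / 2))"
    have cI: "connected ?I" by (intro convex_connected convex_Int convex_ball) auto
    show ?thesis
    proof (intro exI[of _ ?I] conjI ballI impI)
      show "openin (top_of_set {0..1}) ?I" by (auto simp: openin_open)
      show "r0 \<in> ?I" using r0 e1 d by auto
      fix r1 r2 assume r1: "r1 \<in> ?I" and r2: "r2 \<in> ?I" and c1: "cts z0 r1"
      show "cts z0 r2"
        unfolding cts_def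
      proof (intro allI impI, elim conjE)
        fix U assume U: "openin X U" "K z0 r2 \<in> U"
        have "K z0 r1 \<in> U0" using e1 r1 by (auto simp: dist_commute)
        then obtain d1 where d1: "d1 > 0" "\<And>z. z \<in> Z \<Longrightarrow> dist z z0 < d1 \<Longrightarrow> K z r1 \<in> U0"
          using c1[unfolded cts_def, rule_format, of U0] U0(1) by blast
        \<comment> \<open>Both sides lift the same path over \<open>?I\<close>, and they agree at
          \<open>r1\<close>, where continuity has put \<open>K z r1\<close> into the chart.\<close>
        have Kq: "K z r2 = q (H (z, r2))" if z: "z \<in> Z" "dist z z0 < d1" "dist z z0 < d / 2" for z
        proof (rule local_homeo_lift_unique[OF haus lh cI, where ?t0.0 = r1])
          show "continuous_map (top_of_set ?I) X (K z)"
            by (rule continuous_map_from_subtopology_mono[OF K[OF z(1)]]) auto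
          have "continuous_map (top_of_set ?I) (top_of_set (p ` U0)) (\<lambda>r. H (z, r))"
            unfolding continuous_map_in_subtopology
          proof
            show "continuous_map (top_of_set ?I) euclidean (\<lambda>r. H (z, r))"
              by (auto intro!: continuous_on_compose2[OF H] continuous_intros simp: z(1))
            show "(\<lambda>r. H (z, r)) \<in> topspace (top_of_set ?I) \<rightarrow> p ` U0"
              using Hin[OF z(1)] z(3) by (auto simp: dist_commute)
          qed
          from continuous_map_compose[OF this qc]
          show "continuous_map (top_of_set ?I) X (\<lambda>r. q (H (z, r)))" by (simp add: o_def)
          show "p (K z t) = p (q (H (z, t)))" if "t \<in> ?I" for t
            using Hin[OF z(1) _ z(3), of t] that pK[OF z(1), of t] pq[of "H (z, t)"]
            by (simp add: dist_commute)
          show "r1 \<in> ?I" "r2 \<in> ?I" by fact+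
          show "K z r1 = q (H (z, r1))" using d1(2)[OF z(1,2)] qp pK[OF z(1), of r1, symmetric] r1 by simp
        qed
        have "openin (top_of_set (p ` U0)) {w \<in> topspace (top_of_set (p ` U0)). q w \<in> U}"
          using openin_continuous_map_preimage[OF qc U(1)] .
        then have "open {w \<in> p ` U0. q w \<in> U}" using U0(3) by (simp add: openin_open_eq)
        moreover have "H (z0, r2) \<in> {w \<in> p ` U0. q w \<in> U}"
          using Kq[OF z0] U(2) Hin[OF z0, of r2] d1(1) d(1) r2 by (auto simp: dist_commute)
        ultimately obtain e' where e': "e' > 0" "ball (H (z0, r2)) e' \<subseteq> {w \<in> p ` U0. q w \<in> U}"
          using open_contains_ball by blast
        have "(z0, r2) \<in> Z \<times> {0..1}" using z0 r2 by auto
        then obtain d' where d': "d' > 0" "\<And>y. y \<in> Z \<times> {0..1} \<Longrightarrow> dist y (z0, r2) < d' \<Longrightarrow> dist (H y) (H (z0, r2)) < e'"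
          using H[unfolded continuous_on_iff, rule_format, of "(z0, r2)" e'] e'(1) by blast
        show "\<exists>d>0. \<forall>z\<in>Z. dist z z0 < d \<longrightarrow> K z r2 \<in> U"
        proof (intro exI[of _ "min d' (min d1 (d / 2))"] conjI ballI impI)
          show "0 < min d' (min d1 (d / 2))" using d' d1 d by auto
          fix z assume z: "z \<in> Z" "dist z z0 < min d' (min d1 (d / 2))"
          have "dist (H (z, r2)) (H (z0, r2)) < e'"
            using z r2 by (intro d'(2)) (auto simp: dist_Pair_Pair)
          then have "H (z, r2) \<in> ball (H (z0, r2)) e'" by (simp add: dist_commute)
          then have "q (H (z, r2)) \<in> U" using e'(2) by blast
          then show "K z r2 \<in> U" using Kq[of z] z by auto
        qed
      qed
    qed
  qed
  have c1: "cts z0 1" if z0: "z0 \<in> Z" for z0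
  proof (rule connected_induction_simple[where S = "{0..1::real}" and P = "cts z0" and a = 0])
    show "cts z0 0" unfolding cts_def using K0 z0 by (auto intro: exI[of _ 1])
  qed (use step[OF z0] in auto)
  show ?thesis
    unfolding continuous_map_def
  proof (intro conjI allI impI)
    show "(\<lambda>z. K z 1) \<in> topspace (top_of_set Z) \<rightarrow> topspace X" using Ktop by auto
    fix U assume U: "openin X U"
    show "openin (top_of_set Z) {z \<in> topspace (top_of_set Z). K z 1 \<in> U}"
      unfolding openin_euclidean_subtopology_iff
      using c1 U unfolding cts_def by auto
  qed
qed

lemma lifts_path_lift:
  assumes "endless_surface \<Omega> X p x0" "allowed \<Omega> 1 g"
  shows "lifts_path X p x0 g (lift X p x0 g)"
  using assms unfolding endless_surface_def lift_def by (metis someI_ex)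

text \<open>\<open>lift\<close> is a Hilbert choice, so it depends on the path only through the
  predicate \<open>lifts_path\<close>, which reads the path on \<open>{0..1}\<close> alone.\<close>

lemma lift_cong:
  assumes "\<And>t. t \<in> {0..1} \<Longrightarrow> g t = g' t"
  shows "lift X p x0 g = lift X p x0 g'"
proof -
  have "lifts_path X p x0 g = lifts_path X p x0 g'"
    using assms by (auto simp: lifts_path_def fun_eq_iff)
  then show ?thesis by (simp add: lift_def)
qed

lemma lift_constant_zero:
  assumes es: "endless_surface \<Omega> X p x0" and al: "allowed \<Omega> 1 g"
    and g: "\<And>t. t \<in> {0..1} \<Longrightarrow> g t = 0"
  shows "lift X p x0 g 1 = x0"
proof -
  have X: "Hausdorff_space X" "local_homeo_to_C X p" "x0 \<in> topspace X" "p x0 = 0"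
    using es by (auto simp: endless_surface_def)
  have l: "lifts_path X p x0 g (lift X p x0 g)" by (rule lifts_path_lift[OF es al])
  show ?thesis
    by (rule local_homeo_lift_unique[OF X(1,2), where S = "{0..1::real}" and ?t0.0 = 0 and g' = "\<lambda>_. x0"])
      (use l X g in \<open>auto simp: lifts_path_def\<close>)
qed

lemma local_homeo_continuous:
  assumes lh: "local_homeo_to_C X p"
  shows "continuous_map X euclidean p"
  unfolding continuous_map_def
proof (intro conjI allI impI)
  fix W :: "complex set" assume W: "openin euclidean W"
  show "openin X {x \<in> topspace X. p x \<in> W}"
  proof (subst openin_subopen, intro ballI)
    fix x assume x: "x \<in> {x \<in> topspace X. p x \<in> W}"
    then obtain U where U: "openin X U" "x \<in> U"
      and hom: "homeomorphic_map (subtopology X U) (top_of_set (p ` U)) p"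
      using lh unfolding local_homeo_to_C_def by blast
    have "continuous_map (subtopology X U) euclidean p"
      using homeomorphic_imp_continuous_map[OF hom] by (simp add: continuous_map_in_subtopology)
    from openin_continuous_map_preimage[OF this W]
    have "openin X {x \<in> topspace (subtopology X U). p x \<in> W}"
      using U(1) openin_open_subtopology by blast
    then show "\<exists>T. openin X T \<and> x \<in> T \<and> T \<subseteq> {x \<in> topspace X. p x \<in> W}"
      using x U(2) by (intro exI[of _ "{x \<in> topspace (subtopology X U). p x \<in> W}"]) auto
  qed
qed auto

section \<open>Singular sets and regularised distances\<close>

text \<open>Take \<eta> to be the power -1/n of the sum of the powers -n of the distances. It lies
  below every \<open>d i\<close> and above their minimum times the power -1/n of the number of
  indices, a factor that is at least \<theta> for large n.\<close>

lemma smooth_minimum_exists: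
  fixes d :: "'i \<Rightarrow> 'a::real_normed_vector \<Rightarrow> real"
  assumes fin: "finite I" "I \<noteq> {}" and nonneg: "\<And>i v. 0 \<le> d i v"
    and lip: "\<And>i v w. i \<in> I \<Longrightarrow> d i w \<le> d i v + dist v w"
    and diff: "\<And>i v. i \<in> I \<Longrightarrow> (\<lambda>v. (d i v)\<^sup>2) differentiable (at v)"
    and theta: "0 < \<theta>" "\<theta> < 1"
  obtains \<eta> where "\<And>v. 0 \<le> \<eta> v" "\<And>v i. i \<in> I \<Longrightarrow> \<eta> v \<le> d i v"
    "\<And>v w. \<eta> w \<le> \<eta> v + dist v w" "\<And>v. \<exists>i\<in>I. \<theta> * d i v \<le> \<eta> v"
    "\<And>v. 0 < \<eta> v \<Longrightarrow> \<eta> differentiable (at v)"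
proof -
  have "(\<lambda>m. \<theta> ^ m) \<longlonglongrightarrow> 0" using theta by (intro LIMSEQ_realpow_zero) auto
  moreover have "0 < 1 / real (card I)" using fin by (simp add: card_gt_0_iff)
  ultimately have "eventually (\<lambda>m. \<theta> ^ m < 1 / real (card I)) sequentially"
    by (rule order_tendstoD(2))
  then obtain M where M: "\<And>m. m \<ge> M \<Longrightarrow> \<theta> ^ m < 1 / real (card I)"
    unfolding eventually_sequentially by blast
  define m where "m = Suc M"
  \<comment> \<open>An even exponent, because only the squares of the \<open>d i\<close> are assumed
    differentiable.\<close>
  define n where "n = 2 * m"
  have n: "0 < n" "n \<ge> M" by (auto simp: n_def m_def)
  have thn: "real (card I) * \<theta> ^ n \<le> 1"
    using M[OF n(2)] fin by (simp add: field_simps card_gt_0_iff)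
  define T where "T v = (\<Sum>i\<in>I. (inverse ((d i v)\<^sup>2)) ^ m)" for v
  define Z where "Z = {v. \<exists>i\<in>I. d i v = 0}"
  define \<eta> where "\<eta> v = (if v \<in> Z then 0 else root n (inverse (T v)))" for v
  have dpos: "0 < d i v" if "v \<notin> Z" "i \<in> I" for i v
    using that nonneg[of i v] by (auto simp: Z_def less_le)
  have Teq: "T v = (\<Sum>i\<in>I. (1 / d i v) ^ n)" for v
    by (simp add: T_def n_def power_mult power_inverse divide_inverse power_mult_distrib)
  have Tpos: "0 < T v" if "v \<notin> Z" for v
    unfolding Teq using fin dpos[OF that] by (intro sum_pos) auto
  have epow: "\<eta> v ^ n = inverse (T v)" if "v \<notin> Z" for v
    using Tpos[OF that] that n by (simp add: \<eta>_def real_root_pow_pos)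
  have epos: "0 < \<eta> v" if "v \<notin> Z" for v
    using Tpos[OF that] that n by (simp add: \<eta>_def)
  have nn: "0 \<le> \<eta> v" for v using epos[of v] by (cases "v \<in> Z") (auto simp: \<eta>_def)
  have le: "\<eta> v \<le> x" if "v \<notin> Z" "0 \<le> x" "1 \<le> x ^ n * T v" for v x
  proof -
    have "\<eta> v ^ n \<le> x ^ n" using that Tpos[of v] epow[of v]
      by (simp add: inverse_eq_divide pos_divide_le_eq)
    then show ?thesis using that(2) n by (simp add: power_mono_iff nn)
  qed
  have led: "\<eta> v \<le> d i v" if "i \<in> I" for v i
  proof (cases "v \<in> Z")
    case False
    have "(1 / d i v) ^ n \<le> T v"
      unfolding Teq using fin that nonneg by (intro member_le_sum) auto
    then have "(d i v) ^ n * (1 / d i v) ^ n \<le> (d i v) ^ n * T v"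
      using nonneg by (intro mult_left_mono) auto
    moreover have "(d i v) ^ n * (1 / d i v) ^ n = 1"
      using dpos[OF False that] by (simp add: power_divide)
    ultimately show ?thesis using le[OF False] nonneg by auto
  qed (simp add: \<eta>_def nonneg)
  have lipe: "\<eta> w \<le> \<eta> v + dist v w" for v w
  proof (cases "w \<in> Z")
    case True then show ?thesis using nn by (simp add: \<eta>_def)
  next
    case w: False
    show ?thesis
    proof (cases "v \<in> Z")
      case True
      then obtain i where i: "i \<in> I" "d i v = 0" by (auto simp: Z_def)
      then show ?thesis using led[OF i(1), of w] lip[OF i(1), of w v] nn[of v] by simp
    next
      case v: False
      \<comment> \<open>The left sum is 1, and the right sum being at least 1 says precisely that
        \<open>\<eta> w\<close> is at most \<open>\<eta> v + dist v w\<close>. The comparison of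
        single terms rests on \<open>\<eta> v \<le> d i v\<close>.\<close>
      have "(\<Sum>i\<in>I. (\<eta> v / d i v) ^ n) \<le> (\<Sum>i\<in>I. ((\<eta> v + dist v w) / d i w) ^ n)"
      proof (intro sum_mono power_mono)
        fix i assume i: "i \<in> I"
        have "\<eta> v * d i w \<le> \<eta> v * (d i v + dist v w)"
          using lip[OF i] nn by (intro mult_left_mono) auto
        also have "\<dots> \<le> (\<eta> v + dist v w) * d i v"
          using led[OF i, of v] mult_right_mono[of "\<eta> v" "d i v" "dist v w"]
          by (simp add: algebra_simps)
        finally show "\<eta> v / d i v \<le> (\<eta> v + dist v w) / d i w"
          using dpos[OF v i] dpos[OF w i] by (simp add: field_simps)
        show "0 \<le> \<eta> v / d i v" using nn nonneg by simp
      qed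
      also have "(\<Sum>i\<in>I. (\<eta> v / d i v) ^ n) = \<eta> v ^ n * T v"
        by (simp add: Teq sum_distrib_left power_divide)
      also have "\<dots> = 1" using epow[OF v] Tpos[OF v] by simp
      also have "(\<Sum>i\<in>I. ((\<eta> v + dist v w) / d i w) ^ n) = (\<eta> v + dist v w) ^ n * T w"
        by (simp add: Teq sum_distrib_left power_divide)
      finally show ?thesis using w nn by (intro le) auto
    qed
  qed
  have low: "\<exists>i\<in>I. \<theta> * d i v \<le> \<eta> v" for v
  proof (cases "v \<in> Z")
    case True
    then obtain i where "i \<in> I" "d i v = 0" by (auto simp: Z_def)
    then show ?thesis using nn[of v] by (intro bexI[of _ i]) auto
  next
    case False
    have "Min ((\<lambda>i. d i v) ` I) \<in> (\<lambda>i. d i v) ` I" using fin by (intro Min_in) auto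
    then obtain i where i0: "i \<in> I" "Min ((\<lambda>i. d i v) ` I) = d i v" by blast
    then have i: "i \<in> I" "\<And>j. j \<in> I \<Longrightarrow> d i v \<le> d j v"
      using Min_le[of "(\<lambda>i. d i v) ` I"] fin by auto
    have "T v \<le> (\<Sum>j\<in>I. (1 / d i v) ^ n)"
      unfolding Teq using i(2) dpos[OF False] i(1) nonneg
      by (intro sum_mono power_mono divide_left_mono mult_pos_pos) auto
    then have T: "T v \<le> real (card I) * (1 / d i v) ^ n" by simp
    have "(\<theta> * d i v) ^ n * T v \<le> (\<theta> * d i v) ^ n * (real (card I) * (1 / d i v) ^ n)"
      using T theta nonneg by (intro mult_left_mono) auto
    also have "\<dots> = real (card I) * \<theta> ^ n"
      using dpos[OF False i(1)] by (simp add: power_mult_distrib power_divide)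
    also have "\<dots> \<le> 1" by (rule thn)
    finally have "(\<theta> * d i v) ^ n \<le> \<eta> v ^ n"
      using epow[OF False] Tpos[OF False] by (simp add: inverse_eq_divide pos_le_divide_eq)
    then have "\<theta> * d i v \<le> \<eta> v" using n nn theta nonneg by (simp add: power_mono_iff)
    then show ?thesis using i by blast
  qed
  have dif: "\<eta> differentiable (at v)" if "0 < \<eta> v" for v
  proof -
    have v: "v \<notin> Z" using that by (auto simp: \<eta>_def)
    have Td: "T differentiable (at v)"
      unfolding T_def
    proof (intro differentiable_sum fin ballI differentiable_power)
      fix i assume i: "i \<in> I"
      show "(\<lambda>v. inverse ((d i v)\<^sup>2)) differentiable (at v)"
        using dpos[OF v i] by (intro differentiable_inverse diff i) simp
    qed
    have "(\<lambda>v. inverse (T v)) differentiable (at v)"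
      using Td Tpos[OF v] by (intro differentiable_inverse) auto
    moreover have "(root n) differentiable (at (inverse (T v)))"
      using DERIV_real_root[OF n(1), of "inverse (T v)"] Tpos[OF v]
      by (metis inverse_positive_iff_positive real_differentiable_def)
    ultimately have 1: "(\<lambda>v. root n (inverse (T v))) differentiable (at v)"
      using differentiable_chain_at[of "\<lambda>v. inverse (T v)" v "root n"] by (simp add: o_def)
    \<comment> \<open>By the Lipschitz bound no zero of \<eta> lies in this ball, so the root
      formula holds on all of it.\<close>
    have "\<eta> w = root n (inverse (T w))" if "dist w v < \<eta> v" for w
    proof -
      have "0 < \<eta> w" using lipe[of v w] that by simp
      then show ?thesis by (auto simp: \<eta>_def split: if_splits)
    qed
    then show ?thesis
      by (intro differentiable_transform_within[OF 1 that]) simp_all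
  qed
  show ?thesis by (rule that[of \<eta>]) (fact nn led lipe low dif)+
qed

text \<open>The contribution of the endpoint of a ray to the squared distance; squaring removes the
  corner at 0.\<close>

lemma differentiable_positive_part_squared:
  "(\<lambda>y::real. (max 0 y)\<^sup>2) differentiable (at y)"
proof -
  have "((\<lambda>y. (max 0 y)\<^sup>2) has_field_derivative 2 * max 0 y) (at y)"
  proof (cases y "0::real" rule: linorder_cases)
    case less
    have "((\<lambda>y. 0) has_field_derivative 0) (at y)" by simp
    then have "((\<lambda>y. (max 0 y)\<^sup>2) has_field_derivative 0) (at y)"
      by (rule has_field_derivative_transform_within_open[of _ _ _ "{..<0}"]) (use less in auto)
    then show ?thesis using less by simp
  next
    case greater
    have "((\<lambda>y. y\<^sup>2) has_field_derivative 2 * y) (at y)"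
      by (auto intro!: derivative_eq_intros)
    then have "((\<lambda>y. (max 0 y)\<^sup>2) has_field_derivative 2 * y) (at y)"
      by (rule has_field_derivative_transform_within_open[of _ _ _ "{0<..}"]) (use greater in auto)
    then show ?thesis using greater by simp
  next
    case equal
    have "((\<lambda>h::real. (max 0 h)\<^sup>2 / h) \<longlongrightarrow> 0) (at 0)"
    proof (rule Lim_null_comparison)
      show "\<forall>\<^sub>F h in at 0. norm ((max 0 h)\<^sup>2 / h) \<le> \<bar>h::real\<bar>"
        by (auto intro!: always_eventually simp: max_def power2_eq_square)
      show "((\<lambda>h::real. \<bar>h\<bar>) \<longlongrightarrow> 0) (at 0)" by (auto intro!: tendsto_eq_intros)
    qed
    then show ?thesis using equal by (simp add: DERIV_def)
  qed
  then show ?thesis using real_differentiable_def by blast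
qed

text \<open>The singular set consists of rays in the direction of increasing length. The smooth
  minimum is taken over the distances to finitely many of them and to the origin. The origin is
  included so that a vanishing component has weight 0 and stays at the base point.\<close>

lemma regularised_distance_exists:
  fixes R :: "(real \<times> complex) set"
  assumes fin: "finite R" and theta: "0 < \<theta>" "\<theta> < 1"
  obtains \<eta> :: "real \<times> complex \<Rightarrow> real" where "\<And>v. 0 \<le> \<eta> v" "\<And>v. \<eta> v \<le> norm v"
    "\<And>v w. \<bar>\<eta> v - \<eta> w\<bar> \<le> norm (v - w)"
    "\<And>v r q. r \<in> R \<Longrightarrow> fst r \<le> fst q \<Longrightarrow> snd r = snd q \<Longrightarrow> \<eta> v \<le> norm (v - q)"
    "\<And>v. \<exists>u. (u = 0 \<or> (\<exists>r\<in>R. fst r \<le> fst u \<and> snd r = snd u)) \<and> \<theta> * norm (v - u) \<le> \<eta> v"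
    "\<And>v. 0 < \<eta> v \<Longrightarrow> \<eta> differentiable (at v)"
proof -
  \<comment> \<open>\<open>None\<close> stands for the origin and \<open>Some r\<close> for the ray
    that starts at \<open>r\<close>; \<open>pr\<close> is the projection to the nearest
    point.\<close>
  define pr where "pr r v = (case r of None \<Rightarrow> 0 | Some r \<Rightarrow> (max (fst v) (fst r), snd r))"
    for r :: "(real \<times> complex) option" and v :: "real \<times> complex"
  define d where "d r v = norm (v - pr r v)" for r v
  define ray where "ray r = (case r of None \<Rightarrow> {0} | Some r \<Rightarrow> {q. fst r \<le> fst q \<and> snd r = snd q})"
    for r :: "(real \<times> complex) option"
  have prin: "pr r v \<in> ray r" for r v by (auto simp: pr_def ray_def split: option.splits)
  have dle: "d r v \<le> norm (v - q)" if "q \<in> ray r" for r v q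
  proof (cases r)
    case None then show ?thesis using that by (simp add: d_def pr_def ray_def)
  next
    case (Some r')
    have "\<bar>fst v - max (fst v) (fst r')\<bar> \<le> \<bar>fst v - fst q\<bar>" "snd q = snd r'"
      using that Some by (auto simp: ray_def)
    then show ?thesis unfolding d_def pr_def Some norm_prod_def
      by (auto intro!: real_sqrt_le_mono add_mono power_mono simp: abs_le_square_iff[symmetric])
  qed
  have lip: "d r w \<le> d r v + dist v w" for r v w
  proof -
    have "d r w \<le> norm (w - pr r v)" by (rule dle[OF prin])
    also have "\<dots> \<le> norm (v - pr r v) + norm (v - w)"
      by (metis add.commute dist_commute dist_norm dist_triangle)
    finally show ?thesis by (simp add: d_def dist_norm)
  qed
  have diff: "(\<lambda>v. (d r v)\<^sup>2) differentiable (at v)" for r v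
  proof (cases r)
    case None
    have "(\<lambda>v. (d r v)\<^sup>2) = (\<lambda>v::real \<times> complex. v \<bullet> v)"
      by (simp add: None d_def pr_def power2_norm_eq_inner fun_eq_iff)
    then show ?thesis unfolding differentiable_def
      using has_derivative_inner[OF has_derivative_ident has_derivative_ident, of v UNIV] by auto
  next
    case (Some q)
    have eq: "(d r v)\<^sup>2 = (max 0 (fst q - fst v))\<^sup>2 + (snd v - snd q) \<bullet> (snd v - snd q)" for v
    proof -
      have "(fst v - max (fst v) (fst q))\<^sup>2 = (max 0 (fst q - fst v))\<^sup>2"
        by (auto simp: max_def power2_commute)
      then show ?thesis
        by (simp add: Some d_def pr_def norm_prod_def power2_norm_eq_inner)
    qed
    have 1: "(\<lambda>v::real\<times>complex. fst q - fst v) differentiable (at v)"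
      by (intro differentiable_diff differentiable_const bounded_linear_imp_differentiable bounded_linear_fst)
    have "((\<lambda>v::real\<times>complex. snd v - snd q) has_derivative snd) (at v)"
      by (auto intro!: derivative_eq_intros)
    then have 2: "(\<lambda>v::real\<times>complex. (snd v - snd q) \<bullet> (snd v - snd q)) differentiable (at v)"
      unfolding differentiable_def using has_derivative_inner by blast
    have "(\<lambda>v. (max 0 (fst q - fst v))\<^sup>2) differentiable (at v)"
      using differentiable_chain_at[OF 1 differentiable_positive_part_squared] by (simp add: o_def)
    then show ?thesis unfolding eq using 2 by (intro differentiable_add) auto
  qed
  let ?I = "insert None (Some ` R)"
  obtain \<eta> where E: "\<And>v. 0 \<le> \<eta> v" "\<And>v i. i \<in> ?I \<Longrightarrow> \<eta> v \<le> d i v"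
    "\<And>v w. \<eta> w \<le> \<eta> v + dist v w" "\<And>v. \<exists>i\<in>?I. \<theta> * d i v \<le> \<eta> v"
    "\<And>v. 0 < \<eta> v \<Longrightarrow> \<eta> differentiable (at v)"
    using smooth_minimum_exists[of ?I d \<theta>] fin lip diff theta by (auto simp: d_def)
  show ?thesis
  proof (rule that[of \<eta>])
    show "\<eta> v \<le> norm v" for v using E(2)[of None v] by (simp add: d_def pr_def)
    show "\<bar>\<eta> v - \<eta> w\<bar> \<le> norm (v - w)" for v w
      using E(3)[of v w] E(3)[of w v] by (simp add: dist_norm norm_minus_commute)
    show "\<eta> v \<le> norm (v - q)" if "r \<in> R" "fst r \<le> fst q" "snd r = snd q" for v r q
      using E(2)[of "Some r" v] dle[of q "Some r" v] that by (auto simp: ray_def)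
    show "\<exists>u. (u = 0 \<or> (\<exists>r\<in>R. fst r \<le> fst u \<and> snd r = snd u)) \<and> \<theta> * norm (v - u) \<le> \<eta> v" for v
    proof -
      obtain i where i: "i \<in> ?I" "\<theta> * d i v \<le> \<eta> v" using E(4) by blast
      have "pr i v = 0 \<or> (\<exists>r\<in>R. fst r \<le> fst (pr i v) \<and> snd r = snd (pr i v))"
      proof (cases i)
        case (Some r)
        then show ?thesis using i(1) by (intro disjI2 bexI[of _ r]) (auto simp: pr_def)
      qed (simp add: pr_def)
      then show ?thesis using i(2) unfolding d_def by blast
    qed
  qed (fact E)+
qed

lemma S_set_upward:
  assumes "is_dfs \<Omega>" "r \<in> S_set \<Omega>" "fst r \<le> fst q" "snd r = snd q"
  shows "q \<in> S_set \<Omega>"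
proof -
  have "0 \<le> fst r" "snd r \<in> \<Omega> (fst r)" using assms(2) by (auto simp: S_set_def)
  moreover have "\<Omega> (fst r) \<subseteq> \<Omega> (fst q)" using assms(1,3) calculation(1) unfolding is_dfs_def by blast
  ultimately show ?thesis using assms(3,4) by (auto simp: S_set_def case_prod_unfold)
qed

text \<open>A point first appears at the infimum of its levels, and equality with the upper closure
  says that it is present at that infimum. So each of the finitely many points of
  \<open>\<Omega> B\<close> generates one closed ray.\<close>

lemma S_set_finite_rays:
  assumes dfs: "is_dfs \<Omega>" and up: "\<forall>l\<ge>0. upper_closure \<Omega> l = \<Omega> l" and B: "0 \<le> B"
  obtains R where "finite R" "R \<subseteq> S_set \<Omega>"
    "\<And>q. q \<in> S_set \<Omega> \<Longrightarrow> fst q \<le> B \<Longrightarrow> \<exists>r\<in>R. fst r \<le> fst q \<and> snd r = snd q"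
proof -
  define \<mu> where "\<mu> w = Inf {l. 0 \<le> l \<and> w \<in> \<Omega> l}" for w
  have mono: "\<Omega> l \<subseteq> \<Omega> l'" if "0 \<le> l" "l \<le> l'" for l l' using dfs that by (auto simp: is_dfs_def)
  have bdd: "bdd_below {l. 0 \<le> l \<and> w \<in> \<Omega> l}" for w by (rule bdd_belowI[of _ 0]) auto
  have mu0: "0 \<le> \<mu> w" and muin: "w \<in> \<Omega> (\<mu> w)" and mule: "\<mu> w \<le> l" if "0 \<le> l" "w \<in> \<Omega> l" for w l
  proof -
    have ne: "{l. 0 \<le> l \<and> w \<in> \<Omega> l} \<noteq> {}" using that by auto
    show 0: "0 \<le> \<mu> w" unfolding \<mu>_def using ne by (intro cInf_greatest) auto
    show "\<mu> w \<le> l" unfolding \<mu>_def using that bdd by (intro cInf_lower) auto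
    have "w \<in> \<Omega> (\<mu> w + e)" if "e > 0" for e
    proof -
      have "\<mu> w < \<mu> w + e" using that by simp
      then obtain l where l: "0 \<le> l" "w \<in> \<Omega> l" "l < \<mu> w + e"
        unfolding \<mu>_def cInf_less_iff[OF ne bdd] by auto
      then show ?thesis using mono[of l "\<mu> w + e"] by auto
    qed
    then have "w \<in> upper_closure \<Omega> (\<mu> w)" by (auto simp: upper_closure_def)
    then show "w \<in> \<Omega> (\<mu> w)" using up 0 by auto
  qed
  show ?thesis
  proof (rule that[of "(\<lambda>w. (\<mu> w, w)) ` \<Omega> B"])
    show "finite ((\<lambda>w. (\<mu> w, w)) ` \<Omega> B)" using dfs B by (auto simp: is_dfs_def)
    show "(\<lambda>w. (\<mu> w, w)) ` \<Omega> B \<subseteq> S_set \<Omega>" using mu0[OF B] muin[OF B] by (auto simp: S_set_def)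
    fix q assume q: "q \<in> S_set \<Omega>" "fst q \<le> B"
    then have q': "0 \<le> fst q" "snd q \<in> \<Omega> (fst q)" by (auto simp: S_set_def)
    then have "snd q \<in> \<Omega> B" using mono[of "fst q" B] q by auto
    then show "\<exists>r\<in>(\<lambda>w. (\<mu> w, w)) ` \<Omega> B. fst r \<le> fst q \<and> snd r = snd q"
      using mule[OF q'] by auto
  qed
qed

text \<open>The additional length can be given to the first summand. Hence the singular sets of the
  sums, too, are closed under increasing the length.\<close>

lemma dfs_pow_mono:
  assumes dfs: "is_dfs \<Omega>" and l: "0 \<le> l" "l \<le> l'"
  shows "dfs_pow \<Omega> n l \<subseteq> dfs_pow \<Omega> n l'"
  using l
proof (induction n arbitrary: l l')
  case (Suc n)
  have mono: "\<Omega> l \<subseteq> \<Omega> l'" using dfs Suc.prems by (auto simp: is_dfs_def)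
  show ?case
  proof
    fix w assume "w \<in> dfs_pow \<Omega> (Suc n) l"
    then consider w1 w2 L1 L2 where "w = w1 + w2" "0 \<le> L1" "0 \<le> L2" "L1 + L2 = l"
        "w1 \<in> dfs_pow \<Omega> n L1" "w2 \<in> \<Omega> L2"
      | "w \<in> dfs_pow \<Omega> n l" | "w \<in> \<Omega> l" by (auto simp: dfs_sum_def)
    then show "w \<in> dfs_pow \<Omega> (Suc n) l'"
    proof cases
      case (1 w1 w2 L1 L2)
      have "w1 \<in> dfs_pow \<Omega> n (l' - L2)" using Suc.IH[of L1 "l' - L2"] 1 Suc.prems by auto
      moreover have "0 \<le> l' - L2" "(l' - L2) + L2 = l'" using 1 Suc.prems by auto
      ultimately have "w \<in> {w1 + w2 | w1 w2 L1 L2. 0 \<le> L1 \<and> 0 \<le> L2 \<and> L1 + L2 = l' \<and>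
          w1 \<in> dfs_pow \<Omega> n L1 \<and> w2 \<in> \<Omega> L2}"
        using 1(1,3,6) by (intro CollectI exI[of _ w1] exI[of _ w2] exI[of _ "l' - L2"] exI[of _ L2]) simp
      then show ?thesis by (simp add: dfs_sum_def)
    qed (use Suc.IH[OF Suc.prems] mono in \<open>auto simp: dfs_sum_def\<close>)
  qed
qed simp

text \<open>Zero terms are harmless because \<open>dfs_sum\<close> retains both of its summands:
  components whose nearest obstacle is the origin simply drop out.\<close>

lemma sum_in_S_set_dfs_pow:
  assumes "finite A" "\<And>i. i \<in> A \<Longrightarrow> u i = 0 \<or> u i \<in> S_set \<Omega>"
  shows "(\<Sum>i\<in>A. u i) = 0 \<or> (\<Sum>i\<in>A. u i) \<in> S_set (dfs_pow \<Omega> (card A))"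
  using assms
proof (induction A rule: finite_induct)
  case (insert x F)
  have c: "card (insert x F) = Suc (card F)" using insert by simp
  have IH: "sum u F = 0 \<or> sum u F \<in> S_set (dfs_pow \<Omega> (card F))" using insert by auto
  have ux: "u x = 0 \<or> u x \<in> S_set \<Omega>" using insert by auto
  have s: "sum u (insert x F) = sum u F + u x" using insert by (simp add: add.commute)
  have "sum u F + u x \<in> S_set (dfs_pow \<Omega> (Suc (card F)))"
    if "sum u F \<in> S_set (dfs_pow \<Omega> (card F))" "u x \<in> S_set \<Omega>"
    using that by (auto simp: S_set_def dfs_sum_def split: prod.splits)
  moreover have "sum u F \<in> S_set (dfs_pow \<Omega> (Suc (card F)))"
    if "sum u F \<in> S_set (dfs_pow \<Omega> (card F))"
    using that by (auto simp: S_set_def dfs_sum_def)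
  moreover have "u x \<in> S_set (dfs_pow \<Omega> (Suc (card F)))" if "u x \<in> S_set \<Omega>"
    using that by (auto simp: S_set_def dfs_sum_def)
  ultimately show ?case using IH ux unfolding s c by auto
qed simp

section \<open>Determinants and negligible sets\<close>

text \<open>The sum over permutations is enlarged to a sum over all maps, which factors into column
  sums.\<close>

lemma norm_det_le_prod_column_sums:
  fixes A :: "complex^'n^'n"
  shows "cmod (det A) \<le> (\<Prod>j\<in>UNIV. \<Sum>i\<in>UNIV. cmod (A $ i $ j))"
proof -
  have "cmod (det A) = cmod (det (transpose A))" by (simp add: det_transpose)
  also have "\<dots> \<le> (\<Sum>p\<in>{p. p permutes (UNIV::'n set)}. \<Prod>j\<in>UNIV. cmod (A $ p j $ j))"
    unfolding det_def transpose_def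
    by (rule order_trans[OF norm_sum], rule sum_mono)
      (auto simp: norm_mult prod_norm[symmetric] sign_def)
  also have "\<dots> \<le> (\<Sum>p\<in>PiE UNIV (\<lambda>_. UNIV). \<Prod>j\<in>UNIV. cmod (A $ p j $ j))"
    by (rule sum_mono2) (auto intro!: prod_nonneg finite_PiE)
  also have "\<dots> = (\<Prod>j\<in>UNIV. \<Sum>i\<in>UNIV. cmod (A $ i $ j))"
    by (rule prod_sum_PiE[symmetric]) auto
  finally show ?thesis .
qed

lemma det_row_replace_by_row_sum:
  fixes A :: "'a::field^'n^'n"
  shows "det (\<chi> i. if i = k then (\<Sum>l\<in>UNIV. A $ l) else A $ i) = det A"
proof -
  have rowA: "row i A = A $ i" for i by (simp add: row_def vec_eq_iff)
  have "(\<Sum>l\<in>UNIV - {k}. row l A) \<in> vec.span {row j A |j. j \<noteq> k}"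
    by (intro vec.span_sum vec.span_base) auto
  from det_row_span[OF this] have "det (\<chi> i. if i = k then row k A + (\<Sum>l\<in>UNIV - {k}. row l A) else row i A) = det A" .
  moreover have "row k A + (\<Sum>l\<in>UNIV - {k}. row l A) = (\<Sum>l\<in>UNIV. A $ l)"
    unfolding rowA by (subst sum.remove[of UNIV k]) auto
  ultimately show ?thesis unfolding rowA by (simp only:)
qed

lemma det_add_multiples_of_row:
  fixes B :: "'a::field^'n^'n"
  assumes "finite S" "k \<notin> S"
  shows "det (\<chi> i. if i \<in> S then B $ i + c i *s B $ k else B $ i) = det B"
  using assms
proof (induction S rule: finite_induct)
  case (insert x F)
  let ?A = "(\<chi> i. if i \<in> F then B $ i + c i *s B $ k else B $ i) :: 'a^'n^'n"
  have ne: "x \<noteq> k" using insert by auto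
  have "(\<chi> i. if i \<in> insert x F then B $ i + c i *s B $ k else B $ i) =
      (\<chi> i. if i = x then row x ?A + c x *s row k ?A else row i ?A)"
    using insert by (auto simp: vec_eq_iff row_def)
  then show ?case using det_row_operation[OF ne, of ?A "c x"] insert by simp
qed simp

text \<open>Replace one row by the sum of all rows. It becomes a multiple of the row of ones, with
  factor \<open>c\<close> for \<open>A\<close> and \<open>c + (\<Sum>i\<in>UNIV. u i)\<close> for
  the perturbed matrix. Multiples of the row of ones then remove \<open>u\<close> from the other
  rows, so both determinants are multiples of the same one.\<close>

lemma det_add_column_constant:
  fixes A :: "'a::field^'n^'n"
  assumes col: "\<And>j. (\<Sum>i\<in>UNIV. A $ i $ j) = c"
  shows "c * det (\<chi> i j. A $ i $ j + u i) = (c + (\<Sum>i\<in>UNIV. u i)) * det A"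
proof -
  fix k :: 'n
  let ?E = "(\<chi> i j. A $ i $ j + u i) :: 'a^'n^'n"
  let ?B = "(\<chi> i. if i = k then 1 else A $ i) :: 'a^'n^'n"
  have A1: "(\<Sum>l\<in>UNIV. A $ l) = c *s 1"
    by (simp add: vec_eq_iff col)
  have E1: "(\<Sum>l\<in>UNIV. ?E $ l) = (c + (\<Sum>i\<in>UNIV. u i)) *s 1"
    by (simp add: vec_eq_iff sum.distrib col)
  have dA: "det A = c * det ?B"
    using det_row_replace_by_row_sum[of k A] unfolding A1 by (simp add: det_row_mul[of k c "\<lambda>_. 1" "\<lambda>i. A $ i"])
  have "det ?E = (c + (\<Sum>i\<in>UNIV. u i)) * det ((\<chi> i. if i = k then 1 else ?E $ i) :: 'a^'n^'n)"
    using det_row_replace_by_row_sum[of k ?E] unfolding E1 by (subst (asm) det_row_mul) simp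
  also have "((\<chi> i. if i = k then 1 else ?E $ i) :: 'a^'n^'n) =
      (\<chi> i. if i \<in> UNIV - {k} then ?B $ i + u i *s ?B $ k else ?B $ i)"
    by (auto simp: vec_eq_iff)
  also have "det \<dots> = det ?B" by (rule det_add_multiples_of_row) auto
  finally show ?thesis using dA by simp
qed

text \<open>Sard's theorem in dimension one, transported to \<open>real^1\<close>. It discards the
  levels at which \<gamma> has zero speed.\<close>

lemma negligible_critical_values:
  fixes f :: "real \<Rightarrow> real"
  assumes der: "\<And>x. x \<in> S \<Longrightarrow> (f has_field_derivative 0) (at x within S)"
  shows "negligible (f ` S)"
proof -
  let ?vec = "vec :: real \<Rightarrow> real^1"
  let ?S = "?vec ` S"
  have "negligible ((\<lambda>x::real^1. ?vec (f (x $ 1))) ` ?S)"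
  proof (rule baby_Sard[where f' = "\<lambda>_ _. 0"])
    fix x assume "x \<in> ?S"
    then obtain y where y: "x = vec y" "y \<in> S" by auto
    have im: "(\<lambda>x::real^1. x $ 1) ` ?S = S" by (auto simp: image_image)
    have 1: "((\<lambda>x::real^1. x $ 1) has_derivative (\<lambda>x. x $ 1)) (at x within ?S)"
      by (intro bounded_linear_imp_has_derivative bounded_linear_vec_nth)
    have 2: "(f has_derivative (\<lambda>_. 0)) (at (x $ 1) within (\<lambda>x::real^1. x $ 1) ` ?S)"
      using der[OF y(2)] unfolding im by (simp add: has_field_derivative_def y(1) lambda_zero)
    have 3: "((\<lambda>x. f (x $ 1)) has_derivative (\<lambda>_. 0)) (at x within ?S)"
      using diff_chain_within[OF 1 2] by (simp add: o_def)
    have bl: "bounded_linear ?vec"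
      by (rule bounded_linear_intro[of _ 1]) (auto simp: vec_eq_iff norm_vec_def L2_set_def)
    show "((\<lambda>x::real^1. ?vec (f (x $ 1))) has_derivative (\<lambda>_. 0)) (at x within ?S)"
      using bounded_linear.has_derivative[OF bl 3] by (simp add: vec_eq_iff)
    show "rank (matrix (\<lambda>_::real^1. 0::real^1)) < CARD(1)"
      by (simp add: matrix_def zero_vec_def[symmetric] vec_lambda_unique)
  qed simp
  then have "negligible ((\<lambda>x::real^1. x $ 1) ` (\<lambda>x::real^1. ?vec (f (x $ 1))) ` ?S)"
    by (rule negligible_differentiable_image_negligible[rotated])
      (simp_all add: differentiable_on_def bounded_linear_imp_differentiable bounded_linear_vec_nth)
  then show ?thesis by (simp add: image_image)
qed

text \<open>By the product formula for Lebesgue measure one factor is the measure of a Borel null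
  set containing \<open>N\<close>. The other factors are infinite, but 0 times infinity is 0 in
  \<open>ennreal\<close>.\<close>

lemma negligible_component_preimage:
  fixes N :: "real set" and k :: "'n::finite"
  assumes "negligible N"
  shows "negligible {s :: real^'n. s $ k \<in> N}"
proof -
  obtain N' where N': "N' \<in> null_sets lborel" "N \<subseteq> N'"
    using assms unfolding negligible_iff_null_sets null_sets_completion_iff2 by auto
  have [measurable]: "N' \<in> sets borel" using N' by auto
  let ?b = "axis k 1 :: real^'n"
  let ?f = "\<lambda>b x. if b = ?b then indicator N' x else (1::ennreal)"
  have "emeasure lborel {s :: real^'n. s $ k \<in> N'} = (\<integral>\<^sup>+s. indicator {s :: real^'n. s $ k \<in> N'} s \<partial>lborel)"
    by (subst nn_integral_indicator) auto
  also have "\<dots> = (\<integral>\<^sup>+s. (\<Prod>b\<in>Basis. ?f b (s \<bullet> b)) \<partial>lborel)"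
    by (intro nn_integral_cong) (simp add: axis_in_Basis_iff inner_axis prod.If_cases prod.delta indicator_def)
  also have "\<dots> = (\<Prod>b\<in>Basis. (\<integral>\<^sup>+x. ?f b x \<partial>lborel))"
    by (rule nn_integral_lborel_prod) auto
  also have "\<dots> = 0"
    using N'(1) by (intro prod_zero bexI[of _ ?b]) (auto simp: axis_in_Basis_iff null_sets_def)
  finally have "{s :: real^'n. s $ k \<in> N'} \<in> null_sets lborel" by (auto simp: null_sets_def)
  then show ?thesis
    unfolding negligible_iff_null_sets null_sets_completion_iff2
    using N'(2) by (intro bexI[of _ "{s :: real^'n. s $ k \<in> N'}"]) auto
qed

text \<open>A linear shear takes the hyperplanes on which one coordinate is constant to those on
  which the sum is constant.\<close>

lemma negligible_sum_preimage:
  fixes N :: "real set"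
  assumes "negligible N"
  shows "negligible {s :: real^'n. (\<Sum>i\<in>UNIV. s $ i) \<in> N}"
proof -
  fix k :: 'n
  define T where "T s = (\<chi> i. if i = k then s $ k - (\<Sum>j\<in>UNIV - {k}. s $ j) else s $ i)" for s :: "real^'n"
  have lin: "linear T"
    by (rule linearI) (auto simp: T_def vec_eq_iff sum.distrib algebra_simps sum_distrib_left)
  have "negligible (T ` {s. s $ k \<in> N})"
    by (intro negligible_differentiable_image_negligible negligible_component_preimage assms
        linear_imp_differentiable_on lin) auto
  moreover have "s \<in> T ` {s. s $ k \<in> N}" if "(\<Sum>i\<in>UNIV. s $ i) \<in> N" for s
  proof (rule image_eqI)
    let ?t = "(\<chi> i. if i = k then (\<Sum>i\<in>UNIV. s $ i) else s $ i) :: real^'n"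
    have "(\<Sum>j\<in>UNIV - {k}. ?t $ j) = (\<Sum>j\<in>UNIV - {k}. s $ j)" by (intro sum.cong) auto
    then show "s = T ?t" by (auto simp: T_def vec_eq_iff sum.remove[of UNIV k])
    show "?t \<in> {s. s $ k \<in> N}" using that by simp
  qed
  ultimately show ?thesis by (blast intro: negligible_subset)
qed

section \<open>The Euler scheme\<close>

lemma has_derivative_bound_of_lipschitz:
  fixes f :: "'a::real_normed_vector \<Rightarrow> real"
  assumes d: "(f has_derivative f') (at v)" and lip: "\<And>v w. \<bar>f v - f w\<bar> \<le> norm (v - w)"
  shows "\<bar>f' e\<bar> \<le> norm e"
proof -
  have lin: "linear f'" using d by (rule has_derivative_linear)
  have "((\<lambda>t::real. v + t *\<^sub>R e) has_derivative (\<lambda>t. t *\<^sub>R e)) (at 0)"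
    by (auto intro!: derivative_eq_intros)
  moreover have "(f has_derivative f') (at (v + 0 *\<^sub>R e))" using d by simp
  ultimately have "((\<lambda>t::real. f (v + t *\<^sub>R e)) has_derivative (\<lambda>t. f' (t *\<^sub>R e))) (at 0)"
    using diff_chain_at[of "\<lambda>t::real. v + t *\<^sub>R e" "\<lambda>t. t *\<^sub>R e" 0 f f'] by (simp add: o_def)
  then have "DERIV (\<lambda>t. f (v + t *\<^sub>R e)) 0 :> f' e"
    unfolding has_field_derivative_def by (simp add: linear_cmul[OF lin] mult_commute_abs)
  then have "((\<lambda>t. (f (v + t *\<^sub>R e) - f v) / t) \<longlongrightarrow> f' e) (at 0)"
    by (simp add: DERIV_def)
  then have "((\<lambda>t. \<bar>(f (v + t *\<^sub>R e) - f v) / t\<bar>) \<longlongrightarrow> \<bar>f' e\<bar>) (at 0)" by (rule tendsto_rabs)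
  moreover have "\<forall>\<^sub>F t in at 0. \<bar>(f (v + t *\<^sub>R e) - f v) / t\<bar> \<le> norm e"
    unfolding eventually_at
  proof (intro exI[of _ 1] conjI ballI impI)
    fix t :: real assume "t \<noteq> 0 \<and> dist t 0 < 1"
    then show "\<bar>(f (v + t *\<^sub>R e) - f v) / t\<bar> \<le> norm e"
      using lip[of "v + t *\<^sub>R e" v] by (simp add: abs_divide divide_le_eq mult.commute)
  qed simp
  ultimately show ?thesis by (rule tendsto_upperbound) simp
qed

text \<open>An increment of the curve \<open>gt\<close> over a length \<open>u\<close> has
  \<open>maxnorm\<close> at most \<open>u\<close>, and \<open>maxnorm\<close> dominates the modulus
  of the second component. Measuring columns in it confines the factor \<open>sqrt 2\<close> to the
  Lipschitz bound of \<eta>.\<close>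

definition maxnorm :: "real \<times> complex \<Rightarrow> real" where
  "maxnorm w = max \<bar>fst w\<bar> (cmod (snd w))"

lemma maxnorm_bounds: "0 \<le> maxnorm w" "\<bar>fst w\<bar> \<le> maxnorm w" "cmod (snd w) \<le> maxnorm w"
  by (auto simp: maxnorm_def)

lemma cmod_snd_le_norm: "cmod (snd w) \<le> norm w"
  by (metis norm_snd_le prod.collapse)

lemma norm_le_maxnorm: "norm w \<le> sqrt 2 * maxnorm w"
proof -
  have "(norm w)\<^sup>2 \<le> (maxnorm w)\<^sup>2 + (maxnorm w)\<^sup>2"
    using power_mono[OF maxnorm_bounds(2)[of w], of 2] power_mono[OF maxnorm_bounds(3)[of w], of 2]
    by (simp add: norm_prod_def)
  then have "(norm w)\<^sup>2 \<le> (sqrt 2 * maxnorm w)\<^sup>2" by (simp add: power_mult_distrib)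
  then show ?thesis by (rule power2_le_imp_le) (simp add: maxnorm_bounds)
qed

lemma maxnorm_add_scaleR: "maxnorm (v + c *\<^sub>R w) \<le> maxnorm v + \<bar>c\<bar> * maxnorm w"
proof -
  have "\<bar>fst v + c * fst w\<bar> \<le> \<bar>fst v\<bar> + \<bar>c\<bar> * \<bar>fst w\<bar>"
    using abs_triangle_ineq[of "fst v" "c * fst w"] by (simp add: abs_mult)
  moreover have "cmod (snd v + c *\<^sub>R snd w) \<le> cmod (snd v) + \<bar>c\<bar> * cmod (snd w)"
    using norm_triangle_ineq[of "snd v" "c *\<^sub>R snd w"] by simp
  moreover have "\<bar>c\<bar> * \<bar>fst w\<bar> \<le> \<bar>c\<bar> * maxnorm w" "\<bar>c\<bar> * cmod (snd w) \<le> \<bar>c\<bar> * maxnorm w"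
    using maxnorm_bounds[of w] by (auto intro!: mult_left_mono)
  ultimately show ?thesis using maxnorm_bounds[of v] unfolding maxnorm_def[of "v + c *\<^sub>R w"] by auto
qed

text \<open>\<open>c\<close> is the rate at which a step can change a component relative to its
  weight; \<open>b\<close> is a slightly larger rate whose exponential lies below the step factor
  \<open>1 - c * u\<close>. By \<open>b_le\<close> the excess of \<open>b\<close> over
  \<open>sqrt 2 / \<delta>\<close> fits into the factor 2 between the radius
  \<open>2 * \<rho>\<close> and the distance \<rho>. If \<Lambda> is 0, all steps have length
  0.\<close>

locale euler_scheme =
  fixes \<eta> :: "real \<times> complex \<Rightarrow> real" and \<theta> \<delta> \<rho> h \<Lambda> b c :: real and N :: nat
    and g :: "real \<Rightarrow> complex" and ty :: "'n::finite itself"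
  assumes eta_nonneg: "\<And>v. 0 \<le> \<eta> v" and eta_le_norm: "\<And>v. \<eta> v \<le> norm v"
    and eta_lip: "\<And>v w. \<bar>\<eta> v - \<eta> w\<bar> \<le> norm (v - w)"
    and eta_diff: "\<And>v. 0 < \<eta> v \<Longrightarrow> \<eta> differentiable (at v)"
    and eta_init: "\<And>v. norm v \<le> sqrt 2 * \<rho> \<Longrightarrow> \<theta> * norm v \<le> \<eta> v"
    and g_lip: "\<And>s t. 0 \<le> s \<Longrightarrow> s \<le> t \<Longrightarrow> t \<le> \<Lambda> \<Longrightarrow> cmod (g t - g s) \<le> t - s"
    and norm_g0: "cmod (g 0) = \<rho>" and rho: "0 < \<rho>" and delta: "0 < \<delta>" "\<delta> < \<rho>"
    and theta: "0 < \<theta>" "2 * sqrt 2 \<le> 3 * \<theta>"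
    and weight_ge: "\<And>(v :: 'n \<Rightarrow> real \<times> complex) l. 0 \<le> l \<Longrightarrow> l \<le> \<Lambda> \<Longrightarrow>
          (\<Sum>i\<in>UNIV. v i) = (\<rho> + l, g l) \<Longrightarrow> \<theta> * \<delta> \<le> (\<Sum>i\<in>UNIV. \<eta> (v i))"
    and h: "0 \<le> h" "real N * h = \<Lambda>" and N: "0 < N"
    and c_def: "c = sqrt 2 / (\<theta> * \<delta>)"
    and step_small: "\<And>u. 0 \<le> u \<Longrightarrow> u \<le> h \<Longrightarrow> exp (- b * u) \<le> 1 - c * u"
    and cb: "c \<le> b" and b_le: "exp (2 * (b - sqrt 2 / \<delta>) * \<Lambda>) \<le> 2 * \<theta>" "sqrt 2 / \<delta> \<le> b"
begin

definition gt :: "real \<Rightarrow> real \<times> complex" where "gt l = (\<rho> + l, g l)"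

text \<open>If all weights vanish, the quotient is 0 by the convention for division by zero, so the
  bounds 0 and 1 hold unconditionally.\<close>

definition f :: "('n \<Rightarrow> real \<times> complex) \<Rightarrow> 'n \<Rightarrow> real" where
  "f v i = \<eta> (v i) / (\<Sum>j\<in>UNIV. \<eta> (v j))"

primrec P :: "nat \<Rightarrow> real^'n \<Rightarrow> 'n \<Rightarrow> real \<times> complex" where
  "P 0 x = (\<lambda>i. (x $ i) *\<^sub>R gt 0)"
| "P (Suc k) x = (\<lambda>i. P k x i + f (P k x) i *\<^sub>R (gt (real (Suc k) * h) - gt (real k * h)))"

definition trunc :: "nat \<Rightarrow> real \<Rightarrow> real" where
  "trunc k l = max (real k * h) (min (real (Suc k) * h) l)"

text \<open>Since \<open>trunc k\<close> stops the clock at both ends of step \<open>k\<close>,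
  completed steps contribute in full, the current one in part and later ones nothing. The formula
  needs no case distinction on \<open>l\<close>, and differences can be taken term by term.\<close>

definition V :: "real \<Rightarrow> real^'n \<Rightarrow> 'n \<Rightarrow> real \<times> complex" where
  "V l x i = (x $ i) *\<^sub>R gt 0 + (\<Sum>k<N. f (P k x) i *\<^sub>R (gt (trunc k l) - gt (real k * h)))"

lemma node_le: "real k * h \<le> real m * h" if "k \<le> m" for k m
  using that h(1) by (intro mult_right_mono) auto

lemma node_bounds: "0 \<le> real k * h" "k \<le> N \<Longrightarrow> real k * h \<le> \<Lambda>"
  using h node_le[of k N] by auto

lemma Lambda_nonneg: "0 \<le> \<Lambda>" using node_bounds(1)[of N] h(2) by simp

lemma theta_delta_pos: "0 < \<theta> * \<delta>" using theta delta by simp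

lemma trunc_bounds: "real k * h \<le> trunc k l" "trunc k l \<le> real (Suc k) * h"
  using node_le[of k "Suc k"] by (auto simp: trunc_def)

lemma trunc_in: "k < N \<Longrightarrow> 0 \<le> trunc k l \<and> trunc k l \<le> \<Lambda>"
  using trunc_bounds[of k l] node_bounds(1)[of k] node_bounds(2)[of "Suc k"] by auto

lemma trunc_mono: "l \<le> l' \<Longrightarrow> trunc k l \<le> trunc k l'"
  by (auto simp: trunc_def)

lemma trunc_lip: "\<bar>trunc k l - trunc k l'\<bar> \<le> \<bar>l - l'\<bar>"
  by (auto simp: trunc_def)

lemma f_nonneg: "0 \<le> f v i" and f_le_1: "f v i \<le> 1"
proof -
  have s: "\<eta> (v i) \<le> (\<Sum>j\<in>UNIV. \<eta> (v j))" by (rule member_le_sum) (auto simp: eta_nonneg)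
  show "0 \<le> f v i" unfolding f_def by (intro divide_nonneg_nonneg sum_nonneg eta_nonneg)
  show "f v i \<le> 1" unfolding f_def using s eta_nonneg[of "v i"] by (auto simp: divide_le_eq)
qed

lemma sum_f: "0 < (\<Sum>j\<in>UNIV. \<eta> (v j)) \<Longrightarrow> (\<Sum>i\<in>UNIV. f v i) = 1"
  unfolding f_def by (simp add: sum_divide_distrib[symmetric])

lemma f_le: "\<theta> * \<delta> \<le> (\<Sum>j\<in>UNIV. \<eta> (v j)) \<Longrightarrow> f v i \<le> \<eta> (v i) / (\<theta> * \<delta>)"
  unfolding f_def by (rule frac_le[OF eta_nonneg order_refl theta_delta_pos])

lemma maxnorm_gt_diff:
  assumes "0 \<le> s" "s \<le> t" "t \<le> \<Lambda>" shows "maxnorm (gt t - gt s) \<le> t - s"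
  using g_lip[OF assms] assms by (auto simp: maxnorm_def gt_def)

lemma norm_gt_diff:
  assumes "0 \<le> s" "s \<le> t" "t \<le> \<Lambda>" shows "norm (gt t - gt s) \<le> sqrt 2 * (t - s)"
  by (rule order_trans[OF norm_le_maxnorm mult_left_mono[OF maxnorm_gt_diff[OF assms]]]) simp

lemma norm_gt0: "norm (gt 0) = sqrt 2 * \<rho>"
  using rho by (simp add: gt_def norm_prod_def norm_g0 real_sqrt_mult)

lemma P_eq: "P k x i = (x $ i) *\<^sub>R gt 0 + (\<Sum>j<k. f (P j x) i *\<^sub>R (gt (real (Suc j) * h) - gt (real j * h)))"
  by (induction k) auto

lemma V_step:
  assumes k: "k < N" and l: "real k * h \<le> l" "l \<le> real (Suc k) * h"
  shows "V l x i = P k x i + f (P k x) i *\<^sub>R (gt l - gt (real k * h))"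
proof -
  let ?t = "\<lambda>j. f (P j x) i *\<^sub>R (gt (trunc j l) - gt (real j * h))"
  have "{..<N} = {..<k} \<union> {k..<N}" using k by auto
  then have "(\<Sum>j<N. ?t j) = (\<Sum>j\<in>{..<k} \<union> {k..<N}. ?t j)" by simp
  also have "\<dots> = (\<Sum>j<k. ?t j) + (\<Sum>j\<in>{k..<N}. ?t j)"
    by (rule sum.union_disjoint) auto
  also have "(\<Sum>j\<in>{k..<N}. ?t j) = ?t k + (\<Sum>j\<in>{Suc k..<N}. ?t j)"
    using k by (simp add: sum.atLeast_Suc_lessThan)
  also have "(\<Sum>j\<in>{Suc k..<N}. ?t j) = 0"
  proof (rule sum.neutral, intro ballI)
    fix j assume "j \<in> {Suc k..<N}"
    then have "l \<le> real j * h" using node_le[of "Suc k" j] l by auto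
    then have "trunc j l = real j * h" using node_le[of j "Suc j"] by (auto simp: trunc_def)
    then show "?t j = 0" by simp
  qed
  also have "?t k = f (P k x) i *\<^sub>R (gt l - gt (real k * h))" using l by (simp add: trunc_def)
  also have "(\<Sum>j<k. ?t j) = (\<Sum>j<k. f (P j x) i *\<^sub>R (gt (real (Suc j) * h) - gt (real j * h)))"
  proof (intro sum.cong refl)
    fix j assume "j \<in> {..<k}"
    then have "real (Suc j) * h \<le> l" using node_le[of "Suc j" k] l by auto
    then have "trunc j l = real (Suc j) * h" using node_le[of j "Suc j"] by (auto simp: trunc_def)
    then show "?t j = f (P j x) i *\<^sub>R (gt (real (Suc j) * h) - gt (real j * h))" by simp
  qed
  finally show ?thesis unfolding V_def P_eq[of k x i] by simp
qed

lemma step_index: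
  assumes "0 \<le> l" "l \<le> \<Lambda>"
  obtains k where "k < N" "real k * h \<le> l" "l \<le> real (Suc k) * h"
proof -
  have "\<exists>k<m. real k * h \<le> l \<and> l \<le> real (Suc k) * h" if "0 < m" "l \<le> real m * h" for m
    using that
  proof (induction m)
    case (Suc m)
    show ?case
    proof (cases "real m * h \<le> l")
      case False
      then have "0 < m" using assms(1) by (cases m) auto
      then show ?thesis using Suc.IH False less_Suc_eq by auto
    qed (use Suc.prems in auto)
  qed simp
  then show ?thesis using N assms h(2) that by blast
qed

lemma V_node: "k < N \<Longrightarrow> V (real k * h) x i = P k x i"
  using V_step[of k "real k * h"] node_le[of k "Suc k"] by simp

lemma V_0: "V 0 x i = (x $ i) *\<^sub>R gt 0"
  using V_node[of 0] N by simp

text \<open>The two claims feed each other: as long as the sum lies on the curve, the weights add up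
  to at least \<open>\<theta> * \<delta>\<close>; hence the \<open>f\<close> add up to 1, and the
  next increment of the sum is that of the curve.\<close>

lemma sum_P:
  assumes x: "(\<Sum>i\<in>UNIV. x $ i) = 1" and k: "k \<le> N"
  shows "(\<Sum>i\<in>UNIV. P k x i) = gt (real k * h)"
    and weight_P: "\<theta> * \<delta> \<le> (\<Sum>i\<in>UNIV. \<eta> (P k x i))"
proof -
  have w: "\<theta> * \<delta> \<le> (\<Sum>i\<in>UNIV. \<eta> (P m x i))" if "m \<le> N" "(\<Sum>i\<in>UNIV. P m x i) = gt (real m * h)" for m
    by (rule weight_ge[of "real m * h"]) (use that node_bounds[of m] in \<open>auto simp: gt_def\<close>)
  show 1: "(\<Sum>i\<in>UNIV. P k x i) = gt (real k * h)"
    using k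
  proof (induction k)
    case 0 then show ?case using x by (simp add: scaleR_sum_left[symmetric])
  next
    case (Suc k)
    then have IH: "(\<Sum>i\<in>UNIV. P k x i) = gt (real k * h)" by simp
    then have "(\<Sum>i\<in>UNIV. f (P k x) i) = 1"
      using w[of k] Suc.prems theta_delta_pos by (intro sum_f) auto
    then show ?case using IH by (simp add: sum.distrib scaleR_sum_left[symmetric] del: of_nat_Suc)
  qed
  show "\<theta> * \<delta> \<le> (\<Sum>i\<in>UNIV. \<eta> (P k x i))" using w[OF k 1] .
qed

lemma sum_f_P: "(\<Sum>i\<in>UNIV. x $ i) = 1 \<Longrightarrow> k \<le> N \<Longrightarrow> (\<Sum>i\<in>UNIV. f (P k x) i) = 1"
  using weight_P[of x k] theta_delta_pos by (intro sum_f) auto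

lemma sum_V:
  assumes x: "(\<Sum>i\<in>UNIV. x $ i) = 1" and l: "0 \<le> l" "l \<le> \<Lambda>"
  shows "(\<Sum>i\<in>UNIV. V l x i) = gt l"
proof -
  obtain k where k: "k < N" "real k * h \<le> l" "l \<le> real (Suc k) * h" using step_index[OF l] .
  show ?thesis
    using sum_P[OF x, of k] sum_f_P[OF x, of k] k
    by (simp add: V_step[OF k] sum.distrib scaleR_sum_left[symmetric] del: of_nat_Suc)
qed

text \<open>The displacement is proportional to the weight of the component itself; this makes
  growth and decay at most exponential.\<close>

lemma step_displacement:
  assumes x: "(\<Sum>i\<in>UNIV. x $ i) = 1" and k: "k < N" "real k * h \<le> l" "l \<le> real (Suc k) * h"
  shows "norm (f (P k x) i *\<^sub>R (gt l - gt (real k * h))) \<le> c * (l - real k * h) * \<eta> (P k x i)"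
proof -
  have "l \<le> \<Lambda>" using node_bounds(2)[of "Suc k"] k by auto
  then have "norm (gt l - gt (real k * h)) \<le> sqrt 2 * (l - real k * h)"
    using k node_bounds(1)[of k] by (intro norm_gt_diff) auto
  moreover have "f (P k x) i \<le> \<eta> (P k x i) / (\<theta> * \<delta>)" using k by (intro f_le weight_P x) auto
  ultimately have "f (P k x) i * norm (gt l - gt (real k * h)) \<le> \<eta> (P k x i) / (\<theta> * \<delta>) * (sqrt 2 * (l - real k * h))"
    using eta_nonneg theta_delta_pos by (intro mult_mono) auto
  then have "norm (f (P k x) i *\<^sub>R (gt l - gt (real k * h)))
      \<le> \<eta> (P k x i) / (\<theta> * \<delta>) * (sqrt 2 * (l - real k * h))" by (simp add: f_nonneg)
  also have "\<dots> = c * (l - real k * h) * \<eta> (P k x i)" by (simp add: c_def)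
  finally show ?thesis .
qed

lemma norm_growth:
  assumes x: "(\<Sum>i\<in>UNIV. x $ i) = 1" and l: "0 \<le> l" "l \<le> \<Lambda>"
  shows "norm (V l x i) \<le> norm (P 0 x i) * exp (c * l)"
proof -
  have c0: "0 \<le> c" using theta_delta_pos by (simp add: c_def)
  have step: "norm (P k x i + f (P k x) i *\<^sub>R (gt l - gt (real k * h))) \<le> norm (P 0 x i) * exp (c * l)"
    if k: "k < N" "real k * h \<le> l" "l \<le> real (Suc k) * h"
      and IH: "norm (P k x i) \<le> norm (P 0 x i) * exp (c * (real k * h))" for k l
  proof -
    have u: "0 \<le> c * (l - real k * h)" using c0 k by simp
    have "norm (P k x i + f (P k x) i *\<^sub>R (gt l - gt (real k * h)))
        \<le> norm (P k x i) + c * (l - real k * h) * \<eta> (P k x i)"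
      using norm_triangle_le[of "P k x i"] step_displacement[OF x k, of i] by simp
    also have "\<dots> \<le> norm (P k x i) + c * (l - real k * h) * norm (P k x i)"
      using eta_le_norm u by (intro add_left_mono mult_left_mono) auto
    also have "\<dots> = norm (P k x i) * (1 + c * (l - real k * h))" by (simp add: algebra_simps)
    also have "\<dots> \<le> (norm (P 0 x i) * exp (c * (real k * h))) * exp (c * (l - real k * h))"
      using IH u exp_ge_add_one_self[of "c * (l - real k * h)"] by (intro mult_mono) auto
    also have "\<dots> = norm (P 0 x i) * exp (c * l)"
      by (simp add: mult.assoc exp_add[symmetric] algebra_simps)
    finally show ?thesis .
  qed
  have node: "norm (P k x i) \<le> norm (P 0 x i) * exp (c * (real k * h))" if "k \<le> N" for k
    using that
  proof (induction k)
    case (Suc k)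
    then show ?case using step[of k "real (Suc k) * h"] node_le[of k "Suc k"] by (simp del: of_nat_Suc P.simps(1))
  qed simp
  obtain k where k: "k < N" "real k * h \<le> l" "l \<le> real (Suc k) * h" using step_index[OF l] .
  show ?thesis using step[OF k node] k by (simp add: V_step[OF k] del: P.simps)
qed

text \<open>A step keeps at least the fraction \<open>1 - c * u\<close> of the weight. For positive
  \<open>u\<close> this is less than \<open>exp (- c * u)\<close>, hence the larger rate
  \<open>b\<close>.\<close>

lemma eta_decay:
  assumes x: "(\<Sum>i\<in>UNIV. x $ i) = 1" and l: "0 \<le> l" "l \<le> \<Lambda>"
  shows "\<eta> (P 0 x i) * exp (- b * l) \<le> \<eta> (V l x i)"
proof -
  have step: "\<eta> (P 0 x i) * exp (- b * l) \<le> \<eta> (P k x i + f (P k x) i *\<^sub>R (gt l - gt (real k * h)))"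
    if k: "k < N" "real k * h \<le> l" "l \<le> real (Suc k) * h"
      and IH: "\<eta> (P 0 x i) * exp (- b * (real k * h)) \<le> \<eta> (P k x i)" for k l
  proof -
    let ?u = "l - real k * h"
    have u: "0 \<le> ?u" "?u \<le> h" using k by (auto simp: algebra_simps)
    have "\<eta> (P 0 x i) * exp (- b * l) = (\<eta> (P 0 x i) * exp (- b * (real k * h))) * exp (- b * ?u)"
      by (simp add: mult.assoc exp_add[symmetric] algebra_simps)
    also have "\<dots> \<le> \<eta> (P k x i) * (1 - c * ?u)"
      using IH step_small[OF u] eta_nonneg by (intro mult_mono) auto
    also have "\<dots> = \<eta> (P k x i) - c * ?u * \<eta> (P k x i)" by (simp add: algebra_simps)
    also have "\<dots> \<le> \<eta> (P k x i + f (P k x) i *\<^sub>R (gt l - gt (real k * h)))"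
      using eta_lip[of "P k x i" "P k x i + f (P k x) i *\<^sub>R (gt l - gt (real k * h))"]
        step_displacement[OF x k, of i] by simp
    finally show ?thesis .
  qed
  have node: "\<eta> (P 0 x i) * exp (- b * (real k * h)) \<le> \<eta> (P k x i)" if "k \<le> N" for k
    using that
  proof (induction k)
    case (Suc k)
    then show ?case using step[of k "real (Suc k) * h"] node_le[of k "Suc k"] by (simp del: of_nat_Suc P.simps(1))
  qed simp
  obtain k where k: "k < N" "real k * h \<le> l" "l \<le> real (Suc k) * h" using step_index[OF l] .
  show ?thesis using step[OF k node] k by (simp add: V_step[OF k] del: P.simps)
qed

lemma norm_P0_le:
  assumes "0 \<le> x $ i" "x $ i \<le> 1"
  shows "norm (P 0 x i) \<le> sqrt 2 * \<rho>"
  using assms rho mult_right_mono[of "x $ i" 1 "sqrt 2 * \<rho>"] by (simp add: norm_gt0)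

text \<open>With positive starting coordinates no component ever reaches the zero set of \<eta>, so
  the chain rule applies at every node.\<close>

lemma eta_P_pos:
  assumes x: "(\<Sum>i\<in>UNIV. x $ i) = 1" "\<And>i. 0 < x $ i" and k: "k < N"
  shows "0 < \<eta> (P k x i)"
proof -
  have "x $ i \<le> (\<Sum>i\<in>UNIV. x $ i)" using x(2) by (intro member_le_sum) (auto simp: less_imp_le)
  then have "\<theta> * norm (P 0 x i) \<le> \<eta> (P 0 x i)"
    using x less_imp_le[OF x(2)] by (intro eta_init norm_P0_le) auto
  moreover have "0 < \<theta> * norm (P 0 x i)" using x(2)[of i] rho theta by (simp add: norm_gt0)
  ultimately have "0 < \<eta> (P 0 x i) * exp (- b * (real k * h))" by simp
  also have "\<dots> \<le> \<eta> (V (real k * h) x i)" using k node_bounds[of k] by (intro eta_decay x) auto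
  finally show ?thesis using V_node[OF k] by simp
qed

text \<open>A component starting near the origin stays near it, hence away from the singular set, while
  a component starting far enough loses at most the stated factor.\<close>

lemma V_far_from_singularities:
  assumes x: "(\<Sum>i\<in>UNIV. x $ i) = 1" "\<And>i. 0 \<le> x $ i" and l: "0 \<le> l'" "l' \<le> l" "l \<le> \<Lambda>"
  shows "norm (V l' x i) \<le> 2 * \<rho> \<or> \<rho> * exp (- 2 * sqrt 2 / \<delta> * l) \<le> \<eta> (V l' x i)"
proof (cases "norm (P 0 x i) * exp (b * l) \<le> 2 * \<rho>")
  case True
  have "0 \<le> c" using theta_delta_pos by (simp add: c_def)
  then have "c * l' \<le> b * l" using cb l by (intro mult_mono) auto
  then have "norm (P 0 x i) * exp (c * l') \<le> norm (P 0 x i) * exp (b * l)"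
    by (intro mult_left_mono) auto
  then show ?thesis using norm_growth[OF x(1), of l' i] l True by simp
next
  case False
  have b0: "0 \<le> b" using b_le(2) delta by (meson divide_nonneg_pos order_trans real_sqrt_ge_zero zero_le_numeral)
  have "x $ i \<le> (\<Sum>i\<in>UNIV. x $ i)" using x(2) by (intro member_le_sum) auto
  then have 1: "\<theta> * norm (P 0 x i) \<le> \<eta> (P 0 x i)"
    using x by (intro eta_init norm_P0_le) auto
  \<comment> \<open>The failed case supplies one exponential in the starting norm; the decay of the
    weight will cost a second one.\<close>
  have 2: "2 * \<rho> * exp (- b * l) \<le> norm (P 0 x i)"
    using False by (simp add: exp_minus field_simps)
  \<comment> \<open>The resulting lower bound is
    \<open>2 * \<theta> * \<rho> * exp (- 2 * b * l)\<close>; its factor \<open>2 * \<theta>\<close>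
    pays for replacing \<open>b\<close> by \<open>sqrt 2 / \<delta>\<close>.\<close>
  have "2 * (b - sqrt 2 / \<delta>) * l \<le> 2 * (b - sqrt 2 / \<delta>) * \<Lambda>" using b_le(2) l by (intro mult_left_mono) auto
  then have "exp (2 * (b - sqrt 2 / \<delta>) * l) \<le> 2 * \<theta>" using b_le(1) by (meson exp_le_cancel_iff order_trans)
  then have "\<rho> * exp (- 2 * b * l) * exp (2 * (b - sqrt 2 / \<delta>) * l) \<le> \<rho> * exp (- 2 * b * l) * (2 * \<theta>)"
    using rho by (intro mult_left_mono) auto
  also have "\<rho> * exp (- 2 * b * l) * exp (2 * (b - sqrt 2 / \<delta>) * l) = \<rho> * exp (- 2 * sqrt 2 / \<delta> * l)"
    by (simp add: mult.assoc exp_add[symmetric] algebra_simps)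
  also have "\<rho> * exp (- 2 * b * l) * (2 * \<theta>) = \<theta> * (2 * \<rho> * exp (- b * l)) * exp (- b * l)"
    by (simp add: mult.assoc exp_add[symmetric] algebra_simps)
  also have "\<dots> \<le> \<theta> * norm (P 0 x i) * exp (- b * l')"
    using 2 theta rho b0 l mult_left_mono[of l' l b] by (intro mult_mono mult_left_mono) auto
  also have "\<dots> \<le> \<eta> (P 0 x i) * exp (- b * l')" using 1 by (intro mult_right_mono) auto
  also have "\<dots> \<le> \<eta> (V l' x i)" using l by (intro eta_decay x) auto
  finally show ?thesis by simp
qed

text \<open>Every step adds a nonnegative multiple of an increment of \<open>gt\<close>, whose
  second component moves no further than its first. So the first component bounds the length of the
  curve run through by the second.\<close>

lemma V_increment:
  assumes l: "0 \<le> l" "l \<le> l'" "l' \<le> \<Lambda>"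
  shows "cmod (snd (V l' x i) - snd (V l x i)) \<le> fst (V l' x i) - fst (V l x i)"
proof -
  let ?t = "\<lambda>k. f (P k x) i *\<^sub>R (gt (trunc k l') - gt (trunc k l))"
  have eq: "V l' x i - V l x i = (\<Sum>k<N. ?t k)"
    by (simp add: V_def sum_subtractf[symmetric] scaleR_diff_right[symmetric])
  have "cmod (snd (V l' x i) - snd (V l x i)) = cmod (\<Sum>k<N. snd (?t k))"
    using arg_cong[OF eq, of snd] by (simp add: snd_sum)
  also have "\<dots> \<le> (\<Sum>k<N. cmod (snd (?t k)))" by (rule norm_sum)
  also have "\<dots> \<le> (\<Sum>k<N. fst (?t k))"
  proof (rule sum_mono)
    fix k assume "k \<in> {..<N}"
    then have "cmod (g (trunc k l') - g (trunc k l)) \<le> trunc k l' - trunc k l"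
      using trunc_in[of k l] trunc_in[of k l'] trunc_mono[OF l(2), of k] by (intro g_lip) auto
    then show "cmod (snd (?t k)) \<le> fst (?t k)"
      using f_nonneg by (auto simp: gt_def intro!: mult_left_mono)
  qed
  also have "\<dots> = fst (V l' x i) - fst (V l x i)"
    using arg_cong[OF eq, of fst] by (simp add: fst_sum)
  finally show ?thesis .
qed

section \<open>Lipschitz dependence on the starting point and derivatives of the scheme\<close>

lemma f_lipschitz:
  assumes v: "\<theta> * \<delta> \<le> (\<Sum>j\<in>UNIV. \<eta> (v j))" and w: "\<theta> * \<delta> \<le> (\<Sum>j\<in>UNIV. \<eta> (w j))"
  shows "\<bar>f v i - f w i\<bar> \<le> 2 / (\<theta> * \<delta>) * (\<Sum>j\<in>UNIV. norm (v j - w j))"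
proof -
  let ?D = "\<Sum>j\<in>UNIV. \<eta> (v j)" and ?E = "\<Sum>j\<in>UNIV. \<eta> (w j)" and ?S = "\<Sum>j\<in>UNIV. norm (v j - w j)"
  have D0: "0 < ?D" and E0: "0 < ?E" using v w theta_delta_pos by linarith+
  have "\<bar>?D - ?E\<bar> \<le> (\<Sum>j\<in>UNIV. \<bar>\<eta> (v j) - \<eta> (w j)\<bar>)"
    by (simp add: sum_subtractf[symmetric] sum_abs)
  also have "\<dots> \<le> ?S" by (intro sum_mono eta_lip)
  finally have DE: "\<bar>?D - ?E\<bar> \<le> ?S" .
  have "\<bar>\<eta> (v i) - \<eta> (w i)\<bar> \<le> norm (v i - w i)" by (rule eta_lip)
  also have "\<dots> \<le> ?S" by (rule member_le_sum) auto
  finally have ei: "\<bar>\<eta> (v i) - \<eta> (w i)\<bar> \<le> ?S" .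
  \<comment> \<open>Arranged so that \<open>?D\<close> is the only denominator left and the change
    of the denominator is multiplied by \<open>f w i\<close>, which is at most 1.\<close>
  have "f v i - f w i = ((\<eta> (v i) - \<eta> (w i)) - f w i * (?D - ?E)) / ?D"
    using D0 E0 by (simp add: f_def field_simps)
  then have "\<bar>f v i - f w i\<bar> = \<bar>(\<eta> (v i) - \<eta> (w i)) - f w i * (?D - ?E)\<bar> / ?D"
    using D0 by simp
  also have "\<dots> \<le> (2 * ?S) / (\<theta> * \<delta>)"
  proof (rule frac_le)
    have "\<bar>f w i * (?D - ?E)\<bar> \<le> 1 * ?S"
      unfolding abs_mult using f_nonneg f_le_1 DE by (intro mult_mono) auto
    then show "\<bar>(\<eta> (v i) - \<eta> (w i)) - f w i * (?D - ?E)\<bar> \<le> 2 * ?S"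
      using ei abs_triangle_ineq4[of "\<eta> (v i) - \<eta> (w i)" "f w i * (?D - ?E)"] by linarith
  qed (use v theta_delta_pos in \<open>auto intro: sum_nonneg\<close>)
  finally show ?thesis by simp
qed

text \<open>Induction over the steps, with a constant of no controlled size: it serves the
  regularity of the deformation only, while the growth of the Jacobian is measured on the
  derivative.\<close>

lemma P_lipschitz:
  "\<exists>C\<ge>0. \<forall>x y. (\<Sum>i\<in>UNIV. x $ i) = 1 \<longrightarrow> (\<Sum>i\<in>UNIV. y $ i) = 1 \<longrightarrow>
     (\<forall>i. norm (P k x i - P k y i) \<le> C * (\<Sum>j\<in>UNIV. \<bar>x $ j - y $ j\<bar>)
        \<and> \<bar>f (P k x) i - f (P k y) i\<bar> \<le> C * (\<Sum>j\<in>UNIV. \<bar>x $ j - y $ j\<bar>))" if "k \<le> N" for k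
proof -
  let ?S = "\<lambda>x y :: real^'n. \<Sum>j\<in>UNIV. \<bar>x $ j - y $ j\<bar>"
  have S0: "0 \<le> ?S x y" for x y by (intro sum_nonneg) auto
  have ext: "\<exists>C\<ge>0. \<forall>x y. (\<Sum>i\<in>UNIV. x $ i) = 1 \<longrightarrow> (\<Sum>i\<in>UNIV. y $ i) = 1 \<longrightarrow>
     (\<forall>i. norm (P k x i - P k y i) \<le> C * ?S x y \<and> \<bar>f (P k x) i - f (P k y) i\<bar> \<le> C * ?S x y)"
    if k: "k \<le> N" and C: "C \<ge> 0" and P: "\<And>x y i. (\<Sum>i\<in>UNIV. x $ i) = 1 \<Longrightarrow> (\<Sum>i\<in>UNIV. y $ i) = 1 \<Longrightarrow>
      norm (P k x i - P k y i) \<le> C * ?S x y" for k C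
  proof -
    define C' where "C' = 2 / (\<theta> * \<delta>) * (real CARD('n) * C)"
    have C0: "0 \<le> C'" using C theta_delta_pos by (simp add: C'_def)
    have "\<bar>f (P k x) i - f (P k y) i\<bar> \<le> C' * ?S x y"
      if xy: "(\<Sum>i\<in>UNIV. x $ i) = 1" "(\<Sum>i\<in>UNIV. y $ i) = 1" for x y i
    proof -
      have "\<bar>f (P k x) i - f (P k y) i\<bar> \<le> 2 / (\<theta> * \<delta>) * (\<Sum>j\<in>UNIV. norm (P k x j - P k y j))"
        by (intro f_lipschitz weight_P xy k)
      also have "\<dots> \<le> 2 / (\<theta> * \<delta>) * (\<Sum>j\<in>(UNIV::'n set). C * ?S x y)"
        using theta_delta_pos P[OF xy] by (intro mult_left_mono sum_mono) auto
      finally show ?thesis by (simp add: C'_def mult.assoc)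
    qed
    moreover have "C * ?S x y \<le> (C + C') * ?S x y" "C' * ?S x y \<le> (C + C') * ?S x y" for x y
      using S0 C C0 by (auto intro!: mult_right_mono)
    ultimately show ?thesis
      using P C C0 by (intro exI[of _ "C + C'"]) (meson add_nonneg_nonneg order_trans)
  qed
  show ?thesis
    using that
  proof (induction k)
    case 0
    show ?case
    proof (rule ext)
      show "norm (P 0 x i - P 0 y i) \<le> norm (gt 0) * ?S x y" for x y i
      proof -
        have "\<bar>x $ i - y $ i\<bar> \<le> ?S x y" by (rule member_le_sum) auto
        then have "\<bar>x $ i - y $ i\<bar> * norm (gt 0) \<le> ?S x y * norm (gt 0)" by (intro mult_right_mono) auto
        then show ?thesis by (simp add: scaleR_diff_left[symmetric] mult.commute)
      qed
    qed auto
  next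
    case (Suc k)
    then obtain C where C: "C \<ge> 0" "\<And>x y i. (\<Sum>i\<in>UNIV. x $ i) = 1 \<Longrightarrow> (\<Sum>i\<in>UNIV. y $ i) = 1 \<Longrightarrow>
        norm (P k x i - P k y i) \<le> C * ?S x y \<and> \<bar>f (P k x) i - f (P k y) i\<bar> \<le> C * ?S x y"
      by (meson Suc_leD)
    let ?w = "gt (real (Suc k) * h) - gt (real k * h)"
    show ?case
    proof (rule ext)
      show "0 \<le> C + C * norm ?w" using C by simp
      show "norm (P (Suc k) x i - P (Suc k) y i) \<le> (C + C * norm ?w) * ?S x y"
        if xy: "(\<Sum>i\<in>UNIV. x $ i) = 1" "(\<Sum>i\<in>UNIV. y $ i) = 1" for x y i
      proof -
        have "P (Suc k) x i - P (Suc k) y i = (P k x i - P k y i) + (f (P k x) i - f (P k y) i) *\<^sub>R ?w"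
          by (simp add: scaleR_diff_left del: of_nat_Suc)
        then have "norm (P (Suc k) x i - P (Suc k) y i)
            \<le> norm (P k x i - P k y i) + \<bar>f (P k x) i - f (P k y) i\<bar> * norm ?w"
          by (metis norm_scaleR norm_triangle_ineq)
        also have "\<dots> \<le> C * ?S x y + (C * ?S x y) * norm ?w"
          using C(2)[OF xy, of i] by (intro add_mono mult_right_mono) auto
        finally show ?thesis by (simp add: algebra_simps)
      qed
    qed (use Suc in auto)
  qed
qed

text \<open>The \<open>f\<close> add up to 1, so their derivatives \<open>F i\<close> add up to 0
  and the column sums are preserved. The quotient rule produces two terms, each at most the sum of
  the \<open>norm (D i e)\<close> over \<open>\<theta> * \<delta>\<close>; passing to
  \<open>maxnorm\<close> costs \<open>sqrt 2\<close>, and 2 sqrt 2 / \<theta> is at most 3.\<close>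

lemma step_derivative:
  fixes v :: "real^'n \<Rightarrow> 'n \<Rightarrow> real \<times> complex"
  assumes vd: "\<And>i. ((\<lambda>x. v x i) has_derivative D i) (at x0)"
    and pos: "\<And>i. 0 < \<eta> (v x0 i)" and low: "\<theta> * \<delta> \<le> (\<Sum>j\<in>UNIV. \<eta> (v x0 j))"
    and w: "maxnorm w \<le> u"
    and bound: "\<And>j. (\<Sum>i\<in>UNIV. maxnorm (D i (axis j 1))) \<le> B"
    and colsum: "\<And>e. (\<Sum>i\<in>UNIV. snd (D i e)) = of_real (\<Sum>j\<in>UNIV. e $ j) * g 0"
  obtains F where "\<And>i. ((\<lambda>x. f (v x) i) has_derivative F i) (at x0)"
    "\<And>j. (\<Sum>i\<in>UNIV. maxnorm (D i (axis j 1) + F i (axis j 1) *\<^sub>R w)) \<le> B * exp (3 / \<delta> * u)"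
    "\<And>e. (\<Sum>i\<in>UNIV. snd (D i e + F i e *\<^sub>R w)) = of_real (\<Sum>j\<in>UNIV. e $ j) * g 0"
proof -
  let ?M = "\<Sum>j\<in>UNIV. \<eta> (v x0 j)"
  have M: "0 < ?M" using low theta_delta_pos by linarith
  have "\<exists>E. (\<eta> has_derivative E) (at (v x0 i))" for i
    using eta_diff[OF pos] by (auto simp: differentiable_def)
  then obtain E where E: "\<And>i. (\<eta> has_derivative E i) (at (v x0 i))" by metis
  define H where "H i e = E i (D i e)" for i e
  have Hd: "((\<lambda>x. \<eta> (v x i)) has_derivative H i) (at x0)" for i
    using diff_chain_at[OF vd E, of i] by (simp add: o_def H_def[abs_def])
  have Hb: "\<bar>H i e\<bar> \<le> norm (D i e)" for i e
    unfolding H_def by (rule has_derivative_bound_of_lipschitz[OF E eta_lip])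
  define F where "F i e = (H i e * ?M - \<eta> (v x0 i) * (\<Sum>j\<in>UNIV. H j e)) / (?M * ?M)" for i e
  have Fd: "((\<lambda>x. f (v x) i) has_derivative F i) (at x0)" for i
    unfolding f_def F_def using M
    by (intro has_derivative_divide' Hd has_derivative_sum) auto
  have Feq: "F i e = (H i e - f (v x0) i * (\<Sum>j\<in>UNIV. H j e)) / ?M" for i e
    using M by (simp add: F_def f_def field_simps)
  have F0: "(\<Sum>i\<in>UNIV. F i e) = 0" for e
    unfolding Feq using sum_f[OF M]
    by (simp add: sum_divide_distrib[symmetric] sum_subtractf sum_distrib_right[symmetric])
  have Fabs: "(\<Sum>i\<in>UNIV. \<bar>F i e\<bar>) \<le> 2 / (\<theta> * \<delta>) * (\<Sum>i\<in>UNIV. norm (D i e))" for e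
  proof -
    have "(\<Sum>i\<in>UNIV. \<bar>F i e\<bar>) = (\<Sum>i\<in>UNIV. \<bar>H i e - f (v x0) i * (\<Sum>j\<in>UNIV. H j e)\<bar>) / ?M"
      unfolding Feq using M by (simp add: sum_divide_distrib)
    also have "\<dots> \<le> (2 * (\<Sum>i\<in>UNIV. norm (D i e))) / (\<theta> * \<delta>)"
    proof (rule frac_le)
      have "(\<Sum>i\<in>UNIV. \<bar>H i e - f (v x0) i * (\<Sum>j\<in>UNIV. H j e)\<bar>)
          \<le> (\<Sum>i\<in>UNIV. \<bar>H i e\<bar> + f (v x0) i * \<bar>\<Sum>j\<in>UNIV. H j e\<bar>)"
      proof (rule sum_mono)
        fix i
        show "\<bar>H i e - f (v x0) i * (\<Sum>j\<in>UNIV. H j e)\<bar> \<le> \<bar>H i e\<bar> + f (v x0) i * \<bar>\<Sum>j\<in>UNIV. H j e\<bar>"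
          using abs_triangle_ineq4[of "H i e" "f (v x0) i * (\<Sum>j\<in>UNIV. H j e)"] f_nonneg[of "v x0" i]
          by (simp add: abs_mult)
      qed
      also have "\<dots> = (\<Sum>i\<in>UNIV. \<bar>H i e\<bar>) + \<bar>\<Sum>j\<in>UNIV. H j e\<bar>"
        using sum_f[OF M] by (simp add: sum.distrib sum_distrib_right[symmetric])
      also have "\<dots> \<le> 2 * (\<Sum>i\<in>UNIV. \<bar>H i e\<bar>)" using sum_abs[of "\<lambda>j. H j e" UNIV] by simp
      also have "\<dots> \<le> 2 * (\<Sum>i\<in>UNIV. norm (D i e))" using Hb by (simp add: sum_mono)
      finally show "(\<Sum>i\<in>UNIV. \<bar>H i e - f (v x0) i * (\<Sum>j\<in>UNIV. H j e)\<bar>) \<le> 2 * (\<Sum>i\<in>UNIV. norm (D i e))" .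
    qed (use low theta_delta_pos in \<open>auto intro: sum_nonneg\<close>)
    finally show ?thesis by simp
  qed
  have u0: "0 \<le> u" using w maxnorm_bounds(1)[of w] by linarith
  show ?thesis
  proof (rule that[of F])
    show "((\<lambda>x. f (v x) i) has_derivative F i) (at x0)" for i by (rule Fd)
    show "(\<Sum>i\<in>UNIV. snd (D i e + F i e *\<^sub>R w)) = of_real (\<Sum>j\<in>UNIV. e $ j) * g 0" for e
      using F0 by (simp add: sum.distrib colsum scaleR_sum_left[symmetric])
    fix j
    let ?e = "axis j 1 :: real^'n"
    have B0: "0 \<le> B" using bound[of j] maxnorm_bounds(1) by (meson order_trans sum_nonneg)
    have "(\<Sum>i\<in>UNIV. norm (D i ?e)) \<le> (\<Sum>i\<in>UNIV. sqrt 2 * maxnorm (D i ?e))"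
      by (intro sum_mono norm_le_maxnorm)
    also have "\<dots> \<le> sqrt 2 * B" using bound[of j] by (simp add: sum_distrib_left[symmetric])
    finally have nD: "(\<Sum>i\<in>UNIV. norm (D i ?e)) \<le> sqrt 2 * B" .
    have "(\<Sum>i\<in>UNIV. maxnorm (D i ?e + F i ?e *\<^sub>R w)) \<le> (\<Sum>i\<in>UNIV. maxnorm (D i ?e) + \<bar>F i ?e\<bar> * u)"
      by (intro sum_mono order_trans[OF maxnorm_add_scaleR] add_left_mono mult_left_mono w) auto
    also have "\<dots> \<le> B + (\<Sum>i\<in>UNIV. \<bar>F i ?e\<bar>) * u"
      using bound[of j] by (simp add: sum.distrib sum_distrib_right)
    also have "\<dots> \<le> B + (2 / (\<theta> * \<delta>) * (sqrt 2 * B)) * u"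
      using Fabs[of ?e] nD u0 theta_delta_pos
      by (intro add_left_mono mult_right_mono order_trans[OF Fabs] mult_left_mono) auto
    also have "\<dots> = B * (1 + (2 * sqrt 2 / \<theta>) / \<delta> * u)" by (simp add: algebra_simps)
    also have "\<dots> \<le> B * (1 + 3 / \<delta> * u)"
      using theta delta u0 B0 by (intro mult_left_mono add_left_mono mult_right_mono divide_right_mono) (auto simp: divide_le_eq)
    also have "\<dots> \<le> B * exp (3 / \<delta> * u)"
      using B0 exp_ge_add_one_self by (intro mult_left_mono) auto
    finally show "(\<Sum>i\<in>UNIV. maxnorm (D i ?e + F i ?e *\<^sub>R w)) \<le> B * exp (3 / \<delta> * u)" .
  qed
qed

text \<open>The derivative is taken in all directions, also across the face, since positive weights
  at the point itself suffice for it. Columns of this full derivative are what the Jacobian of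
  \<open>G\<close> is decomposed into.\<close>

lemma P_derivative:
  assumes x: "(\<Sum>i\<in>UNIV. x $ i) = 1" "\<And>i. 0 < x $ i" and k: "k < N"
  shows "\<exists>D. (\<forall>i. ((\<lambda>x. P k x i) has_derivative D i) (at x)) \<and>
    (\<forall>j. (\<Sum>i\<in>UNIV. maxnorm (D i (axis j 1))) \<le> \<rho> * exp (3 / \<delta> * (real k * h))) \<and>
    (\<forall>e. (\<Sum>i\<in>UNIV. snd (D i e)) = of_real (\<Sum>j\<in>UNIV. e $ j) * g 0)"
  using k
proof (induction k)
  case 0
  have ms: "maxnorm (c *\<^sub>R gt 0) = \<bar>c\<bar> * \<rho>" for c
    using rho by (simp add: maxnorm_def gt_def norm_g0 abs_mult)
  show ?case
  proof (intro exI[of _ "\<lambda>i e. (e $ i) *\<^sub>R gt 0"] conjI allI)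
    show "((\<lambda>x. P 0 x i) has_derivative (\<lambda>e. (e $ i) *\<^sub>R gt 0)) (at x)" for i
      using bounded_linear_imp_has_derivative[OF bounded_linear_compose[OF
          bounded_linear_scaleR_left[of "gt 0"] bounded_linear_vec_nth[of i]]] by simp
    show "(\<Sum>i\<in>UNIV. maxnorm ((axis j 1 :: real^'n) $ i *\<^sub>R gt 0)) \<le> \<rho> * exp (3 / \<delta> * (real 0 * h))" for j
      by (simp add: ms axis_def if_distrib[of abs] if_distrib[of "\<lambda>c. c * \<rho>"] sum.delta cong: if_cong)
    show "(\<Sum>i\<in>UNIV. snd ((e $ i) *\<^sub>R gt 0)) = of_real (\<Sum>j\<in>UNIV. e $ j) * g 0" for e :: "real^'n"
      by (simp add: gt_def scaleR_conv_of_real sum_distrib_right)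
  qed
next
  case (Suc k)
  then obtain D where D: "\<And>i. ((\<lambda>x. P k x i) has_derivative D i) (at x)"
    "\<And>j. (\<Sum>i\<in>UNIV. maxnorm (D i (axis j 1))) \<le> \<rho> * exp (3 / \<delta> * (real k * h))"
    "\<And>e. (\<Sum>i\<in>UNIV. snd (D i e)) = of_real (\<Sum>j\<in>UNIV. e $ j) * g 0"
    using Suc_lessD by blast
  let ?w = "gt (real (Suc k) * h) - gt (real k * h)"
  have w: "maxnorm ?w \<le> h"
    using maxnorm_gt_diff[of "real k * h" "real (Suc k) * h"] node_le[of k "Suc k"]
      node_bounds(1)[of k] node_bounds(2)[of "Suc k"] Suc.prems by (simp add: algebra_simps)
  have kN: "k < N" "k \<le> N" using Suc.prems by auto
  obtain F where F: "\<And>i. ((\<lambda>x. f (P k x) i) has_derivative F i) (at x)"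
    "\<And>j. (\<Sum>i\<in>UNIV. maxnorm (D i (axis j 1) + F i (axis j 1) *\<^sub>R ?w)) \<le> \<rho> * exp (3 / \<delta> * (real k * h)) * exp (3 / \<delta> * h)"
    "\<And>e. (\<Sum>i\<in>UNIV. snd (D i e + F i e *\<^sub>R ?w)) = of_real (\<Sum>j\<in>UNIV. e $ j) * g 0"
    using step_derivative[OF D(1) eta_P_pos[OF x kN(1)] weight_P[OF x(1) kN(2)] w D(2) D(3)] by blast
  show ?case
  proof (intro exI[of _ "\<lambda>i e. D i e + F i e *\<^sub>R ?w"] conjI allI)
    show "((\<lambda>x. P (Suc k) x i) has_derivative (\<lambda>e. D i e + F i e *\<^sub>R ?w)) (at x)" for i
      unfolding P.simps by (intro has_derivative_add D(1) has_derivative_scaleR_left F(1))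
    show "(\<Sum>i\<in>UNIV. maxnorm (D i (axis j 1) + F i (axis j 1) *\<^sub>R ?w)) \<le> \<rho> * exp (3 / \<delta> * (real (Suc k) * h))" for j
      using F(2)[of j] by (simp add: mult.assoc exp_add[symmetric] algebra_simps)
  qed (rule F(3))
qed

text \<open>The derivatives of \<open>P k\<close> and \<open>f (P k)\<close> are kept apart because
  in \<open>G\<close> the level \<open>l\<close> varies together with the starting point.\<close>

lemma V_derivative:
  assumes x: "(\<Sum>i\<in>UNIV. x $ i) = 1" "\<And>i. 0 < x $ i"
    and k: "k < N" "real k * h \<le> l" "l \<le> real (Suc k) * h"
  obtains D F where "\<And>i. ((\<lambda>x. P k x i) has_derivative D i) (at x)"
    "\<And>i. ((\<lambda>x. f (P k x) i) has_derivative F i) (at x)"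
    "\<And>j. (\<Sum>i\<in>UNIV. maxnorm (D i (axis j 1) + F i (axis j 1) *\<^sub>R (gt l - gt (real k * h)))) \<le> \<rho> * exp (3 / \<delta> * l)"
    "\<And>e. (\<Sum>i\<in>UNIV. snd (D i e + F i e *\<^sub>R (gt l - gt (real k * h)))) = of_real (\<Sum>j\<in>UNIV. e $ j) * g 0"
proof -
  obtain D where D: "\<And>i. ((\<lambda>x. P k x i) has_derivative D i) (at x)"
    "\<And>j. (\<Sum>i\<in>UNIV. maxnorm (D i (axis j 1))) \<le> \<rho> * exp (3 / \<delta> * (real k * h))"
    "\<And>e. (\<Sum>i\<in>UNIV. snd (D i e)) = of_real (\<Sum>j\<in>UNIV. e $ j) * g 0"
    using P_derivative[OF x k(1)] by blast
  have "l \<le> \<Lambda>" using node_bounds(2)[of "Suc k"] k by auto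
  then have w: "maxnorm (gt l - gt (real k * h)) \<le> l - real k * h"
    using k node_bounds(1)[of k] by (intro maxnorm_gt_diff) auto
  have kN: "k \<le> N" using k by auto
  obtain F where F: "\<And>i. ((\<lambda>x. f (P k x) i) has_derivative F i) (at x)"
    "\<And>j. (\<Sum>i\<in>UNIV. maxnorm (D i (axis j 1) + F i (axis j 1) *\<^sub>R (gt l - gt (real k * h)))) \<le> \<rho> * exp (3 / \<delta> * (real k * h)) * exp (3 / \<delta> * (l - real k * h))"
    "\<And>e. (\<Sum>i\<in>UNIV. snd (D i e + F i e *\<^sub>R (gt l - gt (real k * h)))) = of_real (\<Sum>j\<in>UNIV. e $ j) * g 0"
    using step_derivative[OF D(1) eta_P_pos[OF x k(1)] weight_P[OF x(1) kN] w D(2) D(3)] by blast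
  show ?thesis
  proof (rule that[OF D(1) F(1) _ F(3)])
    show "(\<Sum>i\<in>UNIV. maxnorm (D i (axis j 1) + F i (axis j 1) *\<^sub>R (gt l - gt (real k * h)))) \<le> \<rho> * exp (3 / \<delta> * l)" for j
      using F(2)[of j] by (simp add: mult.assoc exp_add[symmetric] algebra_simps)
  qed
qed

section \<open>Extension of the scheme from the face to a dilated simplex\<close>

definition mu :: "real^'n \<Rightarrow> real" where "mu z = max 1 (\<Sum>i\<in>UNIV. z $ i)"

text \<open>Beyond the face the level has derivative \<delta> divided by the sum of the coordinates,
  and the dilation in \<open>Psi\<close> inverts the logarithm. The maximum in \<open>mu\<close>
  makes the level 0 up to the face.\<close>

definition lev :: "real^'n \<Rightarrow> real" where "lev z = \<delta> * ln (mu z)"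

text \<open>The scheme is only stable on the face \<open>\<Sum> x = 1\<close>, where the weights add up to at least
  \<open>\<theta> \<delta>\<close>. A point beyond the face is moved along the face trajectory in its direction,
  for the arc length given by the logarithm of its distance.\<close>

definition G :: "real^'n \<Rightarrow> 'n \<Rightarrow> real \<times> complex" where
  "G z i = V (lev z) ((1 / mu z) *\<^sub>R z) i"

definition Z :: "(real^'n) set" where
  "Z = {z. (\<forall>i. 0 \<le> z $ i) \<and> (\<Sum>i\<in>UNIV. z $ i) \<le> exp (\<Lambda> / \<delta>)}"

lemma mu_ge_1: "1 \<le> mu z" by (simp add: mu_def)

lemma lev_nonneg: "0 \<le> lev z"
  using delta mu_ge_1[of z] by (simp add: lev_def)

lemma lev_le_of_sum_le:
  assumes "(\<Sum>i\<in>UNIV. z $ i) \<le> exp (l / \<delta>)" "0 \<le> l" shows "lev z \<le> l"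
proof -
  have "mu z \<le> exp (l / \<delta>)" using assms delta by (simp add: mu_def)
  then have "ln (mu z) \<le> ln (exp (l / \<delta>))" using mu_ge_1[of z] by (intro ln_mono) auto
  then have "ln (mu z) \<le> l / \<delta>" by simp
  then show ?thesis using delta by (simp add: lev_def field_simps)
qed

lemma lev_le: "z \<in> Z \<Longrightarrow> lev z \<le> \<Lambda>"
  by (rule lev_le_of_sum_le) (auto simp: Z_def Lambda_nonneg)

lemma G_small:
  assumes "(\<Sum>i\<in>UNIV. z $ i) \<le> 1" shows "G z i = (z $ i) *\<^sub>R gt 0"
proof -
  have "mu z = 1" using assms by (simp add: mu_def)
  then show ?thesis by (simp add: G_def lev_def V_0)
qed

lemma sum_normalised: "1 \<le> (\<Sum>i\<in>UNIV. z $ i) \<Longrightarrow> (\<Sum>i\<in>UNIV. ((1 / mu z) *\<^sub>R z) $ i) = 1"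
  by (simp add: mu_def sum_divide_distrib[symmetric])

lemma sum_G:
  assumes "z \<in> Z" "1 \<le> (\<Sum>i\<in>UNIV. z $ i)" shows "(\<Sum>i\<in>UNIV. G z i) = gt (lev z)"
  unfolding G_def by (intro sum_V sum_normalised assms lev_nonneg lev_le)

lemma Z_scale: "z \<in> Z \<Longrightarrow> 0 \<le> r \<Longrightarrow> r \<le> 1 \<Longrightarrow> r *\<^sub>R z \<in> Z"
proof -
  assume z: "z \<in> Z" "0 \<le> r" "r \<le> 1"
  have "r * (\<Sum>i\<in>UNIV. z $ i) \<le> 1 * (\<Sum>i\<in>UNIV. z $ i)"
    using z by (intro mult_right_mono sum_nonneg) (auto simp: Z_def)
  then show ?thesis using z by (auto simp: Z_def sum_distrib_left[symmetric])
qed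

text \<open>The point 0 has weight 0, so a component that starts there receives no
  increment.\<close>

lemma G_zero: "z $ i = 0 \<Longrightarrow> G z i = 0"
proof -
  assume z: "z $ i = 0"
  have e0: "\<eta> 0 = 0" using eta_le_norm[of 0] eta_nonneg[of 0] by simp
  have P0: "P k ((1 / mu z) *\<^sub>R z) i = 0" for k
    by (induction k) (simp_all add: z f_def e0)
  then show ?thesis by (simp add: G_def V_def z f_def e0)
qed

text \<open>Along a ray the direction is constant: the component first moves linearly and then along
  one face trajectory whose level increases. Two parameters on different sides of the face are
  joined at the parameter where the ray crosses it.\<close>

lemma G_increment:
  assumes z: "z \<in> Z" and r: "0 \<le> r" "r \<le> r'" "r' \<le> 1"
  shows "cmod (snd (G (r' *\<^sub>R z) i) - snd (G (r *\<^sub>R z) i)) \<le> fst (G (r' *\<^sub>R z) i) - fst (G (r *\<^sub>R z) i)"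
proof -
  let ?y = "\<Sum>i\<in>UNIV. z $ i"
  have y: "(\<Sum>i\<in>UNIV. (r *\<^sub>R z) $ i) = r * ?y" for r by (simp add: sum_distrib_left)
  have zi: "0 \<le> z $ i" using z by (simp add: Z_def)
  have y0: "0 \<le> ?y" using z by (auto simp: Z_def intro: sum_nonneg)
  have small: "cmod (snd (G (t *\<^sub>R z) i) - snd (G (s *\<^sub>R z) i)) \<le> fst (G (t *\<^sub>R z) i) - fst (G (s *\<^sub>R z) i)"
    if st: "0 \<le> s" "s \<le> t" "t * ?y \<le> 1" for s t
  proof -
    have "s * ?y \<le> 1" using st mult_right_mono[OF st(2) y0] by linarith
    then have "G (t *\<^sub>R z) i = (t * z $ i) *\<^sub>R gt 0" "G (s *\<^sub>R z) i = (s * z $ i) *\<^sub>R gt 0"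
      using st G_small[of "t *\<^sub>R z" i] G_small[of "s *\<^sub>R z" i] unfolding y by simp_all
    moreover have "0 \<le> t * z $ i - s * z $ i" using mult_right_mono[OF st(2) zi] by simp
    ultimately show ?thesis
      by (simp add: gt_def scaleR_diff_left[symmetric] norm_g0 left_diff_distrib[symmetric])
  qed
  have large: "cmod (snd (G (t *\<^sub>R z) i) - snd (G (s *\<^sub>R z) i)) \<le> fst (G (t *\<^sub>R z) i) - fst (G (s *\<^sub>R z) i)"
    if st: "0 \<le> s" "s \<le> t" "1 \<le> s * ?y" "t \<le> 1" for s t
  proof -
    have ty: "1 \<le> t * ?y" using st mult_right_mono[OF st(2) y0] by linarith
    have mut: "mu (t *\<^sub>R z) = t * ?y" and mus: "mu (s *\<^sub>R z) = s * ?y"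
      using ty st unfolding mu_def y by simp_all
    have "s \<noteq> 0" "t \<noteq> 0" using st ty by auto
    then have dir: "(1 / mu (t *\<^sub>R z)) *\<^sub>R t *\<^sub>R z = (1 / ?y) *\<^sub>R z" "(1 / mu (s *\<^sub>R z)) *\<^sub>R s *\<^sub>R z = (1 / ?y) *\<^sub>R z"
      by (simp_all add: mut mus)
    have "ln (s * ?y) \<le> ln (t * ?y)" using st mult_right_mono[OF st(2) y0] by (intro ln_mono) auto
    then have "lev (s *\<^sub>R z) \<le> lev (t *\<^sub>R z)" using delta by (simp add: lev_def mut mus)
    moreover have "lev (t *\<^sub>R z) \<le> \<Lambda>" using st by (intro lev_le Z_scale z) auto
    ultimately show ?thesis unfolding G_def dir by (intro V_increment lev_nonneg)
  qed
  show ?thesis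
  proof (cases "r' * ?y \<le> 1 \<or> 1 \<le> r * ?y")
    case True then show ?thesis using small[of r r'] large[of r r'] r by auto
  next
    case False
    then have yp: "0 < ?y" using y0 by (cases "?y = 0") auto
    let ?q = "1 / ?y"
    have q: "0 \<le> ?q" "r \<le> ?q" "?q \<le> r'" "?q * ?y = 1"
      using False yp by (auto simp: field_simps)
    have "cmod (snd (G (?q *\<^sub>R z) i) - snd (G (r *\<^sub>R z) i)) \<le> fst (G (?q *\<^sub>R z) i) - fst (G (r *\<^sub>R z) i)"
      by (rule small) (use q r in auto)
    moreover have "cmod (snd (G (r' *\<^sub>R z) i) - snd (G (?q *\<^sub>R z) i)) \<le> fst (G (r' *\<^sub>R z) i) - fst (G (?q *\<^sub>R z) i)"
      by (rule large) (use q r in auto)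
    ultimately show ?thesis
      using norm_triangle_ineq[of "snd (G (r' *\<^sub>R z) i) - snd (G (?q *\<^sub>R z) i)" "snd (G (?q *\<^sub>R z) i) - snd (G (r *\<^sub>R z) i)"]
      by simp
  qed
qed

lemma G_far_from_singularities:
  assumes z: "z \<in> Z" and l: "lev z \<le> l" "l \<le> \<Lambda>"
  shows "norm (G z i) \<le> 2 * \<rho> \<or> \<rho> * exp (- 2 * sqrt 2 / \<delta> * l) \<le> \<eta> (G z i)"
proof (cases "(\<Sum>i\<in>UNIV. z $ i) \<le> 1")
  case True
  have "z $ i \<le> (\<Sum>i\<in>UNIV. z $ i)" using z by (intro member_le_sum) (auto simp: Z_def)
  then have "norm (P 0 z i) \<le> sqrt 2 * \<rho>" using z True by (intro norm_P0_le) (auto simp: Z_def)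
  moreover have "sqrt 2 * \<rho> \<le> 2 * \<rho>" using rho sqrt2_less_2 by (intro mult_right_mono) auto
  ultimately show ?thesis using True by (simp add: G_small)
next
  case False
  then show ?thesis unfolding G_def
    using z mu_ge_1[of z] by (intro V_far_from_singularities sum_normalised lev_nonneg l) (auto simp: Z_def)
qed

text \<open>The weights \<open>f\<close> are known to be Lipschitz only for starting points of sum
  1. Below the face the normalised point is not of this kind, but its level is 0 and every increment
  of \<open>gt\<close> vanishes, so there is no difference of weights to estimate.\<close>

lemma G_lipschitz:
  obtains C where "0 \<le> C"
    "\<And>z z' i. z \<in> Z \<Longrightarrow> z' \<in> Z \<Longrightarrow> norm (G z i - G z' i) \<le> C * (\<Sum>j\<in>UNIV. \<bar>z $ j - z' $ j\<bar>)"
proof -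
  let ?S = "\<lambda>x y :: real^'n. \<Sum>j\<in>UNIV. \<bar>x $ j - y $ j\<bar>"
  let ?m = "\<lambda>z. (1 / mu z) *\<^sub>R z"
  have S0: "0 \<le> ?S x y" for x y by (intro sum_nonneg) auto
  have "\<forall>k. \<exists>C\<ge>0. k \<le> N \<longrightarrow> (\<forall>x y i. (\<Sum>i\<in>UNIV. x $ i) = 1 \<longrightarrow> (\<Sum>i\<in>UNIV. y $ i) = 1 \<longrightarrow>
        \<bar>f (P k x) i - f (P k y) i\<bar> \<le> C * ?S x y)"
  proof
    fix k show "\<exists>C\<ge>0. k \<le> N \<longrightarrow> (\<forall>x y i. (\<Sum>i\<in>UNIV. x $ i) = 1 \<longrightarrow> (\<Sum>i\<in>UNIV. y $ i) = 1 \<longrightarrow>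
        \<bar>f (P k x) i - f (P k y) i\<bar> \<le> C * ?S x y)"
      using P_lipschitz[of k] by (cases "k \<le> N") (meson order_refl)+
  qed
  from choice[OF this] obtain C where CC: "\<forall>k. 0 \<le> C k \<and> (k \<le> N \<longrightarrow> (\<forall>x y i. (\<Sum>i\<in>UNIV. x $ i) = 1 \<longrightarrow>
        (\<Sum>i\<in>UNIV. y $ i) = 1 \<longrightarrow> \<bar>f (P k x) i - f (P k y) i\<bar> \<le> C k * ?S x y))" ..
  have C: "\<And>k. 0 \<le> C k" "\<And>k x y i. k \<le> N \<Longrightarrow> (\<Sum>i\<in>UNIV. x $ i) = 1 \<Longrightarrow> (\<Sum>i\<in>UNIV. y $ i) = 1 \<Longrightarrow>
        \<bar>f (P k x) i - f (P k y) i\<bar> \<le> C k * ?S x y"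
    using CC by simp_all
  have mulip: "\<bar>mu z - mu z'\<bar> \<le> ?S z z'" for z z'
  proof -
    have "\<bar>(\<Sum>j\<in>UNIV. z $ j) - (\<Sum>j\<in>UNIV. z' $ j)\<bar> \<le> ?S z z'"
      by (simp add: sum_subtractf[symmetric] sum_abs)
    then show ?thesis by (auto simp: mu_def)
  qed
  have levlip: "\<bar>lev z - lev z'\<bar> \<le> \<delta> * ?S z z'" for z z'
  proof -
    have ln_lip: "ln a - ln b \<le> \<bar>a - b\<bar>" if "1 \<le> a" "1 \<le> b" for a b :: real
    proof -
      have "ln a - ln b = ln (a / b)" using that by (simp add: ln_div)
      also have "\<dots> \<le> a / b - 1" using that by (intro ln_le_minus_one) auto
      also have "\<dots> = (a - b) / b" using that by (simp add: field_simps)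
      also have "\<dots> \<le> \<bar>a - b\<bar> / b" using that by (intro divide_right_mono) auto
      also have "\<dots> \<le> \<bar>a - b\<bar>" using that by (simp add: divide_le_eq mult_left_mono[of 1 b "\<bar>a - b\<bar>", simplified])
      finally show ?thesis .
    qed
    have "\<bar>ln (mu z) - ln (mu z')\<bar> \<le> ?S z z'"
      using ln_lip[OF mu_ge_1[of z] mu_ge_1[of z']] ln_lip[OF mu_ge_1[of z'] mu_ge_1[of z]] mulip[of z z'] by auto
    then show ?thesis using delta by (simp add: lev_def right_diff_distrib[symmetric] abs_mult mult_left_mono)
  qed
  have mlip: "\<bar>?m z $ j - ?m z' $ j\<bar> \<le> \<bar>z $ j - z' $ j\<bar> + ?S z z'" if z: "z' \<in> Z" for z z' j
  proof -
    have m1: "1 \<le> mu z" "1 \<le> mu z'" by (rule mu_ge_1)+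
    have "z' $ j \<le> (\<Sum>j\<in>UNIV. z' $ j)" using z by (intro member_le_sum) (auto simp: Z_def)
    then have zm: "0 \<le> z' $ j / mu z'" "z' $ j / mu z' \<le> 1"
      using z m1 by (auto simp: Z_def mu_def divide_le_eq)
    \<comment> \<open>Besides \<open>z' $ j / mu z'\<close>, which lies between 0 and 1, only the
      denominator \<open>mu z\<close>, at least 1, remains.\<close>
    have "?m z $ j - ?m z' $ j = ((z $ j - z' $ j) + (z' $ j / mu z') * (mu z' - mu z)) / mu z"
      using m1 by (simp add: field_simps)
    also have "\<bar>\<dots>\<bar> \<le> \<bar>(z $ j - z' $ j) + (z' $ j / mu z') * (mu z' - mu z)\<bar>"
      using m1 mult_left_mono[OF m1(1), of "\<bar>(z $ j - z' $ j) + (z' $ j / mu z') * (mu z' - mu z)\<bar>"]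
      by (simp add: divide_le_eq)
    also have "\<dots> \<le> \<bar>z $ j - z' $ j\<bar> + (z' $ j / mu z') * \<bar>mu z' - mu z\<bar>"
      using abs_triangle_ineq[of "z $ j - z' $ j" "(z' $ j / mu z') * (mu z' - mu z)"]
      unfolding abs_mult[of "z' $ j / mu z'"] abs_of_nonneg[OF zm(1)] .
    also have "\<dots> \<le> \<bar>z $ j - z' $ j\<bar> + 1 * ?S z z'"
      using zm mulip[of z z'] by (intro add_left_mono mult_mono) auto
    finally show ?thesis by simp
  qed
  have mS: "?S (?m z) (?m z') \<le> (1 + real CARD('n)) * ?S z z'" if z: "z' \<in> Z" for z z'
  proof -
    have "?S (?m z) (?m z') \<le> (\<Sum>j\<in>UNIV. \<bar>z $ j - z' $ j\<bar> + ?S z z')" by (intro sum_mono mlip z)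
    then show ?thesis by (simp add: sum.distrib algebra_simps)
  qed
  define K where "K = sqrt 2 * \<rho> * 2 + (\<Sum>k<N. sqrt 2 * \<delta> + C k * (1 + real CARD('n)) * (sqrt 2 * \<Lambda>))"
  have K0: "0 \<le> K" unfolding K_def using rho delta C(1) Lambda_nonneg by (intro add_nonneg_nonneg sum_nonneg mult_nonneg_nonneg) auto
  show ?thesis
  proof (rule that[OF K0])
    fix z z' i assume z: "z \<in> Z" "z' \<in> Z"
    let ?A = "?S z z'"
    let ?f = "\<lambda>k. f (P k (?m z)) i" and ?f' = "\<lambda>k. f (P k (?m z')) i"
    let ?c = "\<lambda>k. gt (trunc k (lev z)) - gt (real k * h)" and ?c' = "\<lambda>k. gt (trunc k (lev z')) - gt (real k * h)"
    have summand: "norm (?f k *\<^sub>R ?c k - ?f' k *\<^sub>R ?c' k) \<le> (sqrt 2 * \<delta> + C k * (1 + real CARD('n)) * (sqrt 2 * \<Lambda>)) * ?A"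
      if k: "k < N" for k
    proof -
      have ngt: "norm (gt s - gt t) \<le> sqrt 2 * \<bar>s - t\<bar>" if "0 \<le> s" "s \<le> \<Lambda>" "0 \<le> t" "t \<le> \<Lambda>" for s t
        using norm_gt_diff[of s t] norm_gt_diff[of t s] that by (cases "s \<le> t") (auto simp: norm_minus_commute)
      have "norm (?c k - ?c' k) = norm (gt (trunc k (lev z)) - gt (trunc k (lev z')))" by simp
      also have "\<dots> \<le> sqrt 2 * \<bar>trunc k (lev z) - trunc k (lev z')\<bar>" using trunc_in[OF k] by (intro ngt) auto
      also have "\<dots> \<le> sqrt 2 * (\<delta> * ?A)" by (intro mult_left_mono order_trans[OF trunc_lip levlip]) auto
      finally have cc: "norm (?c k - ?c' k) \<le> sqrt 2 * \<delta> * ?A" by simp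
      have rest0: "0 \<le> C k * (1 + real CARD('n)) * (sqrt 2 * \<Lambda>) * ?A"
        using C(1)[of k] Lambda_nonneg S0 by simp
      have c0: "gt (trunc k (lev w)) - gt (real k * h) = 0" if "\<not> 1 \<le> (\<Sum>i\<in>UNIV. w $ i)" for w
      proof -
        have "lev w = 0" using that by (simp add: lev_def mu_def)
        then have "trunc k (lev w) = real k * h"
          using node_bounds(1)[of k] node_le[of k "Suc k"] by (simp add: trunc_def)
        then show ?thesis by simp
      qed
      have fle: "norm (f v i *\<^sub>R w) \<le> norm w" for v w
        using f_nonneg[of v i] f_le_1[of v i] mult_right_mono[of "f v i" 1 "norm w"] by simp
      consider "\<not> 1 \<le> (\<Sum>i\<in>UNIV. z $ i)" | "\<not> 1 \<le> (\<Sum>i\<in>UNIV. z' $ i)"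
        | "1 \<le> (\<Sum>i\<in>UNIV. z $ i)" "1 \<le> (\<Sum>i\<in>UNIV. z' $ i)" by blast
      then have "norm (?f k *\<^sub>R ?c k - ?f' k *\<^sub>R ?c' k) \<le> sqrt 2 * \<delta> * ?A + C k * (1 + real CARD('n)) * (sqrt 2 * \<Lambda>) * ?A"
      proof cases
        case 1
        then have "?c k = 0" by (rule c0)
        then show ?thesis using cc rest0 fle[of "P k (?m z')" "?c' k"] by (simp only: norm_minus_cancel scaleR_zero_right diff_0)
      next
        case 2
        then have "?c' k = 0" by (rule c0)
        then show ?thesis using cc rest0 fle[of "P k (?m z)" "?c k"] by (simp only: scaleR_zero_right diff_0_right)
      next
        case 3
        have "\<bar>?f k - ?f' k\<bar> \<le> C k * ?S (?m z) (?m z')" using k 3 by (intro C(2) sum_normalised) auto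
        also have "\<dots> \<le> C k * ((1 + real CARD('n)) * ?A)" by (intro mult_left_mono mS z C(1))
        finally have ff: "\<bar>?f k - ?f' k\<bar> \<le> C k * ((1 + real CARD('n)) * ?A)" .
        have tk: "real k * h \<le> \<Lambda>" "0 \<le> real k * h" using node_bounds[of k] k by auto
        have "norm (?c' k) \<le> sqrt 2 * \<bar>trunc k (lev z') - real k * h\<bar>"
          using trunc_in[OF k] tk by (intro ngt) auto
        also have "\<dots> \<le> sqrt 2 * \<Lambda>" using trunc_in[OF k, of "lev z'"] tk by (intro mult_left_mono) auto
        finally have c': "norm (?c' k) \<le> sqrt 2 * \<Lambda>" .
        have "?f k *\<^sub>R ?c k - ?f' k *\<^sub>R ?c' k = ?f k *\<^sub>R (?c k - ?c' k) + (?f k - ?f' k) *\<^sub>R ?c' k"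
          by (simp add: algebra_simps)
        then have "norm (?f k *\<^sub>R ?c k - ?f' k *\<^sub>R ?c' k) \<le> norm (?f k *\<^sub>R (?c k - ?c' k)) + \<bar>?f k - ?f' k\<bar> * norm (?c' k)"
          using norm_triangle_ineq[of "?f k *\<^sub>R (?c k - ?c' k)" "(?f k - ?f' k) *\<^sub>R ?c' k"]
          by (simp only: norm_scaleR)
        also have "\<dots> \<le> sqrt 2 * \<delta> * ?A + (C k * ((1 + real CARD('n)) * ?A)) * (sqrt 2 * \<Lambda>)"
          using S0 C(1) by (intro add_mono order_trans[OF fle cc] mult_mono ff c') auto
        finally show ?thesis by (simp add: algebra_simps)
      qed
      then show ?thesis by (simp only: distrib_right)
    qed
    have "G z i - G z' i = (?m z $ i - ?m z' $ i) *\<^sub>R gt 0 + (\<Sum>k<N. ?f k *\<^sub>R ?c k - ?f' k *\<^sub>R ?c' k)"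
      by (simp add: G_def V_def sum_subtractf scaleR_diff_left)
    then have "norm (G z i - G z' i) \<le> \<bar>?m z $ i - ?m z' $ i\<bar> * norm (gt 0) + norm (\<Sum>k<N. ?f k *\<^sub>R ?c k - ?f' k *\<^sub>R ?c' k)"
      using norm_triangle_ineq[of "(?m z $ i - ?m z' $ i) *\<^sub>R gt 0" "\<Sum>k<N. ?f k *\<^sub>R ?c k - ?f' k *\<^sub>R ?c' k"]
      by (simp only: norm_scaleR)
    also have "\<dots> \<le> (2 * ?A) * norm (gt 0) + (\<Sum>k<N. (sqrt 2 * \<delta> + C k * (1 + real CARD('n)) * (sqrt 2 * \<Lambda>)) * ?A)"
    proof (intro add_mono mult_right_mono order_trans[OF norm_sum] sum_mono summand)
      have "\<bar>z $ i - z' $ i\<bar> \<le> ?A" by (rule member_le_sum) auto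
      then show "\<bar>?m z $ i - ?m z' $ i\<bar> \<le> 2 * ?A" using mlip[OF z(2), of z i] by linarith
    qed auto
    also have "\<dots> = K * ?A" unfolding K_def norm_gt0 sum_distrib_right[symmetric] by (simp only: distrib_left distrib_right mult_ac)
    finally show "norm (G z i - G z' i) \<le> K * ?A" .
  qed
qed

end

section \<open>The Jacobian determinant of \<open>G\<close> and the paths along rays\<close>

lemma norm_det_add_column_constant_le:
  fixes A :: "complex^'n^'n"
  assumes col: "\<And>j. (\<Sum>i\<in>UNIV. A $ i $ j) = c" and c: "c \<noteq> 0" and u: "cmod (c + (\<Sum>i\<in>UNIV. u i)) \<le> cmod c"
    and B: "\<And>j. (\<Sum>i\<in>UNIV. cmod (A $ i $ j)) \<le> B"
  shows "cmod (det (\<chi> i j. A $ i $ j + u i)) \<le> B ^ CARD('n)"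
proof -
  have "cmod c * cmod (det (\<chi> i j. A $ i $ j + u i)) = cmod (c + (\<Sum>i\<in>UNIV. u i)) * cmod (det A)"
    using arg_cong[OF det_add_column_constant[of A c u, OF col], of cmod] by (simp add: norm_mult)
  also have "\<dots> \<le> cmod c * cmod (det A)" by (intro mult_right_mono u) simp
  finally have "cmod (det (\<chi> i j. A $ i $ j + u i)) \<le> cmod (det A)" using c by simp
  also have "\<dots> \<le> (\<Prod>j\<in>UNIV. \<Sum>i\<in>UNIV. cmod (A $ i $ j))" by (rule norm_det_le_prod_column_sums)
  also have "\<dots> \<le> (\<Prod>j\<in>(UNIV::'n set). B)" by (intro prod_mono) (auto intro: sum_nonneg B)
  finally show ?thesis by simp
qed

lemma det_scale_rows:
  fixes A :: "'a::comm_ring_1^'n^'n"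
  shows "det (\<chi> i j. c * A $ i $ j) = c ^ CARD('n) * det A"
proof -
  have "(\<chi> i j. c * A $ i $ j) = (\<chi> i. c *s A $ i)" by (simp add: vec_eq_iff)
  then show ?thesis using det_rows_mul[of "\<lambda>_. c" "\<lambda>i. A $ i"] by simp
qed

context euler_scheme
begin

lemma G_jacobian_small:
  assumes y: "(\<Sum>i\<in>UNIV. z $ i) < 1"
  shows "\<exists>J :: complex^'n^'n. (\<forall>i j. ((\<lambda>r. snd (G (z + r *\<^sub>R axis j 1) i)) has_vector_derivative J $ i $ j) (at 0)) \<and>
     cmod (det J) \<le> \<rho> ^ CARD('n)"
proof (intro exI[of _ "\<chi> i j. if i = j then g 0 else 0"] conjI allI)
  let ?J = "(\<chi> i j. if i = j then g 0 else 0) :: complex^'n^'n"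
  have "?J = (\<chi> i j. g 0 * (mat 1 :: complex^'n^'n) $ i $ j)" by (auto simp: mat_def vec_eq_iff)
  then have "det ?J = g 0 ^ CARD('n)" using det_scale_rows[of "g 0" "mat 1 :: complex^'n^'n"] by simp
  then show "cmod (det ?J) \<le> \<rho> ^ CARD('n)" by (simp add: norm_power norm_g0)
  fix i j
  have d: "((\<lambda>r. (z $ i + r * (axis j 1 :: real^'n) $ i) *\<^sub>R g 0) has_vector_derivative ?J $ i $ j) (at 0)"
    by (auto intro!: derivative_eq_intros simp: axis_def)
  have sum: "(\<Sum>i\<in>UNIV. (z + r *\<^sub>R axis j 1) $ i) = (\<Sum>i\<in>UNIV. z $ i) + r" for r
    by (simp add: sum.distrib sum_distrib_left[symmetric] axis_def sum.delta)
  show "((\<lambda>r. snd (G (z + r *\<^sub>R axis j 1) i)) has_vector_derivative ?J $ i $ j) (at 0)"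
  proof (rule has_vector_derivative_transform_within_open[OF d])
    show "open {..<1 - (\<Sum>i\<in>UNIV. z $ i)}" "0 \<in> {..<1 - (\<Sum>i\<in>UNIV. z $ i)}" using y by auto
    fix r assume "r \<in> {..<1 - (\<Sum>i\<in>UNIV. z $ i)}"
    then show "(z $ i + r * (axis j 1 :: real^'n) $ i) *\<^sub>R g 0 = snd (G (z + r *\<^sub>R axis j 1) i)"
      using G_small[of "z + r *\<^sub>R axis j 1" i] unfolding sum by (simp add: gt_def)
  qed
qed

text \<open>Column \<open>j\<close> is \<open>1 / y\<close> times the sum of column \<open>j\<close>
  of the scheme at fixed level and a vector \<open>u\<close> common to all columns. As
  \<open>u\<close> adds up to \<open>\<delta> *\<^sub>R g' - g 0\<close>, the rank-one factor has
  modulus at most \<delta> / \<rho>. The strict inequalities keep the level inside one step, where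
  \<open>V\<close> has no kink.\<close>

lemma G_jacobian_large:
  assumes zp: "\<And>i. 0 < z $ i" and k: "k < N" "real k * h < lev z" "lev z < real (Suc k) * h"
    and g': "(g has_vector_derivative g') (at (lev z))" "cmod g' \<le> 1"
  shows "\<exists>J :: complex^'n^'n. (\<forall>i j. ((\<lambda>r. snd (G (z + r *\<^sub>R axis j 1) i)) has_vector_derivative J $ i $ j) (at 0)) \<and>
     cmod (det J) \<le> (\<rho> * exp (2 / \<delta> * lev z)) ^ CARD('n)"
proof -
  define y where "y = (\<Sum>i\<in>UNIV. z $ i)"
  have lp: "0 < lev z" using k node_bounds(1)[of k] by linarith
  have y1: "1 < y"
  proof (rule ccontr)
    assume "\<not> 1 < y"
    then have "lev z = 0" by (simp add: lev_def mu_def y_def)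
    then show False using lp by simp
  qed
  have muz: "mu z = y" using y1 by (simp add: mu_def y_def)
  have lz: "lev z = \<delta> * ln y" by (simp add: lev_def muz)
  have ey: "y = exp (lev z / \<delta>)" using y1 delta by (simp add: lz)
  define x where "x = (1 / y) *\<^sub>R z"
  have x1: "(\<Sum>i\<in>UNIV. x $ i) = 1" using y1 by (simp add: x_def y_def sum_divide_distrib[symmetric])
  have xp: "0 < x $ i" for i using zp y1 by (simp add: x_def)
  let ?w = "gt (lev z) - gt (real k * h)"
  obtain D F where D: "\<And>i. ((\<lambda>x. P k x i) has_derivative D i) (at x)"
    and F: "\<And>i. ((\<lambda>x. f (P k x) i) has_derivative F i) (at x)"
    and bound: "\<And>j. (\<Sum>i\<in>UNIV. maxnorm (D i (axis j 1) + F i (axis j 1) *\<^sub>R ?w)) \<le> \<rho> * exp (3 / \<delta> * lev z)"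
    and colsum: "\<And>e. (\<Sum>i\<in>UNIV. snd (D i e + F i e *\<^sub>R ?w)) = of_real (\<Sum>j\<in>UNIV. e $ j) * g 0"
    by (rule V_derivative[OF x1 xp k(1) less_imp_le[OF k(2)] less_imp_le[OF k(3)]], rule that)
  define E where "E i e = snd (D i e + F i e *\<^sub>R ?w)" for i e
  have linE: "linear (E i)" for i
  proof -
    have lD: "linear (D i)" "linear (F i)" using D F has_derivative_linear by blast+
    show ?thesis
      by (rule linearI) (simp_all add: E_def linear_add[OF lD(1)] linear_add[OF lD(2)]
          linear_cmul[OF lD(1)] linear_cmul[OF lD(2)] algebra_simps)
  qed
  let ?a = "\<lambda>j. axis j 1 :: real^'n"
  define A where "A = ((\<chi> i j. E i (?a j)) :: complex^'n^'n)"
  \<comment> \<open>The effect of the normalisation and of the change of level, which is the same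
    for every direction \<open>j\<close>.\<close>
  define u where "u i = f (P k x) i *\<^sub>R (\<delta> *\<^sub>R g') - E i x" for i
  define J where "J = ((\<chi> i j. of_real (1 / y) * (\<chi> i j. A $ i $ j + u i) $ i $ j) :: complex^'n^'n)"
  have der: "((\<lambda>r. snd (G (z + r *\<^sub>R ?a j) i)) has_vector_derivative J $ i $ j) (at 0)" for i j
  proof -
    define m where "m r = (1 / (y + r)) *\<^sub>R (z + r *\<^sub>R ?a j)" for r
    define m' where "m' = (1 / y) *\<^sub>R (?a j - x)"
    define lr where "lr r = \<delta> * ln (y + r)" for r
    have m0: "m 0 = x" by (simp add: m_def x_def)
    have l0: "lr 0 = lev z" by (simp add: lr_def lz)
    have md: "(m has_vector_derivative m') (at 0)"
      unfolding m_def m'_def x_def using y1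
      by (auto intro!: derivative_eq_intros simp: has_real_derivative_iff_has_vector_derivative[symmetric]
          power2_eq_square algebra_simps)
    have ld: "(lr has_vector_derivative \<delta> / y) (at 0)"
      unfolding lr_def has_real_derivative_iff_has_vector_derivative[symmetric] using y1
      by (auto intro!: derivative_eq_intros)
    have Pd: "((\<lambda>r. P k (m r) i) has_vector_derivative D i m') (at 0)"
      using vector_derivative_diff_chain_within[OF md, of "\<lambda>x. P k x i" "D i"] D[of i]
      by (simp add: m0 o_def has_derivative_at_withinI)
    have fd: "((\<lambda>r. f (P k (m r)) i) has_vector_derivative F i m') (at 0)"
      using vector_derivative_diff_chain_within[OF md, of "\<lambda>x. f (P k x) i" "F i"] F[of i]
      by (simp add: m0 o_def has_derivative_at_withinI)
    have gd: "((\<lambda>r. g (lr r)) has_vector_derivative (\<delta> / y) *\<^sub>R g') (at 0)"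
      using vector_diff_chain_at[OF ld, of g g'] g'(1) by (simp add: l0 o_def)
    have sPd: "((\<lambda>r. snd (P k (m r) i)) has_vector_derivative snd (D i m')) (at 0)"
      using bounded_linear.has_vector_derivative[OF bounded_linear_snd Pd] .
    have "((\<lambda>r. f (P k (m r)) i *\<^sub>R (g (lr r) - g (real k * h))) has_vector_derivative
        f (P k (m 0)) i *\<^sub>R ((\<delta> / y) *\<^sub>R g') + F i m' *\<^sub>R (g (lr 0) - g (real k * h))) (at 0)"
      using has_vector_derivative_scaleR[OF fd[folded has_real_derivative_iff_has_vector_derivative]
          has_vector_derivative_diff[OF gd has_vector_derivative_const[of "g (real k * h)"]]] by simp
    from has_vector_derivative_add[OF sPd this]
    have d: "((\<lambda>r. snd (P k (m r) i) + f (P k (m r)) i *\<^sub>R (g (lr r) - g (real k * h))) has_vector_derivative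
        E i m' + f (P k x) i *\<^sub>R ((\<delta> / y) *\<^sub>R g')) (at 0)"
      by (simp add: E_def gt_def m0 l0 algebra_simps)
    have "E i m' = (1 / y) *\<^sub>R (E i (?a j) - E i x)"
      by (simp add: m'_def linear_cmul[OF linE] linear_diff[OF linE])
    then have Jeq: "E i m' + f (P k x) i *\<^sub>R ((\<delta> / y) *\<^sub>R g') = J $ i $ j"
      by (simp add: J_def A_def u_def scaleR_conv_of_real algebra_simps)
    \<comment> \<open>The parameters for which the point remains beyond the face and its level in
      step \<open>k\<close>, so that a single formula for \<open>V\<close> applies.\<close>
    define T where "T = {r. 1 < y + r} \<inter> {r. real k * h < lr r} \<inter> {r. lr r < real (Suc k) * h}"
    have cl: "continuous_on {r. 1 < y + r} lr"
      unfolding lr_def by (intro continuous_intros) auto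
    have o1: "open {r. 1 < y + r}" by (intro open_Collect_less continuous_intros)
    have "open ({r. 1 < y + r} \<inter> lr -` {real k * h<..<real (Suc k) * h})"
      by (intro continuous_open_preimage cl o1) auto
    moreover have "T = {r. 1 < y + r} \<inter> lr -` {real k * h<..<real (Suc k) * h}" by (auto simp: T_def)
    ultimately have oT: "open T" by simp
    have 0: "0 \<in> T" using y1 k by (simp add: T_def l0)
    have sum: "(\<Sum>i\<in>UNIV. (z + r *\<^sub>R ?a j) $ i) = y + r" for r
      by (simp add: sum.distrib sum_distrib_left[symmetric] axis_def sum.delta y_def)
    show ?thesis
    proof (rule has_vector_derivative_transform_within_open[OF d[unfolded Jeq] oT 0])
      fix r assume r: "r \<in> T"
      have mur: "mu (z + r *\<^sub>R ?a j) = y + r" using r unfolding mu_def sum by (simp add: T_def)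
      have "lev (z + r *\<^sub>R ?a j) = lr r" by (simp add: lev_def mur lr_def)
      then have "G (z + r *\<^sub>R ?a j) i = V (lr r) (m r) i" by (simp add: G_def mur m_def)
      also have "\<dots> = P k (m r) i + f (P k (m r)) i *\<^sub>R (gt (lr r) - gt (real k * h))"
        using r k by (intro V_step) (auto simp: T_def)
      finally show "snd (P k (m r) i) + f (P k (m r)) i *\<^sub>R (g (lr r) - g (real k * h)) = snd (G (z + r *\<^sub>R ?a j) i)"
        by (simp add: gt_def)
    qed
  qed
  have col: "(\<Sum>i\<in>UNIV. A $ i $ j) = g 0" for j
    using colsum[of "?a j"] by (simp add: A_def E_def axis_def sum.delta)
  have su: "(\<Sum>i\<in>UNIV. u i) = \<delta> *\<^sub>R g' - g 0"
    using colsum[of x] sum_f_P[OF x1, of k] k(1)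
    by (simp add: u_def E_def sum_subtractf scaleR_sum_left[symmetric] x1 del: scaleR_scaleR)
  have "cmod (det (\<chi> i j. A $ i $ j + u i)) \<le> (\<rho> * exp (3 / \<delta> * lev z)) ^ CARD('n)"
  proof (rule norm_det_add_column_constant_le[OF col])
    show "g 0 \<noteq> 0" using norm_g0 rho by auto
    show "cmod (g 0 + (\<Sum>i\<in>UNIV. u i)) \<le> cmod (g 0)"
      using g'(2) delta mult_mono[of \<delta> \<rho> "cmod g'" 1] by (simp add: su norm_g0)
    show "(\<Sum>i\<in>UNIV. cmod (A $ i $ j)) \<le> \<rho> * exp (3 / \<delta> * lev z)" for j
      by (rule order_trans[OF sum_mono bound[of j]]) (simp only: A_def E_def vec_lambda_beta maxnorm_bounds(3))
  qed
  then have "cmod (det J) \<le> (1 / y) ^ CARD('n) * (\<rho> * exp (3 / \<delta> * lev z)) ^ CARD('n)"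
    unfolding J_def det_scale_rows norm_mult norm_power using y1
    by (intro mult_mono) (auto simp: norm_divide)
  \<comment> \<open>The factor \<open>1 / y\<close> is \<open>exp (- (lev z / \<delta>))\<close> and
    lowers the exponent from 3 to 2.\<close>
  also have "\<dots> = (\<rho> * exp (2 / \<delta> * lev z)) ^ CARD('n)"
    unfolding power_mult_distrib[symmetric]
  proof -
    have "1 / y * (\<rho> * exp (3 / \<delta> * lev z)) = \<rho> * (exp (- (lev z / \<delta>)) * exp (3 / \<delta> * lev z))"
      unfolding exp_minus ey[symmetric] by (simp add: divide_inverse)
    also have "\<dots> = \<rho> * exp (2 / \<delta> * lev z)"
      by (simp add: exp_add[symmetric] algebra_simps diff_divide_distrib[symmetric])
    finally show "(1 / y * (\<rho> * exp (3 / \<delta> * lev z))) ^ CARD('n) = (\<rho> * exp (2 / \<delta> * lev z)) ^ CARD('n)" by simp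
  qed
  finally show ?thesis using der by blast
qed

lemma fst_G_nonneg: "z \<in> Z \<Longrightarrow> 0 \<le> fst (G z i)"
  using G_increment[of z 0 1 i] G_zero[of 0 i] norm_ge_zero by (simp add: order_trans[OF norm_ge_zero])

text \<open>On and beyond the face the first components add up to that of the curve; below it the
  sum is linear. They become, up to slack, the lengths allotted to the factors
  \<open>K_set\<close>.\<close>

lemma sum_fst_G_le:
  assumes "z \<in> Z" shows "(\<Sum>i\<in>UNIV. fst (G z i)) \<le> \<rho> + lev z"
proof (cases "1 \<le> (\<Sum>i\<in>UNIV. z $ i)")
  case True
  then show ?thesis using arg_cong[OF sum_G[OF assms], of fst] by (simp add: fst_sum gt_def)
next
  case False
  then have "(\<Sum>i\<in>UNIV. fst (G z i)) = (\<Sum>i\<in>UNIV. z $ i) * \<rho>"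
    by (simp add: G_small gt_def sum_distrib_right)
  also have "\<dots> \<le> 1 * \<rho>" using False rho by (intro mult_right_mono) auto
  finally show ?thesis using lev_nonneg[of z] by simp
qed

lemma fst_G_le: "z \<in> Z \<Longrightarrow> fst (G z i) \<le> \<rho> + \<Lambda>"
  using member_le_sum[of i UNIV "\<lambda>i. fst (G z i)"] fst_G_nonneg[of z] sum_fst_G_le[of z] lev_le[of z]
  by fastforce

lemma continuous_on_G: "continuous_on Z (\<lambda>z. snd (G z i))"
proof -
  obtain C where C: "0 \<le> C"
    "\<And>z z' i. z \<in> Z \<Longrightarrow> z' \<in> Z \<Longrightarrow> norm (G z i - G z' i) \<le> C * (\<Sum>j\<in>UNIV. \<bar>z $ j - z' $ j\<bar>)"
    by (rule G_lipschitz, rule that)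
  have "(C * real CARD('n))-lipschitz_on Z (\<lambda>z. snd (G z i))"
  proof (rule lipschitz_onI)
    fix z z' assume z: "z \<in> Z" "z' \<in> Z"
    have "dist (snd (G z i)) (snd (G z' i)) \<le> norm (G z i - G z' i)"
      using cmod_snd_le_norm[of "G z i - G z' i"] by (simp add: dist_norm)
    also have "\<dots> \<le> C * (\<Sum>j\<in>UNIV. \<bar>z $ j - z' $ j\<bar>)" by (rule C(2)[OF z])
    also have "\<dots> \<le> C * (\<Sum>j\<in>(UNIV::'n set). dist z z')"
      using C(1) component_le_norm_cart[of "z - z'"] by (intro mult_left_mono sum_mono) (auto simp: dist_norm)
    finally show "dist (snd (G z i)) (snd (G z' i)) \<le> C * real CARD('n) * dist z z'" by simp
  qed (use C in simp)
  then show ?thesis by (rule lipschitz_on_continuous_on)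
qed

lemma lev_scale_le:
  assumes "z \<in> Z" "0 \<le> r" "r \<le> 1" shows "lev (r *\<^sub>R z) \<le> lev z"
proof -
  have "r * (\<Sum>i\<in>UNIV. z $ i) \<le> 1 * (\<Sum>i\<in>UNIV. z $ i)"
    using assms by (intro mult_right_mono sum_nonneg) (auto simp: Z_def)
  then have "mu (r *\<^sub>R z) \<le> mu z" by (auto simp: mu_def sum_distrib_left[symmetric])
  then have "ln (mu (r *\<^sub>R z)) \<le> ln (mu z)" using mu_ge_1[of "r *\<^sub>R z"] by (intro ln_mono) auto
  then show ?thesis using delta by (simp add: lev_def)
qed

text \<open>Since the singular set is closed under increasing the length, an upper bound on the length
  of a path suffices to keep it away from the singularities.\<close>

lemma G_path_in_Pi_set:
  assumes dfs: "is_dfs \<Omega>"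
    and avoid: "\<And>w q. q \<in> S_set \<Omega> \<Longrightarrow> fst w \<le> \<rho> + \<Lambda> \<Longrightarrow> norm w \<le> 2 * \<rho> \<or> d \<le> \<eta> w \<Longrightarrow> d \<le> norm (w - q)"
    and z: "z \<in> Z" and l: "lev z \<le> l" "l \<le> \<Lambda>"
    and d: "0 < d" "d \<le> \<rho> * exp (- 2 * sqrt 2 / \<delta> * l)" and L: "fst (G z i) \<le> L"
  shows "(\<lambda>r. snd (G (r *\<^sub>R z) i)) \<in> Pi_set \<Omega> d L"
proof -
  let ?p = "\<lambda>r. snd (G (r *\<^sub>R z) i)"
  have G0: "G (0 *\<^sub>R z) i = 0" using G_zero[of 0 i] by simp
  have pl: "path_length ?p 0 r \<le> fst (G (r *\<^sub>R z) i)" if r: "0 \<le> r" "r \<le> 1" for r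
  proof -
    have "path_length ?p 0 r \<le> fst (G (r *\<^sub>R z) i) - fst (G (0 *\<^sub>R z) i)"
      by (rule path_length_le[where l = "\<lambda>r. fst (G (r *\<^sub>R z) i)"]) (use r in \<open>auto intro!: G_increment z\<close>)
    then show ?thesis unfolding G0 by simp
  qed
  have far: "d \<le> dist (path_length ?p 0 r, ?p r) q" if r: "0 \<le> r" "r \<le> 1" and q: "q \<in> S_set \<Omega>" for r q
  proof -
    let ?w = "G (r *\<^sub>R z) i"
    have rz: "r *\<^sub>R z \<in> Z" using r by (intro Z_scale z)
    have "norm ?w \<le> 2 * \<rho> \<or> \<rho> * exp (- 2 * sqrt 2 / \<delta> * l) \<le> \<eta> ?w"
      using lev_scale_le[OF z r] l by (intro G_far_from_singularities rz) auto
    then have f: "norm ?w \<le> 2 * \<rho> \<or> d \<le> \<eta> ?w" using d by linarith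
    \<comment> \<open>Raising the singular point by the excess of the length bound over the true
      length leaves the difference vector unchanged.\<close>
    define q' where "q' = (fst q + (fst ?w - path_length ?p 0 r), snd q)"
    have "q' \<in> S_set \<Omega>" by (rule S_set_upward[OF dfs q]) (use pl[OF r] in \<open>auto simp: q'_def\<close>)
    then have "d \<le> norm (?w - q')" using f by (intro avoid fst_G_le rz)
    also have "norm (?w - q') = dist (path_length ?p 0 r, ?p r) q"
      by (simp add: q'_def dist_norm norm_prod_def)
    finally show ?thesis .
  qed
  have plL: "path_length ?p 0 r \<le> L" if r: "0 \<le> r" "r \<le> 1" for r
  proof -
    have "0 \<le> cmod (snd (G (1 *\<^sub>R z) i) - snd (G (r *\<^sub>R z) i))" by simp
    also have "\<dots> \<le> fst (G (1 *\<^sub>R z) i) - fst (G (r *\<^sub>R z) i)" using r by (intro G_increment z) auto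
    finally show ?thesis using pl[OF r] L by simp
  qed
  obtain C where C: "0 \<le> C"
    "\<And>z z' i. z \<in> Z \<Longrightarrow> z' \<in> Z \<Longrightarrow> norm (G z i - G z' i) \<le> C * (\<Sum>j\<in>UNIV. \<bar>z $ j - z' $ j\<bar>)"
    by (rule G_lipschitz, rule that)
  have "(C * (\<Sum>j\<in>UNIV. \<bar>z $ j\<bar>))-lipschitz_on {0..1} ?p"
  proof (rule lipschitz_onI)
    fix r r' :: real assume r: "r \<in> {0..1}" "r' \<in> {0..1}"
    have "dist (?p r) (?p r') \<le> norm (G (r *\<^sub>R z) i - G (r' *\<^sub>R z) i)"
      using cmod_snd_le_norm[of "G (r *\<^sub>R z) i - G (r' *\<^sub>R z) i"]
      by (simp add: dist_norm)
    also have "\<dots> \<le> C * (\<Sum>j\<in>UNIV. \<bar>(r *\<^sub>R z) $ j - (r' *\<^sub>R z) $ j\<bar>)"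
      using r by (intro C(2) Z_scale z) auto
    also have "\<dots> = C * (\<Sum>j\<in>UNIV. \<bar>z $ j\<bar>) * dist r r'"
      by (simp add: left_diff_distrib[symmetric] abs_mult sum_distrib_left[symmetric] dist_real_def)
    finally show "dist (?p r) (?p r') \<le> C * (\<Sum>j\<in>UNIV. \<bar>z $ j\<bar>) * dist r r'" .
  qed (use C in \<open>auto intro!: mult_nonneg_nonneg sum_nonneg\<close>)
  moreover have "?p 0 = 0" using G0 by simp
  moreover have "(path_length ?p 0 r, ?p r) \<in> M_set \<Omega>" if "r \<in> {0..1}" for r
  proof -
    have "(path_length ?p 0 r, ?p r) \<notin> closure (S_set \<Omega>)"
    proof
      assume "(path_length ?p 0 r, ?p r) \<in> closure (S_set \<Omega>)"
      then obtain q where "q \<in> S_set \<Omega>" "dist q (path_length ?p 0 r, ?p r) < d"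
        using d(1) unfolding closure_approachable by blast
      then show False using far[of r q] that by (simp add: dist_commute)
    qed
    then show ?thesis by (simp add: M_set_def)
  qed
  ultimately have "allowed \<Omega> 1 ?p" unfolding allowed_def by auto
  then show ?thesis unfolding Pi_set_def using far plL by auto
qed

text \<open>The dilations \<open>r *\<^sub>R z\<close> form a jointly continuous family of paths
  that all start at 0.\<close>

lemma continuous_map_lift_G:
  assumes es: "endless_surface \<Omega> X p x0"
    and al: "\<And>z. z \<in> Z \<Longrightarrow> allowed \<Omega> 1 (\<lambda>r. snd (G (r *\<^sub>R z) i))"
  shows "continuous_map (top_of_set Z) X (\<lambda>z. lift X p x0 (\<lambda>r. snd (G (r *\<^sub>R z) i)) 1)"
proof (rule continuous_lift_endpoint[where H = "\<lambda>(z, r). snd (G (r *\<^sub>R z) i)" and p = p and ?x0.0 = x0])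
  show "Hausdorff_space X" "local_homeo_to_C X p" "x0 \<in> topspace X"
    using es by (auto simp: endless_surface_def)
  have "continuous_on (Z \<times> {0..1}) (\<lambda>zr. snd (G (snd zr *\<^sub>R fst zr) i))"
    by (rule continuous_on_compose2[OF continuous_on_G]) (auto intro!: continuous_intros Z_scale)
  then show "continuous_on (Z \<times> {0..1}) (\<lambda>(z, r). snd (G (r *\<^sub>R z) i))"
    by (simp add: case_prod_unfold)
  fix z assume z: "z \<in> Z"
  have l: "lifts_path X p x0 (\<lambda>r. snd (G (r *\<^sub>R z) i)) (lift X p x0 (\<lambda>r. snd (G (r *\<^sub>R z) i)))"
    by (rule lifts_path_lift[OF es al[OF z]])
  then show "continuous_map (top_of_set {0..1}) X (lift X p x0 (\<lambda>r. snd (G (r *\<^sub>R z) i)))"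
    "lift X p x0 (\<lambda>r. snd (G (r *\<^sub>R z) i)) 0 = x0"
    by (auto simp: lifts_path_def)
  show "p (lift X p x0 (\<lambda>r. snd (G (r *\<^sub>R z) i)) r) = (case (z, r) of (z, r) \<Rightarrow> snd (G (r *\<^sub>R z) i))"
    if "r \<in> {0..1}" for r
    using l that by (auto simp: lifts_path_def)
qed

end

section \<open>Lifting the scheme\<close>

lemma continuous_map_vec_lambda:
  fixes f :: "'n::finite \<Rightarrow> 'b \<Rightarrow> 'c::real_normed_vector"
  assumes "\<And>i. continuous_map T euclidean (f i)"
  shows "continuous_map T euclidean (\<lambda>x. \<chi> i. f i x)"
  using assms unfolding continuous_map_atin limitin_canonical_iff by (auto intro!: tendsto_vec_lambda)

lemma norm_vec_le_sum: "norm (x :: 'a::real_normed_vector^'n) \<le> (\<Sum>i\<in>UNIV. norm (x $ i))"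
  unfolding norm_vec_def by (rule L2_set_le_sum) auto

lemma continuous_map_snd_component:
  "continuous_map (prod_topology S (subtopology (product_topology (\<lambda>_. X) UNIV) V)) X (\<lambda>x. snd x i)"
proof -
  have "continuous_map (prod_topology S (subtopology (product_topology (\<lambda>_. X) UNIV) V))
      (product_topology (\<lambda>_. X) UNIV) snd"
    using continuous_map_into_fulltopology[OF continuous_map_snd] .
  from continuous_map_compose[OF this continuous_map_product_projection[of i]]
  show ?thesis by (simp add: o_def)
qed

locale euler_lift = euler_scheme \<eta> \<theta> \<delta> \<rho> h \<Lambda> b c N g ty
  for \<eta> \<theta> \<delta> \<rho> h \<Lambda> b c N g and ty :: "'n::finite itself" +
  fixes \<Omega> :: dfs and X :: "'x topology" and p :: "'x \<Rightarrow> complex" and x0 :: 'x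
  assumes surface: "endless_surface \<Omega> X p x0"
    and path_allowed: "\<And>z i. z \<in> Z \<Longrightarrow> allowed \<Omega> 1 (\<lambda>r. snd (G (r *\<^sub>R z) i))"
begin

definition LG :: "real^'n \<Rightarrow> 'n \<Rightarrow> 'x" where
  "LG z i = lift X p x0 (\<lambda>r. snd (G (r *\<^sub>R z) i)) 1"

lemma LG_lifts: "z \<in> Z \<Longrightarrow> lifts_path X p x0 (\<lambda>r. snd (G (r *\<^sub>R z) i)) (lift X p x0 (\<lambda>r. snd (G (r *\<^sub>R z) i)))"
  by (rule lifts_path_lift[OF surface path_allowed])

lemma p_LG: "z \<in> Z \<Longrightarrow> p (LG z i) = snd (G z i)"
  using LG_lifts[of z i] by (auto simp: lifts_path_def LG_def)

lemma LG_topspace: "z \<in> Z \<Longrightarrow> LG z i \<in> topspace X"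
  using LG_lifts[of z i] continuous_map_image_subset_topspace by (fastforce simp: lifts_path_def LG_def)

lemma simplex_in_Z: "s \<in> Delta_simplex \<Longrightarrow> s \<in> Z"
  using Lambda_nonneg delta by (auto simp: Delta_simplex_def Z_def intro: order_trans[of _ 1])

lemma Lmap_eq_LG:
  assumes s: "s \<in> Delta_simplex"
  shows "Lmap X p x0 (of_real (s $ i) * g 0) = LG s i"
  unfolding Lmap_def LG_def
proof (rule fun_cong[OF lift_cong])
  fix r :: real assume r: "r \<in> {0..1}"
  have "r * (\<Sum>i\<in>UNIV. s $ i) \<le> 1 * 1" using s r by (intro mult_mono) (auto simp: Delta_simplex_def intro: sum_nonneg)
  then have "G (r *\<^sub>R s) i = ((r *\<^sub>R s) $ i) *\<^sub>R gt 0" by (intro G_small) (simp add: sum_distrib_left[symmetric])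
  then show "of_real r * (of_real (s $ i) * g 0) = snd (G (r *\<^sub>R s) i)"
    by (simp add: gt_def scaleR_conv_of_real[of _ "g 0"])
qed

lemma p_Lmap: "s \<in> Delta_simplex \<Longrightarrow> p (LG s i) = of_real (s $ i) * g 0"
  using G_small[of s i] by (simp add: p_LG simplex_in_Z gt_def scaleR_conv_of_real[of _ "g 0"] Delta_simplex_def)

text \<open>A deformation has to be a map of the points of the initial simplex, so their parameters
  must be recovered from them. On that simplex the quotients are real and \<open>Re\<close> loses
  nothing.\<close>

definition coords :: "('n \<Rightarrow> 'x) \<Rightarrow> real^'n" where
  "coords v = (\<chi> i. Re (p (v i) / g 0))"

lemma g0_nonzero: "g 0 \<noteq> 0" using norm_g0 rho by auto

lemma coords_LG: "s \<in> Delta_simplex \<Longrightarrow> coords (LG s) = s"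
  using g0_nonzero by (simp add: coords_def p_Lmap vec_eq_iff)

lemma Vset_eq: "Vset X p x0 (g 0) = LG ` Delta_simplex"
proof -
  have "Vset X p x0 (g 0) = (\<lambda>s i. Lmap X p x0 (of_real (s $ i) * g 0)) ` Delta_simplex"
    by (auto simp: Vset_def)
  also have "\<dots> = LG ` Delta_simplex"
    by (intro image_cong refl) (simp add: fun_eq_iff Lmap_eq_LG)
  finally show ?thesis .
qed

lemma scaled_simplex_in_Z:
  assumes "s \<in> Delta_simplex" "0 \<le> l" "l \<le> \<Lambda>"
  shows "exp (l / \<delta>) *\<^sub>R s \<in> Z" and lev_scaled_simplex: "lev (exp (l / \<delta>) *\<^sub>R s) \<le> l"
proof -
  have s: "(\<Sum>i\<in>UNIV. (exp (l / \<delta>) *\<^sub>R s) $ i) \<le> exp (l / \<delta>)"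
    using assms(1) mult_left_mono[of "\<Sum>i\<in>UNIV. s $ i" 1 "exp (l / \<delta>)"]
    by (simp add: Delta_simplex_def sum_distrib_left[symmetric])
  also have "\<dots> \<le> exp (\<Lambda> / \<delta>)" using assms delta by (simp add: divide_right_mono)
  finally show "exp (l / \<delta>) *\<^sub>R s \<in> Z" using assms(1) by (auto simp: Z_def Delta_simplex_def)
  show "lev (exp (l / \<delta>) *\<^sub>R s) \<le> l" by (rule lev_le_of_sum_le[OF s assms(2)])
qed

definition Psi :: "(real \<Rightarrow> real) \<Rightarrow> real \<Rightarrow> ('n \<Rightarrow> 'x) \<Rightarrow> 'n \<Rightarrow> 'x" where
  "Psi l t v = LG (exp (l t / \<delta>) *\<^sub>R coords v)"

lemma Psi_LG: "s \<in> Delta_simplex \<Longrightarrow> Psi l t (LG s) = LG (exp (l t / \<delta>) *\<^sub>R s)"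
  by (simp add: Psi_def coords_LG)

text \<open>In coordinates the map is \<open>G\<close> after a dilation, so one constant works on
  the whole space and every neighbourhood can be all of it. Continuity into \<open>X\<close> is a
  separate matter and comes from the lifts.\<close>

lemma Psi_loc_lipschitz:
  assumes l0: "\<And>t. t \<in> {a..1} \<Longrightarrow> 0 \<le> l t \<and> l t \<le> \<Lambda>"
    and el: "M-lipschitz_on {a..1} (\<lambda>t. exp (l t / \<delta>))"
  shows "loc_lipschitz_coords X p a (LG ` Delta_simplex) (Psi l)"
  unfolding loc_lipschitz_coords_def Let_def
proof (intro conjI ballI)
  let ?D = "prod_topology (top_of_set {a..1}) (subtopology (product_topology (\<lambda>_. X) UNIV) (LG ` Delta_simplex))"
  have top: "topspace ?D = {a..1} \<times> LG ` Delta_simplex"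
    using LG_topspace[OF simplex_in_Z] by (auto simp: topspace_product_topology PiE_UNIV_domain)
  have lh: "local_homeo_to_C X p" using surface by (simp add: endless_surface_def)
  have cl: "continuous_map ?D euclidean (\<lambda>x. exp (l (fst x) / \<delta>))"
  proof -
    have "continuous_map (top_of_set {a..1}) euclidean (\<lambda>t. exp (l t / \<delta>))"
      using lipschitz_on_continuous_on[OF el] by simp
    from continuous_map_compose[OF continuous_map_fst this] show ?thesis by (simp add: o_def)
  qed
  have cp: "continuous_map ?D euclidean (\<lambda>x. p (snd x i))" for i
    using continuous_map_compose[OF continuous_map_snd_component local_homeo_continuous[OF lh]]
    by (simp add: o_def)
  have cz: "continuous_map ?D euclidean (\<lambda>x. \<chi> i. exp (l (fst x) / \<delta>) * Re (p (snd x i) / g 0))"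
  proof (rule continuous_map_vec_lambda)
    fix i
    show "continuous_map ?D euclidean (\<lambda>x. exp (l (fst x) / \<delta>) * Re (p (snd x i) / g 0))"
    proof (rule continuous_map_real_mult[OF cl])
      have "continuous_map euclidean euclidean (\<lambda>w. Re (w / g 0))"
        using g0_nonzero by (auto intro!: continuous_intros)
      from continuous_map_compose[OF cp[of i] this]
      show "continuous_map ?D euclidean (\<lambda>x. Re (p (snd x i) / g 0))" by (simp add: o_def)
    qed
  qed
  have eq: "(\<chi> i. exp (l t / \<delta>) * Re (p (v i) / g 0)) = exp (l t / \<delta>) *\<^sub>R coords v" for t v
    by (simp add: coords_def vec_eq_iff)
  have cz': "continuous_map ?D (top_of_set Z) (\<lambda>x. exp (l (fst x) / \<delta>) *\<^sub>R coords (snd x))"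
    unfolding continuous_map_in_subtopology
  proof
    show "continuous_map ?D euclidean (\<lambda>x. exp (l (fst x) / \<delta>) *\<^sub>R coords (snd x))" using cz by (simp only: eq)
    show "(\<lambda>x. exp (l (fst x) / \<delta>) *\<^sub>R coords (snd x)) \<in> topspace ?D \<rightarrow> Z"
      unfolding top using l0 by (auto simp: coords_LG intro!: scaled_simplex_in_Z)
  qed
  show "continuous_map ?D (product_topology (\<lambda>_. X) UNIV) (\<lambda>(t, v). Psi l t v)"
    unfolding continuous_map_componentwise_UNIV
  proof
    fix i
    from continuous_map_compose[OF cz' continuous_map_lift_G[OF surface path_allowed, of i]]
    show "continuous_map ?D X (\<lambda>x. (case x of (t, v) \<Rightarrow> Psi l t v) i)"
      by (simp add: o_def Psi_def LG_def case_prod_unfold)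
  qed
  obtain C where C: "0 \<le> C"
    "\<And>z z' i. z \<in> Z \<Longrightarrow> z' \<in> Z \<Longrightarrow> norm (G z i - G z' i) \<le> C * (\<Sum>j\<in>UNIV. \<bar>z $ j - z' $ j\<bar>)"
    by (rule G_lipschitz, rule that)
  define n where "n = real CARD('n)"
  define E where "E = exp (\<Lambda> / \<delta>)"
  have M0: "0 \<le> M" using el by (rule lipschitz_on_nonneg)
  \<comment> \<open>One factor \<open>n\<close> counts the components of the image, the other the
    coordinates in the bound for \<open>G\<close>. \<open>M\<close> accounts for the change of
    \<open>t\<close>, and \<open>E / \<rho>\<close> for that of the point, because
    \<open>g 0\<close> has modulus \<rho>.\<close>
  define K where "K = n * (C * (n * (M + E / \<rho>)))"
  have main: "norm ((\<chi> i. p (Psi l t v i) - p (Psi l t' v' i)) :: complex^'n)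
      \<le> K * (\<bar>t - t'\<bar> + norm ((\<chi> i. p (v i) - p (v' i)) :: complex^'n))"
    if t: "t \<in> {a..1}" "t' \<in> {a..1}" and v: "v \<in> LG ` Delta_simplex" "v' \<in> LG ` Delta_simplex" for t t' v v'
  proof -
    obtain s s' where s: "s \<in> Delta_simplex" "s' \<in> Delta_simplex" and vs: "v = LG s" "v' = LG s'" using v by blast
    let ?z = "exp (l t / \<delta>) *\<^sub>R s" and ?z' = "exp (l t' / \<delta>) *\<^sub>R s'"
    let ?B = "\<bar>t - t'\<bar> + norm ((\<chi> i. p (v i) - p (v' i)) :: complex^'n)"
    have z: "?z \<in> Z" "?z' \<in> Z" using s t l0 by (auto intro!: scaled_simplex_in_Z)
    have zj: "\<bar>?z $ j - ?z' $ j\<bar> \<le> (M + E / \<rho>) * ?B" for j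
    proof -
      have "s $ j \<le> (\<Sum>j\<in>UNIV. s $ j)" using s by (intro member_le_sum) (auto simp: Delta_simplex_def)
      then have sj: "0 \<le> s $ j" "s $ j \<le> 1" using s by (auto simp: Delta_simplex_def)
      have e: "\<bar>exp (l t / \<delta>) - exp (l t' / \<delta>)\<bar> \<le> M * \<bar>t - t'\<bar>"
        using lipschitz_onD[OF el t] by (simp add: dist_real_def)
      have "exp (l t' / \<delta>) \<le> E" unfolding E_def using l0[OF t(2)] delta by (simp add: divide_right_mono)
      have "cmod (((\<chi> i. p (v i) - p (v' i)) :: complex^'n) $ j) \<le> norm ((\<chi> i. p (v i) - p (v' i)) :: complex^'n)"
        by (rule Finite_Cartesian_Product.norm_nth_le)
      moreover have "p (v j) - p (v' j) = of_real (s $ j - s' $ j) * g 0"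
        using s by (simp add: vs p_Lmap algebra_simps)
      ultimately have ds: "\<bar>s $ j - s' $ j\<bar> * \<rho> \<le> norm ((\<chi> i. p (v i) - p (v' i)) :: complex^'n)"
        by (simp add: norm_mult norm_g0 flip: of_real_diff)
      have "?z $ j - ?z' $ j = (exp (l t / \<delta>) - exp (l t' / \<delta>)) * s $ j + exp (l t' / \<delta>) * (s $ j - s' $ j)"
        by (simp add: algebra_simps)
      then have "\<bar>?z $ j - ?z' $ j\<bar> \<le> \<bar>(exp (l t / \<delta>) - exp (l t' / \<delta>)) * s $ j\<bar> + \<bar>exp (l t' / \<delta>) * (s $ j - s' $ j)\<bar>"
        by (simp only: abs_triangle_ineq)
      also have "\<dots> \<le> (M * \<bar>t - t'\<bar>) * 1 + E * (norm ((\<chi> i. p (v i) - p (v' i)) :: complex^'n) / \<rho>)"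
        unfolding abs_mult using e sj ds rho \<open>exp (l t' / \<delta>) \<le> E\<close> M0
        by (intro add_mono mult_mono) (auto simp: field_simps E_def)
      also have "\<dots> \<le> M * ?B + E / \<rho> * ?B"
        using M0 rho by (intro add_mono) (auto simp: E_def intro!: mult_left_mono divide_right_mono)
      finally show ?thesis by (simp only: distrib_right)
    qed
    have "norm ((\<chi> i. p (Psi l t v i) - p (Psi l t' v' i)) :: complex^'n)
        \<le> (\<Sum>i\<in>UNIV. cmod (snd (G ?z i) - snd (G ?z' i)))"
      using norm_vec_le_sum[of "(\<chi> i. p (Psi l t v i) - p (Psi l t' v' i)) :: complex^'n"] z s
      by (simp add: vs Psi_LG p_LG)
    also have "\<dots> \<le> (\<Sum>i\<in>(UNIV::'n set). C * (n * ((M + E / \<rho>) * ?B)))"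
    proof (rule sum_mono)
      fix i
      have "cmod (snd (G ?z i) - snd (G ?z' i)) \<le> norm (G ?z i - G ?z' i)"
        using cmod_snd_le_norm[of "G ?z i - G ?z' i"] by simp
      also have "\<dots> \<le> C * (\<Sum>j\<in>UNIV. \<bar>?z $ j - ?z' $ j\<bar>)" by (rule C(2)[OF z])
      also have "\<dots> \<le> C * (\<Sum>j\<in>(UNIV::'n set). (M + E / \<rho>) * ?B)" by (intro mult_left_mono sum_mono zj C(1))
      finally show "cmod (snd (G ?z i) - snd (G ?z' i)) \<le> C * (n * ((M + E / \<rho>) * ?B))" by (simp add: n_def)
    qed
    finally show ?thesis by (simp add: K_def n_def mult_ac)
  qed
  fix x assume "x \<in> topspace ?D"
  then show "\<exists>W C. openin ?D W \<and> x \<in> W \<and> (\<forall>(t, v)\<in>W. \<forall>(t', v')\<in>W.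
      norm ((\<chi> i. p (Psi l t v i) - p (Psi l t' v' i)) :: complex^'n)
        \<le> C * (\<bar>t - t'\<bar> + norm ((\<chi> i. p (v i) - p (v' i)) :: complex^'n)))"
  proof (intro exI[of _ "topspace ?D"] exI[of _ K] conjI)
    show "openin ?D (topspace ?D)" by (rule openin_topspace)
    show "\<forall>(t, v)\<in>topspace ?D. \<forall>(t', v')\<in>topspace ?D.
      norm ((\<chi> i. p (Psi l t v i) - p (Psi l t' v' i)) :: complex^'n)
        \<le> K * (\<bar>t - t'\<bar> + norm ((\<chi> i. p (v i) - p (v' i)) :: complex^'n))"
      unfolding top using main by blast
  qed
qed

text \<open>A point of the initial simplex lies over \<open>\<gamma> a\<close> exactly when its
  parameters add up to 1; its dilate then has level \<open>l t\<close> and its image sums to the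
  point of the curve. A component at the base point has parameter 0, so its path is
  constant.\<close>

lemma Psi_adapted:
  assumes la: "l a = 0" and l0: "\<And>t. t \<in> {a..1} \<Longrightarrow> 0 \<le> l t \<and> l t \<le> \<Lambda>"
    and el: "M-lipschitz_on {a..1} (\<lambda>t. exp (l t / \<delta>))"
    and gl: "\<And>t. t \<in> {a..1} \<Longrightarrow> g (l t) = \<gamma> t" and ga: "g 0 = \<gamma> a"
  shows "adapted_deformation X p x0 \<gamma> a (Psi l)"
  unfolding adapted_deformation_def Let_def ga[symmetric] Vset_eq
proof (intro conjI ballI allI impI)
  show "loc_lipschitz_coords X p a (LG ` Delta_simplex) (Psi l)" by (rule Psi_loc_lipschitz[OF l0 el])
  fix v :: "'n \<Rightarrow> 'x" assume "v \<in> LG ` Delta_simplex"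
  then obtain s where s: "s \<in> Delta_simplex" "v = LG s" by blast
  show "Psi l a v = v" using s by (simp add: Psi_LG la)
  fix t assume t: "t \<in> {a..1}"
  let ?z = "exp (l t / \<delta>) *\<^sub>R s"
  have z: "?z \<in> Z" using s t l0 by (auto intro!: scaled_simplex_in_Z)
  show "Psi l t v i \<in> topspace X" for i using LG_topspace[OF z] s by (simp add: Psi_LG)
  show "(\<Sum>i\<in>UNIV. p (Psi l t v i)) = \<gamma> t" if "(\<Sum>i\<in>UNIV. p (v i)) = g 0"
  proof -
    have "of_real (\<Sum>i\<in>UNIV. s $ i) * g 0 = g 0"
      using that s by (simp add: p_Lmap sum_distrib_right)
    then have "complex_of_real (\<Sum>i\<in>UNIV. s $ i) = of_real 1" using g0_nonzero by (simp del: of_real_sum)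
    then have s1: "(\<Sum>i\<in>UNIV. s $ i) = 1" by (simp only: of_real_eq_iff)
    then have y: "(\<Sum>i\<in>UNIV. ?z $ i) = exp (l t / \<delta>)" by (simp add: sum_distrib_left[symmetric])
    have y1: "1 \<le> exp (l t / \<delta>)" using l0[OF t] delta by simp
    have "lev ?z = l t" using y1 delta unfolding lev_def mu_def y by simp
    then have "(\<Sum>i\<in>UNIV. G ?z i) = gt (l t)" using sum_G[OF z] y y1 by simp
    then have "snd (\<Sum>i\<in>UNIV. G ?z i) = snd (gt (l t))" by (rule arg_cong)
    then have "(\<Sum>i\<in>UNIV. snd (G ?z i)) = g (l t)" by (simp add: snd_sum gt_def)
    then show ?thesis using s z gl[OF t] by (simp add: Psi_LG p_LG)
  qed
  show "Psi l t v j = x0" if "v j = x0" for j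
  proof -
    have "p x0 = 0" using surface by (simp add: endless_surface_def)
    then have "s $ j = 0" using p_Lmap[OF s(1), of j] that s g0_nonzero by simp
    then have "snd (G (r *\<^sub>R ?z) j) = 0" for r using G_zero[of "r *\<^sub>R ?z" j] by simp
    then have "LG ?z j = x0"
      unfolding LG_def by (intro lift_constant_zero[OF surface path_allowed[OF z]])
    then show ?thesis using s by (simp add: Psi_LG)
  qed
qed

end

section \<open>Choice of the parameters and the lower bound for the weights\<close>

lemma euler_parameters_exist:
  fixes \<delta> \<Lambda> :: real
  assumes delta: "0 < \<delta>" and Lam: "0 \<le> \<Lambda>"
  obtains \<theta> b c h and N :: nat where "0 < \<theta>" "\<theta> < 1" "2 * sqrt 2 \<le> 3 * \<theta>" "c = sqrt 2 / (\<theta> * \<delta>)" "c \<le> b"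
    "sqrt 2 / \<delta> \<le> b" "exp (2 * (b - sqrt 2 / \<delta>) * \<Lambda>) \<le> 2 * \<theta>" "0 < N" "0 \<le> h" "real N * h = \<Lambda>"
    "\<And>u. 0 \<le> u \<Longrightarrow> u \<le> h \<Longrightarrow> exp (- b * u) \<le> 1 - c * u"
proof -
  \<comment> \<open>This is the excess of \<open>b\<close> over \<open>sqrt 2 / \<delta>\<close>: it
    gives \<open>2 * \<kappa> * \<Lambda> \<le> 1 / 4\<close>, and
    \<open>exp (1 / 4) \<le> 4 / 3 \<le> 2 * \<theta>\<close>.\<close>
  define \<kappa> where "\<kappa> = 1 / (8 * (\<Lambda> + 1))"
  define A where "A = sqrt 2 / \<delta>"
  \<comment> \<open>The first bound serves the exponent \<open>3 / \<delta>\<close>; the second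
    makes \<open>c = A / \<theta>\<close> at most \<open>A + \<kappa> / 2\<close>, hence less than
    \<open>b\<close>.\<close>
  define \<theta> where "\<theta> = max (2 * sqrt 2 / 3) (A / (A + \<kappa> / 2))"
  define b where "b = A + \<kappa>"
  define c where "c = sqrt 2 / (\<theta> * \<delta>)"
  have kp: "0 < \<kappa>" using Lam by (simp add: \<kappa>_def)
  have Ap: "0 < A" using delta by (simp add: A_def)
  have s15: "sqrt 2 < 3 / 2" by (rule real_less_lsqrt) (auto simp: power2_eq_square)
  have s1: "1 < sqrt 2" by simp
  have th: "2 * sqrt 2 / 3 \<le> \<theta>" "A / (A + \<kappa> / 2) \<le> \<theta>" by (auto simp: \<theta>_def)
  have th23: "2 / 3 \<le> \<theta>" using th(1) s1 by linarith
  then have th0: "0 < \<theta>" by simp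
  have th1: "\<theta> < 1" using s15 kp Ap by (auto simp: \<theta>_def)
  have cA: "c = A / \<theta>" by (simp add: c_def A_def)
  have cp: "0 < c" using Ap th0 by (simp add: cA)
  have "A \<le> \<theta> * (A + \<kappa> / 2)" using th(2) Ap kp by (simp add: divide_le_eq)
  then have "c \<le> A + \<kappa> / 2" using th0 by (simp add: cA divide_le_eq mult.commute)
  then have cb: "c < b" using kp by (simp add: b_def)
  have bp: "0 < b" using cb cp by simp
  have "2 * (b - A) * \<Lambda> = \<Lambda> / (4 * (\<Lambda> + 1))" using Lam by (simp add: b_def \<kappa>_def field_simps)
  also have "\<dots> \<le> 1 / 4" using Lam by (simp add: divide_le_eq)
  finally have e: "2 * (b - A) * \<Lambda> \<le> 1 / 4" .
  have "exp (1 / 4 :: real) = inverse (exp (- (1 / 4)))" by (simp add: exp_minus)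
  also have "\<dots> \<le> inverse (3 / 4)"
    using exp_ge_add_one_self[of "- (1 / 4) :: real"] by (intro le_imp_inverse_le) auto
  finally have "exp (1 / 4 :: real) \<le> 4 / 3" by simp
  then have e2: "exp (2 * (b - A) * \<Lambda>) \<le> 2 * \<theta>"
    using iffD2[OF exp_le_cancel_iff e] th23 by linarith
  \<comment> \<open>The largest \<open>u\<close> with
    \<open>1 / (1 + b * u) \<le> 1 - c * u\<close>, whose left side dominates
    \<open>exp (- b * u)\<close>.\<close>
  define h0 where "h0 = (b - c) / (b * c)"
  have h0: "0 < h0" using cb bp cp by (simp add: h0_def)
  obtain N where N: "real N > \<Lambda> / h0" using reals_Archimedean2 by blast
  then have Np: "0 < real N" using h0 Lam by (smt (verit) divide_nonneg_pos)
  have hN: "\<Lambda> / real N \<le> h0" using N h0 Np by (simp add: field_simps)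
  show ?thesis
  proof (rule that[of \<theta> c b N "\<Lambda> / real N"])
    show "exp (- b * u) \<le> 1 - c * u" if u: "0 \<le> u" "u \<le> \<Lambda> / real N" for u
    proof -
      have "u \<le> (b - c) / (b * c)" using u hN by (simp add: h0_def)
      then have "u * (b * c) \<le> b - c" using bp cp by (simp add: le_divide_eq)
      then have "u * (u * (b * c)) \<le> u * (b - c)" using u by (intro mult_left_mono) auto
      then have 1: "1 \<le> (1 - c * u) * (1 + b * u)" by (simp add: algebra_simps)
      have bu: "0 < 1 + b * u" using bp u by (simp add: add_pos_nonneg)
      have "exp (- b * u) = inverse (exp (b * u))" by (simp add: exp_minus)
      also have "\<dots> \<le> inverse (1 + b * u)" using bu exp_ge_add_one_self by (intro le_imp_inverse_le)
      also have "\<dots> \<le> 1 - c * u" using 1 bu by (simp add: inverse_eq_divide divide_le_eq)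
      finally show ?thesis .
    qed
  qed (use th0 th1 th cb e2 Np Lam kp in \<open>auto simp: c_def A_def b_def\<close>)
qed

text \<open>The weights cannot all be small: otherwise the sum would be close to a sum of singular points.\<close>

lemma weight_lower_bound:
  fixes v :: "'n::finite \<Rightarrow> real \<times> complex"
  assumes near: "\<And>v. \<exists>u. (u = 0 \<or> u \<in> S_set \<Omega>) \<and> \<theta> * norm (v - u) \<le> \<eta> v" and theta: "0 \<le> \<theta>"
    and w: "\<delta> \<le> norm (\<Sum>i\<in>UNIV. v i)"
      "\<And>q. q \<in> S_set (dfs_pow \<Omega> CARD('n)) \<Longrightarrow> \<delta> \<le> norm ((\<Sum>i\<in>UNIV. v i) - q)"
  shows "\<theta> * \<delta> \<le> (\<Sum>i\<in>UNIV. \<eta> (v i))"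
proof -
  have "\<forall>i. \<exists>u. (u = 0 \<or> u \<in> S_set \<Omega>) \<and> \<theta> * norm (v i - u) \<le> \<eta> (v i)" using near by blast
  from choice[OF this] obtain u where u: "\<forall>i. (u i = 0 \<or> u i \<in> S_set \<Omega>) \<and> \<theta> * norm (v i - u i) \<le> \<eta> (v i)" ..
  have "(\<Sum>i\<in>UNIV. u i) = 0 \<or> (\<Sum>i\<in>UNIV. u i) \<in> S_set (dfs_pow \<Omega> CARD('n))"
    using u by (intro sum_in_S_set_dfs_pow) auto
  then have "\<delta> \<le> norm ((\<Sum>i\<in>UNIV. v i) - (\<Sum>i\<in>UNIV. u i))"
    using w(1) w(2)[of "\<Sum>i\<in>UNIV. u i"] by auto
  also have "\<dots> = norm (\<Sum>i\<in>UNIV. v i - u i)" by (simp add: sum_subtractf)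
  also have "\<dots> \<le> (\<Sum>i\<in>UNIV. norm (v i - u i))" by (rule norm_sum)
  finally have "\<theta> * \<delta> \<le> (\<Sum>i\<in>UNIV. \<theta> * norm (v i - u i))"
    using theta by (simp add: sum_distrib_left[symmetric] mult_left_mono)
  also have "\<dots> \<le> (\<Sum>i\<in>UNIV. \<eta> (v i))" using u by (intro sum_mono) auto
  finally show ?thesis .
qed

lemma S_set_fst_ge:
  assumes "is_dfs \<Omega>" "\<Omega> l = {}" "q \<in> S_set \<Omega>"
  shows "l \<le> fst q"
proof (rule ccontr)
  assume "\<not> l \<le> fst q"
  moreover have "0 \<le> fst q" using assms(3) by (auto simp: S_set_def)
  ultimately have "\<Omega> (fst q) \<subseteq> \<Omega> l" using assms(1) unfolding is_dfs_def by (meson linear)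
  then show False using assms by (auto simp: S_set_def)
qed

lemma abs_fst_le_norm: "\<bar>fst w\<bar> \<le> norm (w :: real \<times> complex)"
  by (metis norm_fst_le prod.collapse real_norm_def)

context euler_lift
begin

text \<open>Excluded are parameters with a vanishing coordinate, those on the face, and those whose
  dilated sum corresponds to a node or lies in \<open>Cr\<close>. All these are preimages of null
  sets of the line under a coordinate or the sum. Elsewhere the dilation multiplies the Jacobian of
  \<open>G\<close> by \<open>exp (l t / \<delta>)\<close>.\<close>

lemma Psi_jacobian:
  fixes l :: "real \<Rightarrow> real"
  assumes lt: "0 \<le> l t" "l t \<le> \<Lambda>"
    and crit: "negligible (Cr :: real set)"
    and gd: "\<And>x. 0 < x \<Longrightarrow> x < \<Lambda> \<Longrightarrow> exp (x / \<delta>) \<notin> Cr \<Longrightarrow>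
      \<exists>g'. (g has_vector_derivative g') (at x) \<and> cmod g' \<le> 1"
  shows "AE s in lebesgue. s \<in> Delta_simplex \<longrightarrow>
    (\<exists>J :: complex^'n^'n.
      (\<forall>i j. ((\<lambda>r. p (Psi l t (\<lambda>j'. Lmap X p x0 (of_real ((s + r *\<^sub>R axis j 1) $ j') * g 0)) i))
         has_vector_derivative J $ i $ j) (at 0))
      \<and> cmod (det J) \<le> (\<rho> * exp (3 / \<delta> * l t)) ^ CARD('n))"
proof -
  define e where "e = exp (l t / \<delta>)"
  have e0: "0 < e" by (simp add: e_def)
  \<comment> \<open>The value 1 excludes the face of the simplex, where perturbed points would leave
    it; the node \<open>k = 0\<close> excludes dilated sums equal to 1, where the two regimes of
    \<open>G\<close> meet.\<close>
  define Bd where "Bd = {1} \<union> (\<lambda>x. x / e) ` ((\<lambda>k. exp (real k * h / \<delta>)) ` {..N} \<union> Cr)"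
  have "negligible ((\<lambda>x. x / e) ` ((\<lambda>k. exp (real k * h / \<delta>)) ` {..N} \<union> Cr))"
    by (intro negligible_differentiable_image_negligible negligible_Un negligible_finite crit
        linear_imp_differentiable_on bounded_linear.linear[OF bounded_linear_divide]) auto
  then have nB: "negligible {s :: real^'n. (\<Sum>i\<in>UNIV. s $ i) \<in> Bd}"
    unfolding Bd_def by (intro negligible_sum_preimage negligible_Un) auto
  have n0: "negligible (\<Union>i. {s :: real^'n. s $ i \<in> {0}})"
    by (intro negligible_Union finite_imageI) (auto intro!: negligible_component_preimage[of "{0}", simplified])
  have null: "{s :: real^'n. (\<Sum>i\<in>UNIV. s $ i) \<in> Bd} \<union> (\<Union>i. {s :: real^'n. s $ i \<in> {0}}) \<in> null_sets lebesgue"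
    using negligible_Un[OF nB n0] unfolding negligible_iff_null_sets .
  show ?thesis
  proof (rule AE_I'[OF null], rule subsetI, rule ccontr)
    fix s :: "real^'n"
    assume bad: "s \<in> {s \<in> space lebesgue. \<not> (s \<in> Delta_simplex \<longrightarrow>
      (\<exists>J :: complex^'n^'n.
        (\<forall>i j. ((\<lambda>r. p (Psi l t (\<lambda>j'. Lmap X p x0 (of_real ((s + r *\<^sub>R axis j 1) $ j') * g 0)) i))
           has_vector_derivative J $ i $ j) (at 0))
        \<and> cmod (det J) \<le> (\<rho> * exp (3 / \<delta> * l t)) ^ CARD('n)))}"
      and ns: "s \<notin> {s. (\<Sum>i\<in>UNIV. s $ i) \<in> Bd} \<union> (\<Union>i. {s. s $ i \<in> {0}})"
    from bad have s: "s \<in> Delta_simplex" by blast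
    define \<sigma> where "\<sigma> = (\<Sum>i\<in>UNIV. s $ i)"
    have sp: "0 < s $ i" for i using ns s by (auto simp: Delta_simplex_def less_le)
    have sB: "\<sigma> \<notin> Bd" using ns by (auto simp: \<sigma>_def)
    then have s1: "\<sigma> < 1" using s by (auto simp: Bd_def Delta_simplex_def \<sigma>_def less_le)
    have eB: "e * \<sigma> \<noteq> exp (real k * h / \<delta>)" if "k \<le> N" for k
      using sB that e0 by (auto simp: Bd_def image_iff field_simps)
    have eC: "e * \<sigma> \<notin> Cr" using sB e0 by (auto simp: Bd_def image_iff field_simps)
    define z where "z = e *\<^sub>R s"
    have y: "(\<Sum>i\<in>UNIV. z $ i) = e * \<sigma>" by (simp add: z_def \<sigma>_def sum_distrib_left)
    have zp: "0 < z $ i" for i using sp e0 by (simp add: z_def)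
    have zZ: "z \<in> Z" unfolding z_def e_def by (rule scaled_simplex_in_Z[OF s lt])
    have lz: "lev z \<le> l t" unfolding z_def e_def by (rule lev_scaled_simplex[OF s lt])
    have "\<exists>J :: complex^'n^'n. (\<forall>i j. ((\<lambda>r. snd (G (z + r *\<^sub>R axis j 1) i)) has_vector_derivative J $ i $ j) (at 0)) \<and>
        cmod (det J) \<le> (\<rho> * exp (2 / \<delta> * lev z)) ^ CARD('n)"
    proof (cases "e * \<sigma> < 1")
      case True
      then have "lev z = 0" by (simp add: lev_def mu_def y)
      then show ?thesis using G_jacobian_small[of z] True y by simp
    next
      case False
      then have y1: "1 < e * \<sigma>" using eB[of 0] by simp
      have el: "exp (lev z / \<delta>) = e * \<sigma>" using y1 delta by (simp add: lev_def mu_def y)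
      obtain k where k: "k < N" "real k * h \<le> lev z" "lev z \<le> real (Suc k) * h"
        using step_index[OF lev_nonneg lev_le[OF zZ]] .
      have ne: "lev z \<noteq> real m * h" if "m \<le> N" for m using eB[OF that] el by auto
      have ks: "real k * h < lev z" "lev z < real (Suc k) * h" "lev z \<noteq> \<Lambda>"
        using k h(2) ne[of k] ne[of "Suc k"] ne[of N] by (simp_all add: less_le del: of_nat_Suc)
      have l0: "0 < lev z" using ks(1) node_bounds(1)[of k] by linarith
      obtain g' where "(g has_vector_derivative g') (at (lev z))" "cmod g' \<le> 1"
        using gd[OF l0] ks(3) lev_le[OF zZ] eC el by auto
      then show ?thesis by (rule G_jacobian_large[OF zp k(1) ks(1,2)])
    qed
    then obtain J :: "complex^'n^'n" where
      J: "\<And>i j. ((\<lambda>r. snd (G (z + r *\<^sub>R axis j 1) i)) has_vector_derivative J $ i $ j) (at 0)"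
      and dJ: "cmod (det J) \<le> (\<rho> * exp (2 / \<delta> * lev z)) ^ CARD('n)" by blast
    let ?J = "(\<chi> i j. of_real e * J $ i $ j) :: complex^'n^'n"
    have "((\<lambda>r. p (Psi l t (\<lambda>j'. Lmap X p x0 (of_real ((s + r *\<^sub>R axis j 1) $ j') * g 0)) i))
         has_vector_derivative ?J $ i $ j) (at 0)" for i j
    proof -
      have "((\<lambda>r. e * r) has_vector_derivative e) (at 0)"
        unfolding has_real_derivative_iff_has_vector_derivative[symmetric] by (auto intro!: derivative_eq_intros)
      moreover have "((\<lambda>r. snd (G (z + r *\<^sub>R axis j 1) i)) has_vector_derivative J $ i $ j) (at (e * 0))"
        using J by simp
      ultimately have "((\<lambda>r. snd (G (z + (e * r) *\<^sub>R axis j 1) i)) has_vector_derivative e *\<^sub>R J $ i $ j) (at 0)"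
        by (rule vector_diff_chain_at[unfolded o_def])
      then have d: "((\<lambda>r. snd (G (z + (e * r) *\<^sub>R axis j 1) i)) has_vector_derivative ?J $ i $ j) (at 0)"
        by (simp add: scaleR_conv_of_real)
      show ?thesis
      proof (rule has_vector_derivative_transform_within_open[OF d, of "{- s $ j<..<1 - \<sigma>}"])
        show "open {- s $ j<..<1 - \<sigma>}" "0 \<in> {- s $ j<..<1 - \<sigma>}" using sp[of j] s1 by auto
        fix r assume r: "r \<in> {- s $ j<..<1 - \<sigma>}"
        let ?s = "s + r *\<^sub>R axis j 1"
        have "(\<Sum>i\<in>UNIV. ?s $ i) = \<sigma> + r"
          by (simp add: sum.distrib sum_distrib_left[symmetric] axis_def sum.delta \<sigma>_def)
        then have S: "?s \<in> Delta_simplex"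
          using r sp by (auto simp: Delta_simplex_def axis_def less_imp_le)
        have "(\<lambda>j'. Lmap X p x0 (of_real (?s $ j') * g 0)) = LG ?s"
          using Lmap_eq_LG[OF S] by (simp add: fun_eq_iff)
        moreover have "e *\<^sub>R ?s = z + (e * r) *\<^sub>R axis j 1" by (simp add: z_def scaleR_add_right)
        moreover have "e *\<^sub>R ?s \<in> Z" unfolding e_def by (rule scaled_simplex_in_Z[OF S lt])
        ultimately show "snd (G (z + (e * r) *\<^sub>R axis j 1) i) =
            p (Psi l t (\<lambda>j'. Lmap X p x0 (of_real (?s $ j') * g 0)) i)"
          using S by (simp add: Psi_LG p_LG e_def[symmetric] del: vector_add_component vector_scaleR_component)
      qed
    qed
    moreover have "cmod (det ?J) \<le> (\<rho> * exp (3 / \<delta> * l t)) ^ CARD('n)"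
    proof -
      have "cmod (det ?J) = e ^ CARD('n) * cmod (det J)"
        unfolding det_scale_rows norm_mult norm_power using e0 by simp
      also have "\<dots> \<le> e ^ CARD('n) * (\<rho> * exp (2 / \<delta> * lev z)) ^ CARD('n)"
        using dJ e0 by (intro mult_left_mono) auto
      also have "\<dots> = (e * (\<rho> * exp (2 / \<delta> * lev z))) ^ CARD('n)" by (simp add: power_mult_distrib)
      also have "\<dots> \<le> (e * (\<rho> * exp (2 / \<delta> * l t))) ^ CARD('n)"
        using rho e0 lz delta by (intro power_mono mult_left_mono) (auto intro!: divide_right_mono)
      also have "e * (\<rho> * exp (2 / \<delta> * l t)) = \<rho> * (exp (l t / \<delta>) * exp (2 / \<delta> * l t))" by (simp add: e_def)
      also have "\<dots> = \<rho> * exp (3 / \<delta> * l t)" by (simp add: exp_add[symmetric] add_divide_distrib[symmetric])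
      finally show ?thesis .
    qed
    ultimately show False using bad by blast
  qed
qed

end

section \<open>Assembly of the deformation for the given path\<close>

theorem theorem4p7:
  fixes \<Omega> :: dfs and \<rho> \<delta> L a :: real and \<gamma> :: "real \<Rightarrow> complex"
    and X :: "'x topology" and p :: "'x \<Rightarrow> complex" and x0 :: 'x
  assumes dfs: "is_dfs \<Omega>"
    and closed_up: "\<forall>l\<ge>0. upper_closure \<Omega> l = \<Omega> l"
    and rho: "\<rho> > 0" and empty3: "\<Omega> (3 * \<rho>) = {}"
    and univ: "universal_endless_surface \<Omega> X p x0"
    and delta: "0 < \<delta>" "\<delta> < \<rho>" and Lpos: "L > 0"
    and gam: "\<gamma> \<in> Pi_set (dfs_pow \<Omega> CARD('n::finite)) \<delta> L"
    and a: "0 < a" "a < 1"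
    and lin: "\<forall>t\<in>{0..a}. \<gamma> t = of_real (t / a) * \<gamma> a"
    and norma: "cmod (\<gamma> a) = \<rho>"
    and C1: "C1_on_interval \<gamma> a 1"
  shows "\<exists>\<Psi> :: real \<Rightarrow> ('n \<Rightarrow> 'x) \<Rightarrow> ('n \<Rightarrow> 'x).
           adapted_deformation X p x0 \<gamma> a \<Psi> \<and>
           (\<forall>t\<in>{a..1}.
              (\<forall>v\<in>(Vset X p x0 (\<gamma> a) :: ('n \<Rightarrow> 'x) set).
                 \<exists>Ls :: 'n \<Rightarrow> real. (\<Sum>i\<in>UNIV. Ls i) = path_length \<gamma> 0 t \<and>
                   (\<forall>i. \<Psi> t v i \<in> K_set \<Omega> X p x0
                          (\<rho> * exp (- 2 * sqrt 2 / \<delta> * path_length \<gamma> a t)) (Ls i))) \<and>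
              (let \<zeta> = (\<lambda>(s :: real^'n) (i :: 'n).
                          p (\<Psi> t (\<lambda>j. Lmap X p x0 (of_real (s $ j) * \<gamma> a)) i))
               in AE s in lebesgue. s \<in> Delta_simplex \<longrightarrow>
                    (\<exists>J :: complex^'n^'n.
                       (\<forall>i j. ((\<lambda>r. \<zeta> (s + r *\<^sub>R axis j 1) i) has_vector_derivative J $ i $ j) (at 0))
                       \<and> cmod (det J) \<le> (\<rho> * exp (3 / \<delta> * path_length \<gamma> a t)) ^ CARD('n))))"
proof -
  have es: "endless_surface \<Omega> X p x0" using univ by (simp add: universal_endless_surface_def)
  let ?pow = "dfs_pow \<Omega> CARD('n)"
  have al: "allowed ?pow 1 \<gamma>"
    and gfar: "\<And>t q. t \<in> {0..1} \<Longrightarrow> q \<in> S_set ?pow \<Longrightarrow> \<delta> \<le> dist (path_length \<gamma> 0 t, \<gamma> t) q"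
    using gam by (auto simp: Pi_set_def)
  obtain Lg where Lg: "Lg-lipschitz_on {0..1} \<gamma>" and \<gamma>0: "\<gamma> 0 = 0" using al by (auto simp: allowed_def)
  obtain D where cD: "continuous_on {a..1} D"
    and der: "\<And>x. x \<in> {a..1} \<Longrightarrow> (\<gamma> has_vector_derivative D x) (at x within {a..1})"
    using C1 by (auto simp: C1_on_interval_def)
  define l where "l t = integral {a..t} (\<lambda>x. cmod (D x))" for t
  have a1: "a \<le> 1" using a by simp
  obtain g where gl: "\<And>t. t \<in> {a..1} \<Longrightarrow> g (l t) = \<gamma> t"
    and glip: "\<And>s t. 0 \<le> s \<Longrightarrow> s \<le> t \<Longrightarrow> t \<le> l 1 \<Longrightarrow> cmod (g t - g s) \<le> t - s"
    and gder: "\<And>t. t \<in> {a..1} \<Longrightarrow> D t \<noteq> 0 \<Longrightarrow> 0 < l t \<Longrightarrow> l t < l 1 \<Longrightarrow>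
        \<exists>g'. (g has_vector_derivative g') (at (l t)) \<and> cmod g' \<le> 1"
    and la: "l a = 0" and lmono: "\<And>s t. a \<le> s \<Longrightarrow> s \<le> t \<Longrightarrow> t \<le> 1 \<Longrightarrow> l s \<le> l t"
    and dl: "\<And>t. t \<in> {a..1} \<Longrightarrow> (l has_real_derivative cmod (D t)) (at t within {a..1})"
    and lsurj: "\<And>x. 0 \<le> x \<Longrightarrow> x \<le> l 1 \<Longrightarrow> \<exists>t\<in>{a..1}. l t = x"
    by (rule arclength_reparametrisation[OF a1 cD der l_def], assumption) (rule that)
  have l0: "0 \<le> l t \<and> l t \<le> l 1" if "t \<in> {a..1}" for t
    using lmono[of a t] lmono[of t 1] that la by auto
  have Lam: "0 \<le> l 1" using l0[of 1] a1 by auto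
  have ga: "g 0 = \<gamma> a" using gl[of a] la a1 by simp
  have lenA: "l t \<le> path_length \<gamma> a t" if t: "t \<in> {a..1}" for t
    unfolding l_def
  proof (rule integral_speed_le_path_length)
    show "Lg-lipschitz_on {a..t} \<gamma>" using a t by (intro lipschitz_on_subset[OF Lg]) auto
    show "continuous_on {a..t} D" using t by (intro continuous_on_subset[OF cD]) auto
    show "(\<gamma> has_vector_derivative D x) (at x within {a..t})" if "x \<in> {a..t}" for x
      using that t by (intro has_vector_derivative_within_subset[OF der]) auto
  qed (use t in auto)
  have len0: "\<rho> + l t \<le> path_length \<gamma> 0 t" if t: "t \<in> {a..1}" for t
  proof -
    have "cmod (\<gamma> a - \<gamma> 0) + path_length \<gamma> a t \<le> path_length \<gamma> 0 t"
      by (rule path_length_superadditive[OF lipschitz_on_subset[OF Lg]]) (use a t in auto)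
    then show ?thesis using lenA[OF t] by (simp add: \<gamma>0 norma)
  qed
  have far: "\<delta> \<le> norm ((\<rho> + x, g x) - q)" if x: "0 \<le> x" "x \<le> l 1" and q: "q \<in> S_set ?pow" for x q
  proof -
    obtain t where t: "t \<in> {a..1}" "l t = x" using lsurj[OF x] by blast
    \<comment> \<open>The scheme works with the lower bound \<open>\<rho> + x\<close> for the
      length. Raising \<open>q\<close> by the difference keeps it singular and preserves the
      difference vector.\<close>
    define q' where "q' = (fst q + (path_length \<gamma> 0 t - (\<rho> + x)), snd q)"
    have q0: "0 \<le> fst q" "snd q \<in> ?pow (fst q)" using q by (auto simp: S_set_def)
    have "fst q \<le> fst q'" using len0[OF t(1)] t(2) by (simp add: q'_def)
    then have "q' \<in> S_set ?pow"
      using dfs_pow_mono[OF dfs q0(1), of "fst q'" "CARD('n)"] q0 by (auto simp: S_set_def q'_def)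
    then have "\<delta> \<le> dist (path_length \<gamma> 0 t, \<gamma> t) q'" using t a by (intro gfar) auto
    also have "\<dots> = norm ((\<rho> + x, g x) - q)"
      using gl[OF t(1)] t(2) by (simp add: q'_def dist_norm norm_prod_def)
    finally show ?thesis .
  qed
  obtain \<theta> b c h and N :: nat where th: "0 < \<theta>" "\<theta> < 1" "2 * sqrt 2 \<le> 3 * \<theta>" "c = sqrt 2 / (\<theta> * \<delta>)" "c \<le> b"
    "sqrt 2 / \<delta> \<le> b" "exp (2 * (b - sqrt 2 / \<delta>) * l 1) \<le> 2 * \<theta>" "0 < N" "0 \<le> h" "real N * h = l 1"
    "\<And>u. 0 \<le> u \<Longrightarrow> u \<le> h \<Longrightarrow> exp (- b * u) \<le> 1 - c * u"
    by (rule euler_parameters_exist[OF delta(1) Lam]) (rule that)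
  \<comment> \<open>Components have length coordinate at most \<open>\<rho> + l 1\<close>, so
    singular points above the level chosen here are at distance more than \<open>2 * \<rho>\<close>
    and finitely many rays suffice.\<close>
  have B0: "0 \<le> 3 * \<rho> + l 1" using rho Lam by simp
  obtain R where R: "finite R" "R \<subseteq> S_set \<Omega>"
    "\<And>q. q \<in> S_set \<Omega> \<Longrightarrow> fst q \<le> 3 * \<rho> + l 1 \<Longrightarrow> \<exists>r\<in>R. fst r \<le> fst q \<and> snd r = snd q"
    by (rule S_set_finite_rays[OF dfs closed_up B0]) (rule that)
  obtain \<eta> :: "real \<times> complex \<Rightarrow> real" where eta: "\<And>v. 0 \<le> \<eta> v" "\<And>v. \<eta> v \<le> norm v"
    "\<And>v w. \<bar>\<eta> v - \<eta> w\<bar> \<le> norm (v - w)"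
    "\<And>v r q. r \<in> R \<Longrightarrow> fst r \<le> fst q \<Longrightarrow> snd r = snd q \<Longrightarrow> \<eta> v \<le> norm (v - q)"
    "\<And>v. \<exists>u. (u = 0 \<or> (\<exists>r\<in>R. fst r \<le> fst u \<and> snd r = snd u)) \<and> \<theta> * norm (v - u) \<le> \<eta> v"
    "\<And>v. 0 < \<eta> v \<Longrightarrow> \<eta> differentiable (at v)"
    by (rule regularised_distance_exists[OF R(1) th(1,2)]) (rule that)
  have near: "\<exists>u. (u = 0 \<or> u \<in> S_set \<Omega>) \<and> \<theta> * norm (v - u) \<le> \<eta> v" for v
  proof -
    obtain u where u: "u = 0 \<or> (\<exists>r\<in>R. fst r \<le> fst u \<and> snd r = snd u)" "\<theta> * norm (v - u) \<le> \<eta> v"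
      using eta(5) by blast
    have "u = 0 \<or> u \<in> S_set \<Omega>" using u(1) R(2) S_set_upward[OF dfs, of _ u] by auto
    then show ?thesis using u(2) by blast
  qed
  have S3: "3 * \<rho> \<le> fst q" if "q \<in> S_set \<Omega>" for q by (rule S_set_fst_ge[OF dfs empty3 that])
  have S3n: "3 * \<rho> - norm w \<le> norm (w - q)" if "q \<in> S_set \<Omega>" for w q
    using S3[OF that] abs_fst_le_norm[of "q"] norm_triangle_ineq2[of q w] by (simp add: norm_minus_commute)
  interpret euler_scheme \<eta> \<theta> \<delta> \<rho> h "l 1" b c N g "TYPE('n)"
  proof
    show "\<theta> * norm v \<le> \<eta> v" if v: "norm v \<le> sqrt 2 * \<rho>" for v
    proof -
      obtain u where u: "u = 0 \<or> u \<in> S_set \<Omega>" "\<theta> * norm (v - u) \<le> \<eta> v" using near by blast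
      have "norm v \<le> norm (v - u)"
      proof (cases "u = 0")
        case False
        \<comment> \<open>So \<open>3 * \<rho> - sqrt 2 * \<rho>\<close> is at least
          \<open>sqrt 2 * \<rho>\<close>: for such \<open>v\<close> no singular point is nearer than
          the origin.\<close>
        have "2 * sqrt 2 * \<rho> \<le> 3 * \<rho>" using th(2,3) rho by (intro mult_right_mono) auto
        then show ?thesis using False u(1) S3n[of u v] v by simp
      qed simp
      then show ?thesis using u(2) th(1) by (meson less_imp_le mult_left_mono order_trans)
    qed
    show "\<theta> * \<delta> \<le> (\<Sum>i\<in>UNIV. \<eta> (v i))"
      if x: "0 \<le> x" "x \<le> l 1" and v: "(\<Sum>i\<in>UNIV. v i) = (\<rho> + x, g x)" for v :: "'n \<Rightarrow> real \<times> complex" and x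
    proof (rule weight_lower_bound[OF near])
      show "\<delta> \<le> norm (\<Sum>i\<in>UNIV. v i)"
        using abs_fst_le_norm[of "(\<rho> + x, g x)"] x delta by (simp add: v)
      show "\<delta> \<le> norm ((\<Sum>i\<in>UNIV. v i) - q)" if "q \<in> S_set ?pow" for q
        unfolding v by (rule far[OF x that])
    qed (use th in simp)
    show "cmod (g t - g s) \<le> t - s" if "0 \<le> s" "s \<le> t" "t \<le> l 1" for s t using that by (rule glip)
    show "exp (- b * u) \<le> 1 - c * u" if "0 \<le> u" "u \<le> h" for u using that by (rule th(11))
    show "\<eta> differentiable at v" if "0 < \<eta> v" for v using that by (rule eta(6))
    show "cmod (g 0) = \<rho>" by (simp add: ga norma)
  qed (fact eta(1,2,3) rho delta th)+
  \<comment> \<open>Apart from the case covered by \<eta>, the distance is at least \<rho> for one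
    of two reasons: \<open>q\<close> lies far above all lengths that occur, or \<open>w\<close> is
    within \<open>2 * \<rho>\<close> of the origin while \<open>q\<close> has length at least
    \<open>3 * \<rho>\<close>.\<close>
  have avoid: "d \<le> norm (w - q)"
    if d: "d \<le> \<rho>" and q: "q \<in> S_set \<Omega>" and w: "fst w \<le> \<rho> + l 1" "norm w \<le> 2 * \<rho> \<or> d \<le> \<eta> w" for d w q
  proof -
    have "norm (w - q) \<ge> d" if "fst q \<le> 3 * \<rho> + l 1" "d \<le> \<eta> w"
      using R(3)[OF q that(1)] eta(4) that(2) by (meson order_trans)
    moreover have "norm (w - q) \<ge> \<rho>" if "\<not> fst q \<le> 3 * \<rho> + l 1"
      using abs_fst_le_norm[of "w - q"] w(1) that rho by simp
    moreover have "norm (w - q) \<ge> \<rho>" if "norm w \<le> 2 * \<rho>" using S3n[OF q, of w] that by simp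
    ultimately show ?thesis using w(2) d by linarith
  qed
  have dle: "\<rho> * exp (- 2 * sqrt 2 / \<delta> * x) \<le> \<rho>" if "0 \<le> x" for x
    using that rho delta by (simp add: mult_le_cancel_left1)
  \<comment> \<open>\<open>x\<close> is a level of the scheme and \<open>y\<close> the possibly
    larger \<open>path_length\<close> of the claim; the required distance decreases in
    \<open>y\<close>.\<close>
  have path_Pi: "(\<lambda>r. snd (G (r *\<^sub>R z) i)) \<in> Pi_set \<Omega> (\<rho> * exp (- 2 * sqrt 2 / \<delta> * y)) L'"
    if "z \<in> Z" "lev z \<le> x" "x \<le> l 1" "x \<le> y" "fst (G z i) \<le> L'" for z i x y L'
  proof (rule G_path_in_Pi_set[OF dfs _ that(1-3)])
    have y0: "0 \<le> y" using lev_nonneg[of z] that by linarith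
    show "\<rho> * exp (- 2 * sqrt 2 / \<delta> * y) \<le> norm (w - q)"
      if "q \<in> S_set \<Omega>" "fst w \<le> \<rho> + l 1" "norm w \<le> 2 * \<rho> \<or> \<rho> * exp (- 2 * sqrt 2 / \<delta> * y) \<le> \<eta> w" for w q
      using avoid[OF dle[OF y0]] that by blast
    show "0 < \<rho> * exp (- 2 * sqrt 2 / \<delta> * y)" using rho by simp
    show "\<rho> * exp (- 2 * sqrt 2 / \<delta> * y) \<le> \<rho> * exp (- 2 * sqrt 2 / \<delta> * x)"
      using that(4) rho delta by (auto intro!: mult_left_mono divide_right_mono)
  qed (use that in auto)
  interpret euler_lift \<eta> \<theta> \<delta> \<rho> h "l 1" b c N g "TYPE('n)" \<Omega> X p x0
  proof
    show "allowed \<Omega> 1 (\<lambda>r. snd (G (r *\<^sub>R z) i))" if "z \<in> Z" for z i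
      using path_Pi[OF that lev_le[OF that] order_refl order_refl order_refl, of i] by (auto simp: Pi_set_def)
  qed (rule es)
  define D' where "D' t = exp (l t / \<delta>) * (cmod (D t) / \<delta>)" for t
  have dD': "((\<lambda>t. exp (l t / \<delta>)) has_real_derivative D' t) (at t within {a..1})" if "t \<in> {a..1}" for t
    unfolding D'_def using delta by (auto intro!: derivative_eq_intros dl[OF that])
  have cl: "continuous_on {a..1} l" by (rule DERIV_continuous_on[OF dl])
  have "continuous_on {a..1} D'" unfolding D'_def using delta by (intro continuous_intros cl cD) auto
  then have "bounded (D' ` {a..1})" by (intro compact_imp_bounded compact_continuous_image compact_Icc)
  then obtain M where "\<forall>x\<in>D' ` {a..1}. norm x \<le> M" unfolding bounded_iff by blast
  then have M: "\<And>t. t \<in> {a..1} \<Longrightarrow> norm (D' t) \<le> M" by blast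
  have M0: "0 \<le> M" using M[of a] a1 norm_ge_zero[of "D' a"] by auto
  have el: "M-lipschitz_on {a..1} (\<lambda>t. exp (l t / \<delta>))"
  proof (rule lipschitz_onI[OF _ M0])
    fix s t assume "s \<in> {a..1}" "t \<in> {a..1}"
    then show "dist (exp (l s / \<delta>)) (exp (l t / \<delta>)) \<le> M * dist s t"
      unfolding dist_norm by (intro field_differentiable_bound[OF _ dD' M]) auto
  qed
  have ad: "adapted_deformation X p x0 \<gamma> a (Psi l)" by (rule Psi_adapted[OF la l0 el gl ga])
  \<comment> \<open>The levels of zero speed are recorded through the exponential, because they are
    compared with sums of dilated parameters.\<close>
  let ?Cr = "(\<lambda>t. exp (l t / \<delta>)) ` {t \<in> {a..1}. D t = 0}"
  have nCr: "negligible ?Cr"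
  proof (rule negligible_critical_values)
    fix t assume t: "t \<in> {t \<in> {a..1}. D t = 0}"
    have "((\<lambda>t. exp (l t / \<delta>)) has_real_derivative D' t) (at t within {t \<in> {a..1}. D t = 0})"
      by (rule has_field_derivative_subset[OF dD']) (use t in auto)
    then show "((\<lambda>t. exp (l t / \<delta>)) has_real_derivative 0) (at t within {t \<in> {a..1}. D t = 0})"
      using t by (simp add: D'_def)
  qed
  have gd: "\<exists>g'. (g has_vector_derivative g') (at x) \<and> cmod g' \<le> 1"
    if x: "0 < x" "x < l 1" "exp (x / \<delta>) \<notin> ?Cr" for x
  proof -
    obtain t where t: "t \<in> {a..1}" "l t = x" using lsurj[of x] x by auto
    then show ?thesis using gder[of t] x by auto
  qed
  have jac: "AE s in lebesgue. s \<in> Delta_simplex \<longrightarrow>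
      (\<exists>J :: complex^'n^'n.
        (\<forall>i j. ((\<lambda>r. p (Psi l t (\<lambda>j'. Lmap X p x0 (of_real ((s + r *\<^sub>R axis j 1) $ j') * \<gamma> a)) i))
           has_vector_derivative J $ i $ j) (at 0))
        \<and> cmod (det J) \<le> (\<rho> * exp (3 / \<delta> * path_length \<gamma> a t)) ^ CARD('n))"
    if t: "t \<in> {a..1}" for t
  proof -
    have "(\<rho> * exp (3 / \<delta> * l t)) ^ CARD('n) \<le> (\<rho> * exp (3 / \<delta> * path_length \<gamma> a t)) ^ CARD('n)"
      using rho lenA[OF t] delta by (intro power_mono mult_left_mono) (auto intro!: divide_right_mono)
    then have mono: "x \<le> (\<rho> * exp (3 / \<delta> * path_length \<gamma> a t)) ^ CARD('n)"
      if "x \<le> (\<rho> * exp (3 / \<delta> * l t)) ^ CARD('n)" for x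
      using that by linarith
    have "AE s in lebesgue. s \<in> Delta_simplex \<longrightarrow>
      (\<exists>J :: complex^'n^'n.
        (\<forall>i j. ((\<lambda>r. p (Psi l t (\<lambda>j'. Lmap X p x0 (of_real ((s + r *\<^sub>R axis j 1) $ j') * g 0)) i))
           has_vector_derivative J $ i $ j) (at 0))
        \<and> cmod (det J) \<le> (\<rho> * exp (3 / \<delta> * l t)) ^ CARD('n))"
      by (rule Psi_jacobian[OF _ _ nCr]) (use l0[OF t] gd in auto)
    then show ?thesis
      unfolding ga by (rule eventually_mono) (use mono in blast)
  qed
  have K: "\<exists>Ls :: 'n \<Rightarrow> real. (\<Sum>i\<in>UNIV. Ls i) = path_length \<gamma> 0 t \<and>
      (\<forall>i. Psi l t v i \<in> K_set \<Omega> X p x0 (\<rho> * exp (- 2 * sqrt 2 / \<delta> * path_length \<gamma> a t)) (Ls i))"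
    if t: "t \<in> {a..1}" and v: "v \<in> Vset X p x0 (\<gamma> a)" for t and v :: "'n \<Rightarrow> 'x"
  proof -
    obtain s where s: "s \<in> Delta_simplex" "v = LG s" using v Vset_eq unfolding ga by blast
    let ?z = "exp (l t / \<delta>) *\<^sub>R s"
    have z: "?z \<in> Z" "lev ?z \<le> l t"
      using s(1) l0[OF t] by (auto intro!: scaled_simplex_in_Z lev_scaled_simplex)
    \<comment> \<open>The lengths must add up exactly to that of \<gamma>. The slack is shared
      equally, which is possible because \<open>Pi_set\<close> grows with its length bound.\<close>
    define sp where "sp = (path_length \<gamma> 0 t - (\<Sum>i\<in>UNIV. fst (G ?z i))) / real CARD('n)"
    have "(\<Sum>i\<in>UNIV. fst (G ?z i)) \<le> path_length \<gamma> 0 t"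
      using sum_fst_G_le[OF z(1)] z(2) len0[OF t] by linarith
    then have sp: "0 \<le> sp" by (simp add: sp_def)
    show ?thesis
    proof (intro exI[of _ "\<lambda>i. fst (G ?z i) + sp"] conjI allI)
      show "(\<Sum>i\<in>UNIV. fst (G ?z i) + sp) = path_length \<gamma> 0 t" by (simp add: sum.distrib sp_def)
      fix i
      have "(\<lambda>r. snd (G (r *\<^sub>R ?z) i)) \<in> Pi_set \<Omega> (\<rho> * exp (- 2 * sqrt 2 / \<delta> * path_length \<gamma> a t)) (fst (G ?z i) + sp)"
        using z l0[OF t] lenA[OF t] sp by (intro path_Pi[where x = "l t"]) auto
      then show "Psi l t v i \<in> K_set \<Omega> X p x0 (\<rho> * exp (- 2 * sqrt 2 / \<delta> * path_length \<gamma> a t)) (fst (G ?z i) + sp)"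
        unfolding K_set_def s(2) Psi_LG[OF s(1)] LG_def by blast
    qed
  qed
  show ?thesis
    using ad K jac unfolding Let_def by (intro exI[of _ "Psi l"]) blast
qed

end
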